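(* Let $k$ be a field, let $C,D$ be $k$-coalgebras, $L$ a right $C$-comodule, $M$ a $C$-$D$-bicomodule, and $N$ a right pseudocompact $D$-contramodule. There is an isomorphism of vector spaces, natural in $L$, $M$ and $N$, $$\mathrm{Hom}_D(N, L\,\square_C\, M)\cong \mathrm{Hom}_C(h(M,N),L),$$ where $h(M,N)=\mathrm{Hom}_D(N,M)^*$ with its natural structure of pseudocompact right $C$-contramodule, and where both $\mathrm{Hom}$'s denote spaces of homomorphisms from a pseudocompact contramodule to a comodule.
   Context: Let $k$ be a field, regarded as a discrete topological ring; $\otimes$ means $\otimes_k$. Coalgebras are coassociative counital $k$-coalgebras, and they and all comodules are discrete vector spaces. A pseudocompact vector space is a topological $k$-vector space that is an inverse limit of finite dimensional discrete vector spaces. For topological vector spaces $V,W$, $\mathrm{Hom}_k(V,W)$ denotes the space of continuous linear maps, with the compact-open topology, and $V^*=\mathrm{Hom}_k(V,k)$; if $A$ is discrete and $Z$ pseudocompact then $\mathrm{Hom}_k(A,Z)$ is pseudocompact. For discrete $A,B$ and pseudocompact $Z$, $\psi_{A,Z}^B:\mathrm{Hom}_k(A,\mathrm{Hom}_k(B,Z))\to\mathrm{Hom}_k(A\otimes B,Z)$ is the natural isomorphism $\psi_{A,Z}^B(\gamma)(a\otimes b)=\gamma(a)(b)$. Let $(E,\Delta,\varepsilon)$ be a coalgebra. Contramodules. A (right) pseudocompact $E$-contramodule is a pair $(Z,\theta)$ with $Z$ a pseudocompact vector space and $\theta:\mathrm{Hom}_k(E,Z)\to Z$ continuous linear such that $\theta\circ\mathrm{Hom}_k(E,\theta)=\theta\circ\mathrm{Hom}_k(\Delta,Z)\circ\psi_{E,Z}^E$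 as maps $\mathrm{Hom}_k(E,\mathrm{Hom}_k(E,Z))\to Z$, and $\theta\circ\mathrm{Hom}_k(\varepsilon,Z):\mathrm{Hom}_k(k,Z)\to Z$ is the canonical isomorphism. A homomorphism $(Z,\theta)\to(T,\eta)$ of contramodules is a continuous linear map $\alpha$ with $\alpha\theta=\eta\circ\mathrm{Hom}_k(E,\alpha)$. Homomorphisms from contramodules to comodules. Let $(N,\theta)$ be a right pseudocompact $E$-contramodule and $(M,\mu:M\to M\otimes E)$ a right $E$-comodule. A homomorphism $(N,\theta)\to(M,\mu)$ is a continuous linear map $\gamma:N\to M$ with $\overline{\psi}(\gamma\theta)=\mu\gamma$, where $\overline{\psi}:\mathrm{Hom}_k(\mathrm{Hom}_k(E,N),M)\to\mathrm{Hom}_k(N,M\otimes E)$ is the natural isomorphism dual to the adjunction $\mathrm{Hom}_k(M^*\widehat{\otimes}E^*,N^* )\cong\mathrm{Hom}_k(M^*,\mathrm{Hom}_k(E^*,N^* ))$ ($\widehat\otimes$ the completed tensor product), under the identifications $(M\otimes E)^*=M^*\widehat\otimes E^*$ and $\mathrm{Hom}_k(E,N)^*=\mathrm{Hom}_k(E^*,N^* )$. Explicitly, $\overline{\psi}(f)$ is determined by $(\mathrm{id}_M\otimes\xi)(\overline{\psi}(f)(n))=f\big(e\mapsto \xi(e)n\big)$ for all $n\in N$, $\xi\in E^*$. The vector space of such homomorphisms is denoted $\mathrm{Hom}_E(N,M)$. Cotensor product. For a right $C$-comodule $(L,\mu_L)$ and a $C$-$D$-bicomodule $M$ with left coaction $\lambda:M\to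 C\otimes M$, $L\,\square_C\,M$ is the kernel of $\mu_L\otimes\mathrm{id}_M-\mathrm{id}_L\otimes\lambda:L\otimes M\to L\otimes C\otimes M$, a right $D$-comodule via the right $D$-coaction of $M$. The functor $h$. Let $M$ be a $C$-$D$-bicomodule with left coaction $\lambda$ and $N$ a right pseudocompact $D$-contramodule. The (discrete) vector space $\mathrm{Hom}_D(N,M)$ has a natural left $C$-comodule structure $\rho:\mathrm{Hom}_D(N,M)\to C\otimes\mathrm{Hom}_D(N,M)$, obtained by duality from the discrete right $C^*$-module $\mathrm{Hom}_{D^*}(M^*,N^* )$ of continuous right $D^*$-module homomorphisms; explicitly, $\rho$ is determined by $(f\otimes\mathrm{id})(\rho(\gamma))=(f\otimes\mathrm{id}_M)\circ\lambda\circ\gamma$ for all $f\in C^*$, $\gamma\in\mathrm{Hom}_D(N,M)$. For any left $C$-comodule $(X,\rho)$, the dual $X^*$ is a pseudocompact right $C$-contramodule with structure map $\rho^*\circ\psi_{C,k}^X:\mathrm{Hom}_k(C,X^* )\to(C\otimes X)^*\to X^*$. Applied to $X=\mathrm{Hom}_D(N,M)$ this gives the pseudocompact right $C$-contramodule $h(M,N):=\mathrm{Hom}_D(N,M)^*$. *)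

theory Defs
  imports "HOL-Analysis.Analysis" "HOL-Library.Function_Algebras"
begin

section \<open>Topological vector spaces\<close>

text \<open>The field \<open>k\<close> is a type \<open>'k::field\<close>.  A topological vector space is a subspace of an
  ambient vector space \<open>('v, sc)\<close>, carrying a topology; its underlying set is the topspace of that
  topology.  So all spaces and maps below are relative to a carrier set, and a linear map is
  normalised to be \<open>0\<close> outside its domain, so that linear maps can be compared by \<open>=\<close> and added
  pointwise.\<close>

record ('k, 'v) tvs =
  tp :: "'v topology"
  sc :: "'k \<Rightarrow> 'v \<Rightarrow> 'v"

abbreviation carr :: "('k, 'v, 'x) tvs_scheme \<Rightarrow> 'v set" where
  "carr V \<equiv> topspace (tp V)"

definition vec :: "('k::field, 'v::ab_group_add, 'x) tvs_scheme \<Rightarrow> bool" where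
  "vec V \<longleftrightarrow> vector_space (sc V) \<and> module.subspace (sc V) (carr V)"

definition top_vec :: "('k::field, 'v::ab_group_add, 'x) tvs_scheme \<Rightarrow> bool" where
  "top_vec V \<longleftrightarrow> vec V
     \<and> continuous_map (prod_topology (tp V) (tp V)) (tp V) (\<lambda>(x, y). x + y)
     \<and> continuous_map (prod_topology (discrete_topology UNIV) (tp V)) (tp V) (\<lambda>(c, x). sc V c x)"

definition discrete_vec :: "('k::field, 'v::ab_group_add, 'x) tvs_scheme \<Rightarrow> bool" where
  "discrete_vec V \<longleftrightarrow> vec V \<and> tp V = discrete_topology (carr V)"

definition fin_dim :: "('k::field, 'v::ab_group_add, 'x) tvs_scheme \<Rightarrow> bool" where
  "fin_dim V \<longleftrightarrow> (\<exists>B. finite B \<and> B \<subseteq> carr V \<and> carr V \<subseteq> module.span (sc V) B)"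

definition lin :: "('k, 'v::ab_group_add, 'x) tvs_scheme \<Rightarrow> ('k, 'w::ab_group_add, 'y) tvs_scheme
    \<Rightarrow> ('v \<Rightarrow> 'w) \<Rightarrow> bool" where
  "lin V W f \<longleftrightarrow> f ` carr V \<subseteq> carr W
     \<and> (\<forall>x\<in>carr V. \<forall>y\<in>carr V. f (x + y) = f x + f y)
     \<and> (\<forall>c. \<forall>x\<in>carr V. f (sc V c x) = sc W c (f x))
     \<and> (\<forall>x. x \<notin> carr V \<longrightarrow> f x = 0)"

definition lin_iso :: "('k, 'v::ab_group_add, 'x) tvs_scheme \<Rightarrow> ('k, 'w::ab_group_add, 'y) tvs_scheme
    \<Rightarrow> ('v \<Rightarrow> 'w) \<Rightarrow> bool" where
  "lin_iso V W f \<longleftrightarrow> lin V W f \<and> bij_betw f (carr V) (carr W)"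

definition hom_set :: "('k, 'v::ab_group_add, 'x) tvs_scheme \<Rightarrow> ('k, 'w::ab_group_add, 'y) tvs_scheme
    \<Rightarrow> ('v \<Rightarrow> 'w) set" where
  "hom_set V W = {f. lin V W f \<and> continuous_map (tp V) (tp W) f}"

text \<open>\<open>Hom\<^sub>k(V, W)\<close> with the compact-open topology.\<close>

definition Homk :: "('k, 'v::ab_group_add, 'x) tvs_scheme \<Rightarrow> ('k, 'w::ab_group_add, 'y) tvs_scheme
    \<Rightarrow> ('k, 'v \<Rightarrow> 'w) tvs" where
  "Homk V W = \<lparr>tp = topology_generated_by
      {{f \<in> hom_set V W. f ` K \<subseteq> U} | K U. compactin (tp V) K \<and> openin (tp W) U},
     sc = (\<lambda>c f x. sc W c (f x))\<rparr>"

lemma carr_Homk [simp]: "carr (Homk V W) = hom_set V W"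
proof -
  have "\<Union>{{f \<in> hom_set V W. f ` K \<subseteq> U} | K U. compactin (tp V) K \<and> openin (tp W) U} = hom_set V W"
    (is "\<Union>?S = _")
  proof
    have "compactin (tp V) {}" "openin (tp W) {}" by auto
    then have "{f \<in> hom_set V W. f ` {} \<subseteq> {}} \<in> ?S" by blast
    then have "hom_set V W \<in> ?S" by simp
    then show "hom_set V W \<subseteq> \<Union>?S" by blast
  qed blast
  then show ?thesis
    by (simp add: Homk_def topology_generated_by_topspace)
qed

definition fld :: "('k::field, 'k) tvs" where
  "fld = \<lparr>tp = discrete_topology UNIV, sc = (*)\<rparr>"

abbreviation dual :: "('k::field, 'v::ab_group_add, 'x) tvs_scheme \<Rightarrow> ('k, 'v \<Rightarrow> 'k) tvs" where
  "dual V \<equiv> Homk V fld"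

text \<open>Transpose \<open>Y\<^sup>* \<rightarrow> X\<^sup>*\<close> of a map \<open>f : X \<rightarrow> Y\<close>.\<close>

definition dual_map :: "('k::field, 'w::ab_group_add, 'y) tvs_scheme \<Rightarrow> ('v \<Rightarrow> 'w)
    \<Rightarrow> (('w \<Rightarrow> 'k) \<Rightarrow> ('v \<Rightarrow> 'k))" where
  "dual_map Y f = (\<lambda>\<phi>. if \<phi> \<in> carr (dual Y) then \<phi> \<circ> f else 0)"

subsection \<open>Pseudocompact vector spaces\<close>

definition inverse_system :: "'i set \<Rightarrow> 'i rel \<Rightarrow> ('i \<Rightarrow> ('k::field, 'v::ab_group_add) tvs)
    \<Rightarrow> ('i \<Rightarrow> 'i \<Rightarrow> 'v \<Rightarrow> 'v) \<Rightarrow> bool" where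
  "inverse_system I r V \<phi> \<longleftrightarrow> preorder_on I r
     \<and> (\<forall>i\<in>I. \<forall>j\<in>I. \<exists>l\<in>I. (i, l) \<in> r \<and> (j, l) \<in> r)
     \<and> (\<forall>i\<in>I. top_vec (V i))
     \<and> (\<forall>i j. (i, j) \<in> r \<longrightarrow> \<phi> i j \<in> carr (Homk (V j) (V i)))
     \<and> (\<forall>i\<in>I. \<forall>x\<in>carr (V i). \<phi> i i x = x)
     \<and> (\<forall>i j l. (i, j) \<in> r \<and> (j, l) \<in> r \<longrightarrow> \<phi> i l = \<phi> i j \<circ> \<phi> j l)"

definition is_inverse_limit :: "'i set \<Rightarrow> 'i rel \<Rightarrow> ('i \<Rightarrow> ('k::field, 'v::ab_group_add) tvs)
    \<Rightarrow> ('i \<Rightarrow> 'i \<Rightarrow> 'v \<Rightarrow> 'v) \<Rightarrow> ('k, 'z::ab_group_add, 'x) tvs_scheme \<Rightarrow> ('i \<Rightarrow> 'z \<Rightarrow> 'v) \<Rightarrow> bool" where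
  "is_inverse_limit I r V \<phi> Z p \<longleftrightarrow>
     (\<forall>i\<in>I. lin Z (V i) (p i))
     \<and> homeomorphic_map (tp Z)
        (subtopology (product_topology (\<lambda>i. tp (V i)) I)
          {s. \<forall>i j. (i, j) \<in> r \<longrightarrow> \<phi> i j (s j) = s i})
        (\<lambda>z. \<lambda>i\<in>I. p i z)"

text \<open>The types of the inverse system are no restriction: a finite dimensional space is isomorphic
  to a subspace of \<open>nat \<Rightarrow> 'k\<close>, and a pseudocompact space is the inverse limit of its quotients by
  open subspaces of finite codimension, so index sets inside \<open>'z set\<close> suffice.\<close>

definition pseudocompact :: "('k::field, 'z::ab_group_add, 'x) tvs_scheme \<Rightarrow> bool" where
  "pseudocompact Z \<longleftrightarrow> top_vec Z \<and>
     (\<exists>(I :: 'z set set) r (V :: 'z set \<Rightarrow> ('k, nat \<Rightarrow> 'k) tvs) \<phi> p.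
        inverse_system I r V \<phi> \<and> (\<forall>i\<in>I. discrete_vec (V i) \<and> fin_dim (V i))
        \<and> is_inverse_limit I r V \<phi> Z p)"

section \<open>Tensor products of discrete vector spaces\<close>

definition bilin :: "('k, 'v::ab_group_add, 'x) tvs_scheme \<Rightarrow> ('k, 'w::ab_group_add, 'y) tvs_scheme
    \<Rightarrow> ('k, 'z::ab_group_add, 'u) tvs_scheme \<Rightarrow> ('v \<Rightarrow> 'w \<Rightarrow> 'z) \<Rightarrow> bool" where
  "bilin V W Z b \<longleftrightarrow>
     (\<forall>v\<in>carr V. \<forall>w\<in>carr W. b v w \<in> carr Z)
     \<and> (\<forall>v\<in>carr V. \<forall>v'\<in>carr V. \<forall>w\<in>carr W. b (v + v') w = b v w + b v' w)
     \<and> (\<forall>v\<in>carr V. \<forall>w\<in>carr W. \<forall>w'\<in>carr W. b v (w + w') = b v w + b v w')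
     \<and> (\<forall>c. \<forall>v\<in>carr V. \<forall>w\<in>carr W. b (sc V c v) w = sc Z c (b v w) \<and> b v (sc W c w) = sc Z c (b v w))"

text \<open>\<open>V \<otimes> W\<close> is realised inside the dual of the space of bilinear forms on \<open>V \<times> W\<close>, as the span of
  the evaluations \<open>v \<otimes> w = (b \<mapsto> b v w)\<close>.  The lemmas \<open>bilin_pure\<close> and \<open>tensor_universal\<close> below
  show that it has the universal property of the tensor product.\<close>

type_synonym ('k, 'v, 'w) tensor = "('v \<Rightarrow> 'w \<Rightarrow> 'k) \<Rightarrow> 'k"

definition pure :: "('k::field, 'v::ab_group_add, 'x) tvs_scheme \<Rightarrow> ('k, 'w::ab_group_add, 'y) tvs_scheme
    \<Rightarrow> 'v \<Rightarrow> 'w \<Rightarrow> ('k, 'v, 'w) tensor" where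
  "pure V W v w = (\<lambda>b. if bilin V W fld b then b v w else 0)"

definition tensor :: "('k::field, 'v::ab_group_add, 'x) tvs_scheme \<Rightarrow> ('k, 'w::ab_group_add, 'y) tvs_scheme
    \<Rightarrow> ('k, ('k, 'v, 'w) tensor) tvs" (infixr \<open>\<otimes>\<close> 70) where
  "V \<otimes> W = \<lparr>tp = discrete_topology
      (module.span (\<lambda>c t b. c * t b) {pure V W v w | v w. v \<in> carr V \<and> w \<in> carr W}),
     sc = (\<lambda>c t b. c * t b)\<rparr>"

text \<open>The linear map on \<open>V \<otimes> W\<close> induced by a bilinear map.\<close>

definition tlift :: "('k::field, 'v::ab_group_add, 'x) tvs_scheme \<Rightarrow> ('k, 'w::ab_group_add, 'y) tvs_scheme
    \<Rightarrow> ('k, 'z::ab_group_add, 'u) tvs_scheme \<Rightarrow> ('v \<Rightarrow> 'w \<Rightarrow> 'z) \<Rightarrow> ('k, 'v, 'w) tensor \<Rightarrow> 'z" where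
  "tlift V W Z b = (THE h. h \<in> carr (Homk (V \<otimes> W) Z)
     \<and> (\<forall>v\<in>carr V. \<forall>w\<in>carr W. h (pure V W v w) = b v w))"

lemma vector_space_tensor: "vector_space (\<lambda>c (t :: ('k::field, 'v, 'w) tensor) b. c * t b)"
  by unfold_locales (auto simp: fun_eq_iff algebra_simps)

lemma vector_space_fld: "vector_space ((*) :: 'k::field \<Rightarrow> 'k \<Rightarrow> 'k)"
  by unfold_locales (auto simp: algebra_simps)

lemma vec_tensor:
  fixes V :: "('k::field, 'v::ab_group_add, 'x) tvs_scheme"
    and W :: "('k, 'w::ab_group_add, 'y) tvs_scheme"
  shows "vec (V \<otimes> W)"
proof -
  interpret T: vector_space "\<lambda>c (t :: ('k, 'v, 'w) tensor) b. c * t b"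
    by (rule vector_space_tensor)
  show ?thesis
    unfolding vec_def tensor_def by (simp only: tvs.simps topspace_discrete_topology) (intro conjI T.vector_space_axioms T.subspace_span)
qed

lemma discrete_vec_tensor: "discrete_vec (V \<otimes> W)"
  by (simp add: discrete_vec_def vec_tensor) (simp add: tensor_def)

lemma bilin_pure:
  fixes V :: "('k::field, 'v::ab_group_add, 'x) tvs_scheme"
    and W :: "('k, 'w::ab_group_add, 'y) tvs_scheme"
  shows "bilin V W (V \<otimes> W) (pure V W)"
proof -
  interpret T: vector_space "\<lambda>c (t :: ('k, 'v, 'w) tensor) b. c * t b"
    by (rule vector_space_tensor)
  show ?thesis
    unfolding bilin_def tensor_def
    by (auto simp: pure_def fun_eq_iff bilin_def fld_def intro!: T.span_base)
       (use T.span_base in \<open>auto simp: pure_def fun_eq_iff bilin_def fld_def\<close>)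
qed

lemma tensor_universal:
  fixes V :: "('k::field, 'v::ab_group_add, 'x) tvs_scheme"
    and W :: "('k, 'w::ab_group_add, 'y) tvs_scheme"
    and Z :: "('k, 'z::ab_group_add, 'u) tvs_scheme"
  assumes Z: "vec Z" and b: "bilin V W Z b"
  shows "\<exists>!h. h \<in> carr (Homk (V \<otimes> W) Z) \<and> (\<forall>v\<in>carr V. \<forall>w\<in>carr W. h (pure V W v w) = b v w)"
proof -
  let ?s = "\<lambda>c (t :: ('k, 'v, 'w) tensor) b. c * t b"
  let ?G = "{pure V W v w | v w. v \<in> carr V \<and> w \<in> carr W}"
  interpret T: vector_space ?s by (rule vector_space_tensor)
  interpret Z: vector_space "sc Z" using Z by (simp add: vec_def)
  interpret ZF: vector_space_pair "sc Z" "(*) :: 'k \<Rightarrow> 'k \<Rightarrow> 'k"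
    by (simp add: vector_space_pair_def Z.vector_space_axioms vector_space_fld)
  have subZ: "Z.subspace (carr Z)" using Z by (simp add: vec_def)
  let ?lin = "Vector_Spaces.linear (sc Z) ((*) :: 'k \<Rightarrow> 'k \<Rightarrow> 'k)"
  have carrT: "carr (V \<otimes> W) = T.span ?G" by (simp add: tensor_def)
  have scT: "sc (V \<otimes> W) = ?s" by (simp add: tensor_def)
  have sep: "z = z'" if eq: "\<And>\<xi>. ?lin \<xi> \<Longrightarrow> \<xi> z = \<xi> z'" for z z'
  proof (rule ccontr)
    assume "z \<noteq> z'"
    then have "Z.independent {z - z'}" by simp
    from ZF.linear_independent_extend[OF this, of "\<lambda>_. 1"]
    obtain \<xi> where \<xi>: "?lin \<xi>" "\<xi> (z - z') = 1" by auto
    then have "\<xi> z - \<xi> z' = 1" using ZF.linear_diff by metis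
    then show False using eq[OF \<xi>(1)] by simp
  qed
  have form: "bilin V W fld (\<lambda>v w. \<xi> (b v w))" if "?lin \<xi>" for \<xi>
    using b that unfolding bilin_def fld_def
    by (auto simp: ZF.linear_add ZF.linear_scale)
  define R where "R t z \<longleftrightarrow> z \<in> carr Z \<and> (\<forall>\<xi>. ?lin \<xi> \<longrightarrow> \<xi> z = t (\<lambda>v w. \<xi> (b v w)))"
    for t :: "('k, 'v, 'w) tensor" and z
  have R_unique: "z = z'" if "R t z" "R t z'" for t z z'
    by (rule sep) (use that in \<open>auto simp: R_def\<close>)
  have R_add: "R (t + t') (z + z')" if "R t z" "R t' z'" for t t' z z'
    using that subZ by (auto simp: R_def ZF.linear_add Z.subspace_add)
  have R_scale: "R (?s c t) (sc Z c z)" if "R t z" for c t z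
    using that subZ by (auto simp: R_def ZF.linear_scale Z.subspace_scale)
  have R_zero: "R 0 0"
    using subZ by (auto simp: R_def ZF.linear_0 Z.subspace_0)
  have R_pure: "R (pure V W v w) (b v w)" if "v \<in> carr V" "w \<in> carr W" for v w
    using that b form by (auto simp: R_def pure_def bilin_def)
  have R_ex: "\<exists>z. R t z" if "t \<in> T.span ?G" for t
    using that
  proof (induction rule: T.span_induct_alt)
    case base
    show ?case using R_zero by blast
  next
    case (step c x y)
    then show ?case using R_pure R_scale R_add by blast
  qed
  define h where "h t = (if t \<in> T.span ?G then THE z. R t z else 0)" for t
  have Rh: "R t (h t)" if "t \<in> T.span ?G" for t
    using theI'[of "R t"] R_ex[OF that] R_unique that unfolding h_def by auto
  have h_eq: "h t = z" if "t \<in> T.span ?G" "R t z" for t z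
    using Rh R_unique that by blast
  show ?thesis
  proof (rule ex1I[of _ h])
    have "lin (V \<otimes> W) Z h"
      unfolding lin_def carrT scT
    proof (intro conjI ballI allI impI)
      show "h ` T.span ?G \<subseteq> carr Z" using Rh by (auto simp: R_def)
      show "h (x + y) = h x + h y" if "x \<in> T.span ?G" "y \<in> T.span ?G" for x y
        by (rule h_eq) (use that R_add Rh T.span_add in auto)
      show "h (?s c x) = sc Z c (h x)" if "x \<in> T.span ?G" for c x
        by (rule h_eq) (use that R_scale Rh T.span_scale in auto)
      show "h x = 0" if "x \<notin> T.span ?G" for x
        using that by (simp add: h_def)
    qed
    moreover from this have "continuous_map (tp (V \<otimes> W)) (tp Z) h"
      by (simp add: lin_def tensor_def Pi_iff image_subset_iff)
    moreover have "h (pure V W v w) = b v w" if "v \<in> carr V" "w \<in> carr W" for v w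
      by (rule h_eq) (use that R_pure in \<open>auto intro: T.span_base\<close>)
    ultimately show "h \<in> carr (Homk (V \<otimes> W) Z)
        \<and> (\<forall>v\<in>carr V. \<forall>w\<in>carr W. h (pure V W v w) = b v w)"
      by (simp add: hom_set_def)
  next
    fix g assume g: "g \<in> carr (Homk (V \<otimes> W) Z)
        \<and> (\<forall>v\<in>carr V. \<forall>w\<in>carr W. g (pure V W v w) = b v w)"
    then have lin: "lin (V \<otimes> W) Z g" by (simp add: hom_set_def)
    have "g t = h t" for t
    proof (cases "t \<in> T.span ?G")
      case True
      then have "t \<in> T.span ?G \<and> R t (g t)"
      proof (induction rule: T.span_induct_alt)
        case base
        have "g (0 + 0) = g 0 + g 0"
          using lin T.span_zero unfolding lin_def carrT by blast
        then have g0: "g 0 = 0" by simp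
        show ?case unfolding g0 by (intro conjI T.span_zero R_zero)
      next
        case (step c x y)
        have xs: "x \<in> T.span ?G" by (rule T.span_base) (rule step(1))
        have cxs: "?s c x \<in> T.span ?G" by (rule T.span_scale[OF xs])
        have ys: "y \<in> T.span ?G" and Ry: "R y (g y)" using step(2) by auto
        have "g (?s c x + y) = g (?s c x) + g y"
          using lin cxs ys unfolding lin_def carrT by simp
        also have "g (?s c x) = sc Z c (g x)"
          using lin xs unfolding lin_def carrT scT by simp
        finally have gs: "g (?s c x + y) = sc Z c (g x) + g y" .
        have "R x (g x)" using step(1) g R_pure by auto
        then have "R (?s c x + y) (sc Z c (g x) + g y)"
          by (intro R_add R_scale Ry)
        then show ?case
          unfolding gs by (intro conjI T.span_add[OF cxs ys])
      qed
      then show ?thesis using h_eq by auto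
    next
      case False
      then show ?thesis using lin by (simp add: lin_def carrT h_def)
    qed
    then show "g = h" by blast
  qed
qed

definition tmap :: "('k::field, 'v::ab_group_add, 'x) tvs_scheme \<Rightarrow> ('k, 'w::ab_group_add, 'y) tvs_scheme
    \<Rightarrow> ('k, 'v'::ab_group_add, 'z) tvs_scheme \<Rightarrow> ('k, 'w'::ab_group_add, 'u) tvs_scheme
    \<Rightarrow> ('v \<Rightarrow> 'v') \<Rightarrow> ('w \<Rightarrow> 'w') \<Rightarrow> ('k, 'v, 'w) tensor \<Rightarrow> ('k, 'v', 'w') tensor" where
  "tmap V W V' W' f g = tlift V W (V' \<otimes> W') (\<lambda>v w. pure V' W' (f v) (g w))"

definition assoc :: "('k::field, 'u::ab_group_add, 'x) tvs_scheme \<Rightarrow> ('k, 'v::ab_group_add, 'y) tvs_scheme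
    \<Rightarrow> ('k, 'w::ab_group_add, 'z) tvs_scheme
    \<Rightarrow> ('k, ('k, 'u, 'v) tensor, 'w) tensor \<Rightarrow> ('k, 'u, ('k, 'v, 'w) tensor) tensor" where
  "assoc U V W = tlift (U \<otimes> V) W (U \<otimes> (V \<otimes> W))
     (\<lambda>t w. tlift U V (U \<otimes> (V \<otimes> W)) (\<lambda>u v. pure U (V \<otimes> W) u (pure V W v w)) t)"

text \<open>\<open>id\<^sub>V \<otimes> \<xi> : V \<otimes> W \<rightarrow> V \<otimes> k = V\<close> and \<open>\<xi> \<otimes> id\<^sub>W : V \<otimes> W \<rightarrow> k \<otimes> W = W\<close>.\<close>

definition rapply :: "('k::field, 'v::ab_group_add, 'x) tvs_scheme \<Rightarrow> ('k, 'w::ab_group_add, 'y) tvs_scheme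
    \<Rightarrow> ('w \<Rightarrow> 'k) \<Rightarrow> ('k, 'v, 'w) tensor \<Rightarrow> 'v" where
  "rapply V W \<xi> = tlift V W V (\<lambda>v w. sc V (\<xi> w) v)"

definition lapply :: "('k::field, 'v::ab_group_add, 'x) tvs_scheme \<Rightarrow> ('k, 'w::ab_group_add, 'y) tvs_scheme
    \<Rightarrow> ('v \<Rightarrow> 'k) \<Rightarrow> ('k, 'v, 'w) tensor \<Rightarrow> 'w" where
  "lapply V W \<xi> = tlift V W W (\<lambda>v w. sc W (\<xi> v) w)"

text \<open>\<open>\<psi> : Hom\<^sub>k(A, Hom\<^sub>k(B, Z)) \<rightarrow> Hom\<^sub>k(A \<otimes> B, Z)\<close>.\<close>

definition psi :: "('k::field, 'a::ab_group_add, 'x) tvs_scheme \<Rightarrow> ('k, 'b::ab_group_add, 'y) tvs_scheme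
    \<Rightarrow> ('k, 'z::ab_group_add, 'u) tvs_scheme \<Rightarrow> ('a \<Rightarrow> 'b \<Rightarrow> 'z) \<Rightarrow> ('k, 'a, 'b) tensor \<Rightarrow> 'z" where
  "psi A B Z \<gamma> = tlift A B Z \<gamma>"

section \<open>Coalgebras, comodules, contramodules\<close>

record ('k, 'c) coalg = "('k, 'c) tvs" +
  comult :: "'c \<Rightarrow> ('k, 'c, 'c) tensor"
  counit :: "'c \<Rightarrow> 'k"

definition coalgebra :: "('k::field, 'c::ab_group_add, 'x) coalg_scheme \<Rightarrow> bool" where
  "coalgebra C \<longleftrightarrow> discrete_vec C
     \<and> lin C (C \<otimes> C) (comult C) \<and> lin C fld (counit C)
     \<and> (\<forall>c\<in>carr C. assoc C C C (tmap C C (C \<otimes> C) C (comult C) (\<lambda>x. x) (comult C c))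
          = tmap C C C (C \<otimes> C) (\<lambda>x. x) (comult C) (comult C c))
     \<and> (\<forall>c\<in>carr C. rapply C C (counit C) (comult C c) = c)
     \<and> (\<forall>c\<in>carr C. lapply C C (counit C) (comult C c) = c)"

record ('k, 'd, 'm) rcomod = "('k, 'm) tvs" +
  rcoact :: "'m \<Rightarrow> ('k, 'm, 'd) tensor"

record ('k, 'c, 'd, 'm) bicomod = "('k, 'd, 'm) rcomod" +
  lcoact :: "'m \<Rightarrow> ('k, 'c, 'm) tensor"

definition right_comodule :: "('k::field, 'd::ab_group_add, 'x) coalg_scheme
    \<Rightarrow> ('k, 'd, 'm::ab_group_add, 'y) rcomod_scheme \<Rightarrow> bool" where
  "right_comodule D M \<longleftrightarrow> discrete_vec M \<and> lin M (M \<otimes> D) (rcoact M)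
     \<and> (\<forall>m\<in>carr M. assoc M D D (tmap M D (M \<otimes> D) D (rcoact M) (\<lambda>x. x) (rcoact M m))
          = tmap M D M (D \<otimes> D) (\<lambda>x. x) (comult D) (rcoact M m))
     \<and> (\<forall>m\<in>carr M. rapply M D (counit D) (rcoact M m) = m)"

definition left_comodule :: "('k::field, 'c::ab_group_add, 'x) coalg_scheme
    \<Rightarrow> ('k, 'm::ab_group_add, 'y) tvs_scheme \<Rightarrow> ('m \<Rightarrow> ('k, 'c, 'm) tensor) \<Rightarrow> bool" where
  "left_comodule C M \<rho> \<longleftrightarrow> discrete_vec M \<and> lin M (C \<otimes> M) \<rho>
     \<and> (\<forall>m\<in>carr M. assoc C C M (tmap C M (C \<otimes> C) M (comult C) (\<lambda>x. x) (\<rho> m))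
          = tmap C M C (C \<otimes> M) (\<lambda>x. x) \<rho> (\<rho> m))
     \<and> (\<forall>m\<in>carr M. lapply C M (counit C) (\<rho> m) = m)"

definition bicomodule :: "('k::field, 'c::ab_group_add, 'x) coalg_scheme
    \<Rightarrow> ('k, 'd::ab_group_add, 'y) coalg_scheme
    \<Rightarrow> ('k, 'c, 'd, 'm::ab_group_add, 'z) bicomod_scheme \<Rightarrow> bool" where
  "bicomodule C D M \<longleftrightarrow> left_comodule C M (lcoact M) \<and> right_comodule D M
     \<and> (\<forall>m\<in>carr M. assoc C M D (tmap M D (C \<otimes> M) D (lcoact M) (\<lambda>x. x) (rcoact M m))
          = tmap C M C (M \<otimes> D) (\<lambda>x. x) (rcoact M) (lcoact M m))"

definition right_comodule_hom :: "('k::field, 'd::ab_group_add, 'x) coalg_scheme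
    \<Rightarrow> ('k, 'd, 'm::ab_group_add, 'y) rcomod_scheme
    \<Rightarrow> ('k, 'd, 'n::ab_group_add, 'z) rcomod_scheme \<Rightarrow> ('m \<Rightarrow> 'n) \<Rightarrow> bool" where
  "right_comodule_hom D M N f \<longleftrightarrow> lin M N f
     \<and> (\<forall>m\<in>carr M. rcoact N (f m) = tmap M D N D f (\<lambda>x. x) (rcoact M m))"

definition bicomodule_hom :: "('k::field, 'c::ab_group_add, 'x) coalg_scheme
    \<Rightarrow> ('k, 'd::ab_group_add, 'y) coalg_scheme
    \<Rightarrow> ('k, 'c, 'd, 'm::ab_group_add, 'z) bicomod_scheme
    \<Rightarrow> ('k, 'c, 'd, 'n::ab_group_add, 'u) bicomod_scheme \<Rightarrow> ('m \<Rightarrow> 'n) \<Rightarrow> bool" where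
  "bicomodule_hom C D M N f \<longleftrightarrow> right_comodule_hom D M N f
     \<and> (\<forall>m\<in>carr M. lcoact N (f m) = tmap C M C N (\<lambda>x. x) f (lcoact M m))"

record ('k, 'e, 'z) contramod = "('k, 'z) tvs" +
  contra :: "('e \<Rightarrow> 'z) \<Rightarrow> 'z"

text \<open>The maps \<open>Hom\<^sub>k(E, \<theta>)\<close>, \<open>Hom\<^sub>k(\<Delta>, Z)\<close> and \<open>Hom\<^sub>k(\<epsilon>, Z)\<close> are composition with \<open>\<theta>\<close>, \<open>\<Delta>\<close>, \<open>\<epsilon>\<close>;
  the canonical isomorphism \<open>Hom\<^sub>k(k, Z) \<rightarrow> Z\<close> is evaluation at \<open>1\<close>.\<close>

definition contramodule :: "('k::field, 'e::ab_group_add, 'x) coalg_scheme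
    \<Rightarrow> ('k, 'e, 'z::ab_group_add, 'y) contramod_scheme \<Rightarrow> bool" where
  "contramodule E Z \<longleftrightarrow> pseudocompact Z
     \<and> contra Z \<in> carr (Homk (Homk E Z) Z)
     \<and> (\<forall>\<phi>\<in>carr (Homk E (Homk E Z)). contra Z (contra Z \<circ> \<phi>) = contra Z (psi E E Z \<phi> \<circ> comult E))
     \<and> (\<forall>\<phi>\<in>carr (Homk (fld :: ('k, 'k) tvs) Z). contra Z (\<phi> \<circ> counit E) = \<phi> 1)"

definition contramodule_hom :: "('k::field, 'e::ab_group_add, 'x) coalg_scheme
    \<Rightarrow> ('k, 'e, 'z::ab_group_add, 'y) contramod_scheme
    \<Rightarrow> ('k, 'e, 't::ab_group_add, 'u) contramod_scheme \<Rightarrow> ('z \<Rightarrow> 't) \<Rightarrow> bool" where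
  "contramodule_hom E Z T \<alpha> \<longleftrightarrow> \<alpha> \<in> carr (Homk Z T)
     \<and> (\<forall>\<phi>\<in>carr (Homk E Z). \<alpha> (contra Z \<phi>) = contra T (\<alpha> \<circ> \<phi>))"

section \<open>Homomorphisms from contramodules to comodules\<close>

definition psi_bar :: "('k::field, 'e::ab_group_add, 'x) tvs_scheme
    \<Rightarrow> ('k, 'n::ab_group_add, 'y) tvs_scheme \<Rightarrow> ('k, 'm::ab_group_add, 'z) tvs_scheme
    \<Rightarrow> (('e \<Rightarrow> 'n) \<Rightarrow> 'm) \<Rightarrow> 'n \<Rightarrow> ('k, 'm, 'e) tensor" where
  "psi_bar E N M f = (THE g. g \<in> carr (Homk N (M \<otimes> E))
     \<and> (\<forall>n\<in>carr N. \<forall>\<xi>\<in>carr (dual E). rapply M E \<xi> (g n) = f (\<lambda>e. sc N (\<xi> e) n)))"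

text \<open>\<open>Hom\<^sub>E(N, M)\<close>, a discrete vector space.\<close>

definition HomCC :: "('k::field, 'e::ab_group_add, 'x) coalg_scheme
    \<Rightarrow> ('k, 'e, 'n::ab_group_add, 'y) contramod_scheme
    \<Rightarrow> ('k, 'e, 'm::ab_group_add, 'z) rcomod_scheme \<Rightarrow> ('k, 'n \<Rightarrow> 'm) tvs" where
  "HomCC E N M = \<lparr>tp = discrete_topology
      {\<gamma> \<in> carr (Homk N M). psi_bar E N M (\<gamma> \<circ> contra N) = rcoact M \<circ> \<gamma>},
     sc = (\<lambda>c \<gamma> n. sc M c (\<gamma> n))\<rparr>"

text \<open>\<open>Hom\<^sub>E(g, f) : Hom\<^sub>E(N, M) \<rightarrow> Hom\<^sub>E(N', M')\<close> for \<open>g : N' \<rightarrow> N\<close> and \<open>f : M \<rightarrow> M'\<close>.\<close>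

definition HomCC_map :: "('k::field, 'e::ab_group_add, 'x) coalg_scheme
    \<Rightarrow> ('k, 'e, 'n::ab_group_add, 'y) contramod_scheme
    \<Rightarrow> ('k, 'e, 'm::ab_group_add, 'z) rcomod_scheme
    \<Rightarrow> ('n' \<Rightarrow> 'n) \<Rightarrow> ('m \<Rightarrow> 'm') \<Rightarrow> ('n \<Rightarrow> 'm) \<Rightarrow> 'n' \<Rightarrow> 'm'::ab_group_add" where
  "HomCC_map E N M g f = (\<lambda>\<gamma>. if \<gamma> \<in> carr (HomCC E N M) then f \<circ> \<gamma> \<circ> g else 0)"

section \<open>Cotensor product\<close>

definition cotensor_space :: "('k::field, 'c::ab_group_add, 'x) coalg_scheme
    \<Rightarrow> ('k, 'c, 'l::ab_group_add, 'y) rcomod_scheme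
    \<Rightarrow> ('k, 'c, 'd, 'm::ab_group_add, 'z) bicomod_scheme \<Rightarrow> ('k, ('k, 'l, 'm) tensor) tvs" where
  "cotensor_space C L M = \<lparr>tp = discrete_topology {t \<in> carr (L \<otimes> M).
        assoc L C M (tmap L M (L \<otimes> C) M (rcoact L) (\<lambda>x. x) t)
        - tmap L M L (C \<otimes> M) (\<lambda>x. x) (lcoact M) t = 0},
     sc = sc (L \<otimes> M)\<rparr>"

text \<open>The \<open>D\<close>-coaction is the restriction of \<open>id\<^sub>L \<otimes> \<mu>\<^sub>M : L \<otimes> M \<rightarrow> L \<otimes> (M \<otimes> D) = (L \<otimes> M) \<otimes> D\<close>:
  it is the map into \<open>(L \<box> M) \<otimes> D\<close> lifting that restriction along the injection
  \<open>(L \<box> M) \<otimes> D \<rightarrow> (L \<otimes> M) \<otimes> D\<close>.\<close>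

definition cotensor :: "('k::field, 'c::ab_group_add, 'x) coalg_scheme
    \<Rightarrow> ('k, 'd::ab_group_add, 'w) coalg_scheme
    \<Rightarrow> ('k, 'c, 'l::ab_group_add, 'y) rcomod_scheme
    \<Rightarrow> ('k, 'c, 'd, 'm::ab_group_add, 'z) bicomod_scheme
    \<Rightarrow> ('k, 'd, ('k, 'l, 'm) tensor) rcomod" where
  "cotensor C D L M = (let P = cotensor_space C L M in
     \<lparr>tp = tp P, sc = sc P,
      rcoact = (THE \<mu>. lin P (P \<otimes> D) \<mu> \<and> (\<forall>t\<in>carr P.
         assoc L M D (tmap P D (L \<otimes> M) D (\<lambda>x. x) (\<lambda>x. x) (\<mu> t))
         = tmap L M L (M \<otimes> D) (\<lambda>x. x) (rcoact M) t))\<rparr>)"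

definition cotensor_map :: "('k::field, 'c::ab_group_add, 'x) coalg_scheme
    \<Rightarrow> ('k, 'c, 'l::ab_group_add, 'y) rcomod_scheme
    \<Rightarrow> ('k, 'c, 'd::ab_group_add, 'm::ab_group_add, 'z) bicomod_scheme
    \<Rightarrow> ('k, 'c, 'l'::ab_group_add, 'u) rcomod_scheme
    \<Rightarrow> ('k, 'c, 'd, 'm'::ab_group_add, 'v) bicomod_scheme
    \<Rightarrow> ('l \<Rightarrow> 'l') \<Rightarrow> ('m \<Rightarrow> 'm') \<Rightarrow> ('k, 'l, 'm) tensor \<Rightarrow> ('k, 'l', 'm') tensor" where
  "cotensor_map C L M L' M' f g =
     (\<lambda>t. if t \<in> carr (cotensor_space C L M) then tmap L M L' M' f g t else 0)"

section \<open>The functor \<open>h\<close>\<close>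

definition HomCC_coact :: "('k::field, 'c::ab_group_add, 'x) coalg_scheme
    \<Rightarrow> ('k, 'd::ab_group_add, 'y) coalg_scheme
    \<Rightarrow> ('k, 'c, 'd, 'm::ab_group_add, 'z) bicomod_scheme
    \<Rightarrow> ('k, 'd, 'n::ab_group_add, 'u) contramod_scheme \<Rightarrow> ('n \<Rightarrow> 'm) \<Rightarrow> ('k, 'c, 'n \<Rightarrow> 'm) tensor" where
  "HomCC_coact C D M N = (THE \<rho>. lin (HomCC D N M) (C \<otimes> HomCC D N M) \<rho>
     \<and> (\<forall>f\<in>carr (dual C). \<forall>\<gamma>\<in>carr (HomCC D N M).
          lapply C (HomCC D N M) f (\<rho> \<gamma>) = lapply C M f \<circ> lcoact M \<circ> \<gamma>))"

text \<open>The contramodule \<open>X\<^sup>*\<close> of a left comodule \<open>(X, \<rho>)\<close>.\<close>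

definition dual_contramodule :: "('k::field, 'c::ab_group_add, 'x) coalg_scheme
    \<Rightarrow> ('k, 'v::ab_group_add, 'y) tvs_scheme \<Rightarrow> ('v \<Rightarrow> ('k, 'c, 'v) tensor)
    \<Rightarrow> ('k, 'c, 'v \<Rightarrow> 'k) contramod" where
  "dual_contramodule C X \<rho> = \<lparr>tp = tp (dual X), sc = sc (dual X),
     contra = (\<lambda>\<phi>. if \<phi> \<in> carr (Homk C (dual X)) then psi C X fld \<phi> \<circ> \<rho> else 0)\<rparr>"

definition hfun :: "('k::field, 'c::ab_group_add, 'x) coalg_scheme
    \<Rightarrow> ('k, 'd::ab_group_add, 'y) coalg_scheme
    \<Rightarrow> ('k, 'c, 'd, 'm::ab_group_add, 'z) bicomod_scheme
    \<Rightarrow> ('k, 'd, 'n::ab_group_add, 'u) contramod_scheme \<Rightarrow> ('k, 'c, ('n \<Rightarrow> 'm) \<Rightarrow> 'k) contramod" where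
  "hfun C D M N = dual_contramodule C (HomCC D N M) (HomCC_coact C D M N)"

text \<open>\<open>h(f, g) : h(M', N') \<rightarrow> h(M, N)\<close> for \<open>f : M \<rightarrow> M'\<close> and \<open>g : N' \<rightarrow> N\<close>.\<close>

definition hfun_map :: "('k::field, 'd::ab_group_add, 'y) coalg_scheme
    \<Rightarrow> ('k, 'c::ab_group_add, 'd, 'm::ab_group_add, 'z) bicomod_scheme
    \<Rightarrow> ('k, 'd, 'n::ab_group_add, 'u) contramod_scheme
    \<Rightarrow> ('k, 'c, 'd, 'm'::ab_group_add, 'v) bicomod_scheme
    \<Rightarrow> ('k, 'd, 'n'::ab_group_add, 'w) contramod_scheme
    \<Rightarrow> ('m \<Rightarrow> 'm') \<Rightarrow> ('n' \<Rightarrow> 'n) \<Rightarrow> (('n' \<Rightarrow> 'm') \<Rightarrow> 'k) \<Rightarrow> ('n \<Rightarrow> 'm) \<Rightarrow> 'k" where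
  "hfun_map D M N M' N' f g = dual_map (HomCC D N' M') (HomCC_map D N M g f)"

end

theory Submission
  imports Defs
begin

text \<open>
  Write \<open>X = Hom\<^sub>D(N, M)\<close>, so that \<open>h(M, N) = X\<^sup>*\<close>.  Both sides of the isomorphism are the cotensor
  product \<open>L \<box> X\<close>, seen through slices: for a functional \<open>\<nu>\<close> on \<open>L\<close> and \<open>\<gamma> : N \<rightarrow> L \<otimes> M\<close> let
  \<open>\<gamma>\<^sub>\<nu> = (\<nu> \<otimes> id) \<gamma> : N \<rightarrow> M\<close>.  A map \<open>\<gamma>\<close> and a map \<open>\<beta> : X\<^sup>* \<rightarrow> L\<close> correspond to each other if
  \<open>\<nu>(\<beta>(n)) = n(\<gamma>\<^sub>\<nu>)\<close> for all \<open>\<nu> \<in> L\<^sup>*\<close> and \<open>n \<in> X\<^sup>*\<close> (\<open>transposes\<close>).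

  Functionals separate points, so each of \<open>\<gamma>\<close> and \<open>\<beta>\<close> determines the other.  Existence is a
  finiteness argument.  A continuous linear map from a pseudocompact space to a discrete one has finite
  rank (\<open>pseudocompact_finite_rank\<close>), so \<open>\<gamma>\<close> takes values in \<open>L\<^sub>0 \<otimes> M\<close> with \<open>L\<^sub>0\<close> finite dimensional,
  and \<open>\<beta>(n) = \<Sum>\<^sub>b n(\<gamma>\<^bsub>e\<^sub>b\<^esub>) b\<close> for a basis \<open>b\<close> of \<open>L\<^sub>0\<close> with dual functionals \<open>e\<^sub>b\<close>.  Conversely \<open>\<beta>\<close> is
  continuous and \<open>L\<close> is discrete, so \<open>\<beta>\<close> vanishes on the annihilator of a finite dimensional
  subspace of \<open>X\<close>, and \<open>\<gamma>(p) = \<Sum>\<^sub>b \<beta>(e\<^sub>b) \<otimes> b(p)\<close> for a basis \<open>b\<close> of that subspace.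

  The conditions on the two sides also match.  That \<open>\<gamma>\<close> lands in \<open>L \<box> M\<close> means, after applying
  \<open>\<nu> \<otimes> f \<otimes> id\<close>, that \<open>\<gamma>\<^bsub>\<nu> * f\<^esub> = f \<gamma>\<^sub>\<nu>\<close> for all \<open>\<nu> \<in> L\<^sup>*\<close> and \<open>f \<in> C\<^sup>*\<close>, where \<open>\<nu> * f\<close> is \<open>\<nu>\<close> composed with the
  action of \<open>f\<close> on \<open>L\<close>; and that \<open>\<gamma>\<close> is then a homomorphism over \<open>D\<close> means that every \<open>\<gamma>\<^sub>\<nu>\<close> is one,
  that is, lies in \<open>X\<close> (\<open>HomCC_cotensor_iff\<close>).  That \<open>\<beta>\<close> is a homomorphism over \<open>C\<close> means that it
  commutes with the actions of all \<open>f \<in> C\<^sup>*\<close> (\<open>HomCC_hfun_iff\<close>); tested against all \<open>\<nu>\<close> and \<open>n\<close> this is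
  the same family of equations (\<open>transposes_equivariant_iff\<close>).  Naturality follows because both sides of
  the naturality square correspond to the same map.

  The maps \<open>\<psi>\<close>-bar, the coaction of \<open>L \<box> M\<close> and the coaction of \<open>X\<close> are each characterised by
  their slices.  Uniqueness holds since slices separate tensors, and existence since a linear map
  \<open>W\<^sup>* \<rightarrow> V\<close> that vanishes on the annihilator of a finite set is the slice map of an element of
  \<open>V \<otimes> W\<close> (\<open>rapply_represents\<close>, \<open>lapply_represents\<close>).
\<close>

section \<open>Relative linear algebra\<close>

text \<open>Unlike \<open>lin\<close>, this puts no condition on the values outside the domain, so that identities,
  inclusions and restrictions qualify.\<close>

definition lin_on :: "('k, 'v::ab_group_add, 'x) tvs_scheme \<Rightarrow> ('k, 'w::ab_group_add, 'y) tvs_scheme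
    \<Rightarrow> ('v \<Rightarrow> 'w) \<Rightarrow> bool" where
  "lin_on V W f \<longleftrightarrow> (\<forall>x\<in>carr V. f x \<in> carr W)
     \<and> (\<forall>x\<in>carr V. \<forall>y\<in>carr V. f (x + y) = f x + f y)
     \<and> (\<forall>c. \<forall>x\<in>carr V. f (sc V c x) = sc W c (f x))"

lemma lin_iff: "lin V W f \<longleftrightarrow> lin_on V W f \<and> (\<forall>x. x \<notin> carr V \<longrightarrow> f x = 0)"
  unfolding lin_def lin_on_def by blast

lemma lin_imp_lin_on: "lin V W f \<Longrightarrow> lin_on V W f"
  by (simp add: lin_iff)

lemma lin_outside: "lin V W f \<Longrightarrow> x \<notin> carr V \<Longrightarrow> f x = 0"
  by (simp add: lin_iff)

lemma lin_onD:
  assumes "lin_on V W f" "x \<in> carr V"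
  shows lin_on_carr: "f x \<in> carr W"
    and lin_on_add: "y \<in> carr V \<Longrightarrow> f (x + y) = f x + f y"
    and lin_on_scale: "f (sc V c x) = sc W c (f x)"
  using assms unfolding lin_on_def by blast+

lemma lin_on_comp: "lin_on V W f \<Longrightarrow> lin_on W Z g \<Longrightarrow> lin_on V Z (\<lambda>x. g (f x))"
  unfolding lin_on_def by simp

lemma lin_on_id: "lin_on V V (\<lambda>x. x)"
  by (simp add: lin_on_def)

lemma vec_vector_space: "vec V \<Longrightarrow> vector_space (sc V)"
  by (simp add: vec_def)

lemma vec_subspace: "vec V \<Longrightarrow> module.subspace (sc V) (carr V)"
  by (simp add: vec_def)

lemma vec_carr:
  assumes "vec V"
  shows vec_zero: "0 \<in> carr V"
    and vec_add: "x \<in> carr V \<Longrightarrow> y \<in> carr V \<Longrightarrow> x + y \<in> carr V"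
    and vec_scale: "x \<in> carr V \<Longrightarrow> sc V c x \<in> carr V"
    and vec_diff: "x \<in> carr V \<Longrightarrow> y \<in> carr V \<Longrightarrow> x - y \<in> carr V"
    and vec_sum: "(\<And>i. i \<in> I \<Longrightarrow> h i \<in> carr V) \<Longrightarrow> sum h I \<in> carr V"
proof -
  interpret vector_space "sc V" by (rule vec_vector_space[OF assms])
  note s = vec_subspace[OF assms]
  show "0 \<in> carr V" "x \<in> carr V \<Longrightarrow> y \<in> carr V \<Longrightarrow> x + y \<in> carr V"
    "x \<in> carr V \<Longrightarrow> sc V c x \<in> carr V"
    "x \<in> carr V \<Longrightarrow> y \<in> carr V \<Longrightarrow> x - y \<in> carr V"
    "(\<And>i. i \<in> I \<Longrightarrow> h i \<in> carr V) \<Longrightarrow> sum h I \<in> carr V"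
    by (simp_all add: subspace_0[OF s] subspace_add[OF s] subspace_scale[OF s] subspace_diff[OF s]
      subspace_sum[OF s])
qed

lemma vec_laws:
  assumes "vec V"
  shows sc_add_right: "sc V c (x + y) = sc V c x + sc V c y"
    and sc_add_left: "sc V (c + d) x = sc V c x + sc V d x"
    and sc_sc: "sc V c (sc V d x) = sc V (c * d) x"
    and sc_zero_left: "sc V 0 x = 0"
    and sc_zero_right: "sc V c 0 = 0"
    and sc_sum_right: "sc V c (sum k J) = (\<Sum>j\<in>J. sc V c (k j))"
proof -
  interpret vector_space "sc V" by (rule vec_vector_space[OF assms])
  show "sc V c (x + y) = sc V c x + sc V c y" "sc V (c + d) x = sc V c x + sc V d x"
    "sc V c (sc V d x) = sc V (c * d) x" "sc V 0 x = 0" "sc V c 0 = 0"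
    "sc V c (sum k J) = (\<Sum>j\<in>J. sc V c (k j))"
    by (simp_all add: scale_right_distrib scale_left_distrib scale_sum_right)
qed

lemma lin_on_zero:
  assumes "vec V" "lin_on V W f"
  shows "f 0 = 0"
proof -
  have "f (0 + 0) = f 0 + f 0"
    by (rule lin_on_add[OF assms(2)]) (rule vec_zero[OF assms(1)])+
  then show ?thesis by simp
qed

lemma lin_on_diff:
  assumes "vec V" "lin_on V W f" "x \<in> carr V" "y \<in> carr V"
  shows "f (x - y) = f x - f y"
proof -
  have "f (x - y + y) = f (x - y) + f y"
    by (rule lin_on_add[OF assms(2) vec_diff[OF assms(1,3,4)] assms(4)])
  then show ?thesis by simp
qed

lemma lin_on_sum:
  assumes "vec V" "lin_on V W f" "\<And>i. i \<in> I \<Longrightarrow> h i \<in> carr V"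
  shows "f (sum h I) = (\<Sum>i\<in>I. f (h i))"
proof (cases "finite I")
  case True
  then show ?thesis using assms(3)
  proof (induction I)
    case empty
    then show ?case by (simp add: lin_on_zero[OF assms(1,2)])
  next
    case (insert i I)
    then show ?case
      by (simp add: lin_on_add[OF assms(2)] vec_sum[OF assms(1)])
  qed
qed (simp add: lin_on_zero[OF assms(1,2)])

lemma lin_comp:
  assumes "vec W" "lin V W f" "lin W Z g"
  shows "lin V Z (g \<circ> f)"
  using assms lin_on_comp[of V W f Z g] lin_on_zero[of W Z g]
  by (simp add: lin_iff comp_def)

lemma lin_cancel_outside: "lin V W f \<Longrightarrow> lin V W g \<Longrightarrow> (\<And>x. x \<in> carr V \<Longrightarrow> f x = g x) \<Longrightarrow> f = g"
  by (rule ext) (metis lin_outside)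

lemma carr_fld [simp]: "carr fld = UNIV"
  by (simp add: fld_def)

lemma sc_fld [simp]: "sc fld = (*)"
  by (simp add: fld_def)

lemma tp_fld: "tp fld = discrete_topology UNIV"
  by (simp add: fld_def)

lemma vec_fld: "vec fld"
  using vector_space_fld by (simp add: vec_def module.subspace_UNIV module_iff_vector_space)

lemma discrete_vec_imp_vec: "discrete_vec V \<Longrightarrow> vec V"
  unfolding discrete_vec_def by blast

lemma discrete_vec_tp: "discrete_vec V \<Longrightarrow> tp V = discrete_topology (carr V)"
  unfolding discrete_vec_def by blast

lemma sum_fun_apply: "(sum h I) x = (\<Sum>i\<in>I. h i x)" for h :: "'i \<Rightarrow> 'a \<Rightarrow> 'b::comm_monoid_add"
  by (induction I rule: infinite_finite_induct) auto

lemma vector_space_pointwise: "vector_space s \<Longrightarrow> vector_space (\<lambda>c f x. s c (f x))"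
  unfolding vector_space_def by (auto simp: fun_eq_iff)

lemma hom_set_discrete:
  assumes "discrete_vec V"
  shows "hom_set V W = {f. lin V W f}"
proof -
  have "continuous_map (tp V) (tp W) f" if "lin V W f" for f
  proof -
    have "continuous_map (discrete_topology (carr V)) (tp W) f"
      using that by (auto simp: lin_def)
    then show ?thesis by (simp only: discrete_vec_tp[OF assms, symmetric])
  qed
  then show ?thesis by (auto simp: hom_set_def)
qed

lemma sc_Homk: "sc (Homk V W) = (\<lambda>c f x. sc W c (f x))"
  by (simp add: Homk_def)

lemma lin_pointwise:
  assumes "vec W"
  shows lin_const_zero: "lin V W 0"
    and lin_plus: "lin V W f \<Longrightarrow> lin V W g \<Longrightarrow> lin V W (f + g)"
    and lin_cmult: "lin V W f \<Longrightarrow> lin V W (\<lambda>x. sc W c (f x))"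
  using assms by (simp_all add: lin_iff lin_on_def vec_laws vec_zero vec_add vec_scale mult.commute
      add.assoc add.left_commute)

lemma lin_on_plus:
  assumes "vec W" "lin_on V W f" "lin_on V W g"
  shows "lin_on V W (\<lambda>x. f x + g x)"
  using assms by (simp add: lin_on_def vec_laws vec_add ac_simps)

lemma vec_Homk_discrete:
  assumes "discrete_vec V" "vec W"
  shows "vec (Homk V W)"
proof -
  interpret F: vector_space "\<lambda>c f x. sc W c (f x)"
    by (rule vector_space_pointwise[OF vec_vector_space[OF assms(2)]])
  show ?thesis
    unfolding vec_def carr_Homk sc_Homk hom_set_discrete[OF assms(1)]
    by (auto intro!: F.subspaceI lin_pointwise[OF assms(2)] simp: F.vector_space_axioms)
qed

section \<open>Finite dual families\<close>

text \<open>A finite family \<open>B\<close> with functionals \<open>e\<close> that expands every vector of \<open>K\<close>.  Modulo functionals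
  vanishing on \<open>K\<close>, a functional \<open>\<xi>\<close> is then \<open>\<Sum>\<^sub>b \<xi>(b) e\<^sub>b\<close>; this is how the topology of a dual space,
  whose basic neighbourhoods of \<open>0\<close> are the annihilators of finite sets, enters all constructions.\<close>

definition dual_family :: "('k::field, 'v::ab_group_add, 'x) tvs_scheme \<Rightarrow> 'v set \<Rightarrow> 'v set
    \<Rightarrow> ('v \<Rightarrow> 'v \<Rightarrow> 'k) \<Rightarrow> bool" where
  "dual_family V K B e \<longleftrightarrow> finite B \<and> B \<subseteq> carr V \<and> (\<forall>b\<in>B. lin V fld (e b))
     \<and> (\<forall>v\<in>K. v = (\<Sum>b\<in>B. sc V (e b v) b))"

lemma dual_family_exists:
  fixes V :: "('k::field, 'v::ab_group_add, 'x) tvs_scheme"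
  assumes V: "vec V" and K: "finite K" "K \<subseteq> carr V"
  shows "\<exists>B e. dual_family V K B e"
proof -
  interpret V: vector_space "sc V" by (rule vec_vector_space[OF V])
  interpret VF: vector_space_pair "sc V" "(*) :: 'k \<Rightarrow> 'k \<Rightarrow> 'k"
    by (simp add: vector_space_pair_def V.vector_space_axioms vector_space_fld)
  obtain B where B: "B \<subseteq> K" "V.independent B" "K \<subseteq> V.span B"
    using V.maximal_independent_subset by blast
  have fB: "finite B" using B(1) K(1) finite_subset by blast
  have "\<exists>g. Vector_Spaces.linear (sc V) (*) g \<and> (\<forall>x\<in>B. g x = (if x = b then 1 else 0))" for b
    using VF.linear_independent_extend[OF B(2), of "\<lambda>x. if x = b then 1 else 0"] .
  then obtain g where g: "\<And>b. Vector_Spaces.linear (sc V) (*) (g b)"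
    "\<And>b x. x \<in> B \<Longrightarrow> g b x = (if x = b then 1 else 0)" by metis
  define e where "e b v = (if v \<in> carr V then g b v else 0)" for b v
  have "lin V fld (e b)" for b
    using g(1)[of b] vec_add[OF V] vec_scale[OF V]
    by (auto simp: lin_def e_def VF.linear_add VF.linear_scale)
  moreover have "v = (\<Sum>b\<in>B. sc V (e b v) b)" if v: "v \<in> K" for v
  proof -
    obtain u where u: "v = (\<Sum>x\<in>B. sc V (u x) x)"
      using B(3) v V.span_finite[OF fB] by auto
    have "g b v = u b" if "b \<in> B" for b
    proof -
      have "g b v = (\<Sum>x\<in>B. u x * g b x)"
        using g(1)[of b] by (simp add: u VF.linear_sum VF.linear_scale)
      also have "\<dots> = (\<Sum>x\<in>B. if x = b then u x else 0)"
        by (intro sum.cong) (simp_all add: g(2))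
      also have "\<dots> = u b" using fB that by simp
      finally show ?thesis .
    qed
    then show ?thesis using v K(2) u by (simp add: e_def subset_iff cong: sum.cong)
  qed
  ultimately have "dual_family V K B e"
    using fB B(1) K(2) unfolding dual_family_def by (intro conjI ballI) blast+
  then show ?thesis by blast
qed

lemma dual_familyD:
  assumes "dual_family V K B e"
  shows "finite B" "b \<in> B \<Longrightarrow> b \<in> carr V" "b \<in> B \<Longrightarrow> lin V fld (e b)"
    "v \<in> K \<Longrightarrow> v = (\<Sum>b\<in>B. sc V (e b v) b)"
  using assms unfolding dual_family_def by (blast, blast, blast, blast)

lemma functionals_separate:
  fixes V :: "('k::field, 'v::ab_group_add, 'x) tvs_scheme"
  assumes V: "vec V" and xy: "x \<in> carr V" "y \<in> carr V"
    and eq: "\<And>\<xi>. lin V (fld :: ('k, 'k) tvs) \<xi> \<Longrightarrow> \<xi> x = \<xi> y"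
  shows "x = y"
proof -
  obtain B and e :: "'v \<Rightarrow> 'v \<Rightarrow> 'k" where B: "dual_family V {x, y} B e"
    using dual_family_exists[OF V, of "{x, y}"] xy by blast
  have "x = (\<Sum>b\<in>B. sc V (e b x) b)" by (rule dual_familyD(4)[OF B]) simp
  also have "\<dots> = (\<Sum>b\<in>B. sc V (e b y) b)"
    using eq dual_familyD(3)[OF B] by (metis (no_types, lifting) sum.cong)
  also have "\<dots> = y" by (rule dual_familyD(4)[OF B, symmetric]) simp
  finally show ?thesis .
qed

text \<open>A linear map on \<open>V\<^sup>*\<close> that vanishes on the annihilator of \<open>K\<close> is given by an element of
  \<open>Z \<otimes> V\<close>, namely \<open>\<Sum>\<^sub>b G(e\<^sub>b) \<otimes> b\<close>.\<close>

lemma dual_expansion: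
  fixes V :: "('k::field, 'v::ab_group_add, 'x) tvs_scheme"
  assumes V: "discrete_vec V" and Z: "vec Z"
    and G: "lin_on (dual V) Z G"
    and van: "\<And>\<xi>. lin V fld \<xi> \<Longrightarrow> (\<And>v. v \<in> K \<Longrightarrow> \<xi> v = 0) \<Longrightarrow> G \<xi> = 0"
    and B: "dual_family V K B e" and \<xi>: "lin V fld \<xi>"
  shows "G \<xi> = (\<Sum>b\<in>B. sc Z (\<xi> b) (G (e b)))"
proof -
  note vV = discrete_vec_imp_vec[OF V]
  have vd: "vec (dual V)" by (rule vec_Homk_discrete[OF V vec_fld])
  have carr: "carr (dual V) = {f. lin V fld f}" by (simp add: hom_set_discrete[OF V])
  have in_d: "\<xi> \<in> carr (dual V)" "\<And>b. b \<in> B \<Longrightarrow> e b \<in> carr (dual V)"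
    using \<xi> dual_familyD(3)[OF B] carr by auto
  define \<eta> where "\<eta> = (\<Sum>b\<in>B. sc (dual V) (\<xi> b) (e b))"
  have term_d: "sc (dual V) (\<xi> b) (e b) \<in> carr (dual V)" if "b \<in> B" for b
    using vec_scale[OF vd in_d(2)[OF that]] .
  have \<eta>d: "\<eta> \<in> carr (dual V)" unfolding \<eta>_def by (rule vec_sum[OF vd term_d])
  have diff: "lin V fld (\<xi> - \<eta>)" using vec_diff[OF vd in_d(1) \<eta>d] carr by auto
  have "(\<xi> - \<eta>) v = 0" if v: "v \<in> K" for v
  proof -
    have "\<xi> v = \<xi> (\<Sum>b\<in>B. sc V (e b v) b)" by (rule arg_cong[OF dual_familyD(4)[OF B v]])
    also have "\<dots> = (\<Sum>b\<in>B. \<xi> (sc V (e b v) b))"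
      by (rule lin_on_sum[OF vV lin_imp_lin_on[OF \<xi>]])
        (use dual_familyD(2)[OF B] vec_scale[OF vV] in blast)
    also have "\<dots> = (\<Sum>b\<in>B. \<xi> b * e b v)"
      using lin_on_scale[OF lin_imp_lin_on[OF \<xi>]] dual_familyD(2)[OF B]
      by (intro sum.cong) (auto simp: mult.commute)
    also have "\<dots> = \<eta> v" by (simp add: \<eta>_def sum_fun_apply sc_Homk)
    finally show ?thesis by simp
  qed
  then have "G (\<xi> - \<eta>) = 0" using van[OF diff] by blast
  then have "G \<xi> = G \<eta>" using lin_on_diff[OF vd G in_d(1) \<eta>d] by simp
  also have "\<dots> = (\<Sum>b\<in>B. G (sc (dual V) (\<xi> b) (e b)))"
    unfolding \<eta>_def by (rule lin_on_sum[OF vd G term_d])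
  also have "\<dots> = (\<Sum>b\<in>B. sc Z (\<xi> b) (G (e b)))"
    by (intro sum.cong refl lin_on_scale[OF G] in_d)
  finally show ?thesis .
qed

section \<open>Tensor products and their slices\<close>

declare vec_tensor [simp]

lemma carr_tensor: "carr (V \<otimes> W)
    = module.span (\<lambda>c t b. c * t b) {pure V W v w | v w. v \<in> carr V \<and> w \<in> carr W}"
  by (simp add: tensor_def)

lemma sc_tensor: "sc (V \<otimes> W) = (\<lambda>c t b. c * t b)"
  by (simp add: tensor_def)

lemma pureD:
  fixes V :: "('k::field, 'v::ab_group_add, 'x) tvs_scheme"
    and W :: "('k, 'w::ab_group_add, 'y) tvs_scheme"
  assumes "v \<in> carr V" "w \<in> carr W"
  shows pure_carr: "pure V W v w \<in> carr (V \<otimes> W)"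
    and pure_add_left: "v' \<in> carr V \<Longrightarrow> pure V W (v + v') w = pure V W v w + pure V W v' w"
    and pure_add_right: "w' \<in> carr W \<Longrightarrow> pure V W v (w + w') = pure V W v w + pure V W v w'"
    and pure_scale_left: "pure V W (sc V c v) w = sc (V \<otimes> W) c (pure V W v w)"
    and pure_scale_right: "pure V W v (sc W c w) = sc (V \<otimes> W) c (pure V W v w)"
  using assms bilin_pure[of V W] unfolding bilin_def by blast+

lemma lin_on_pure_left: "w \<in> carr W \<Longrightarrow> lin_on V (V \<otimes> W) (\<lambda>v. pure V W v w)"
  by (simp add: lin_on_def pureD)

lemma lin_on_pure_right: "v \<in> carr V \<Longrightarrow> lin_on W (V \<otimes> W) (\<lambda>w. pure V W v w)"
  by (simp add: lin_on_def pureD)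

text \<open>Scalars are absorbed into the left factor, so sums of pure tensors suffice.\<close>

lemma tensor_induct [consumes 2, case_names zero step]:
  fixes V :: "('k::field, 'v::ab_group_add, 'x) tvs_scheme"
    and W :: "('k, 'w::ab_group_add, 'y) tvs_scheme"
  assumes V: "vec V" and t: "t \<in> carr (V \<otimes> W)" and z: "P 0"
    and s: "\<And>v w t. v \<in> carr V \<Longrightarrow> w \<in> carr W \<Longrightarrow> t \<in> carr (V \<otimes> W) \<Longrightarrow> P t \<Longrightarrow> P (pure V W v w + t)"
  shows "P t"
proof -
  interpret T: vector_space "\<lambda>c (t :: ('k, 'v, 'w) tensor) b. c * t b"
    by (rule vector_space_tensor)
  have "t \<in> carr (V \<otimes> W) \<and> P t" using t[unfolded carr_tensor]
  proof (induction rule: T.span_induct_alt)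
    case base
    show ?case by (intro conjI z vec_zero vec_tensor)
  next
    case (step c x y)
    then obtain v w where vw: "x = pure V W v w" "v \<in> carr V" "w \<in> carr W" by blast
    have "(\<lambda>b. c * x b) = pure V W (sc V c v) w"
      by (simp only: vw(1) pure_scale_left[OF vw(2,3)] sc_tensor)
    have cv: "sc V c v \<in> carr V" by (rule vec_scale[OF V vw(2)])
    have y: "y \<in> carr (V \<otimes> W)" "P y" using step by blast+
    show ?case
      unfolding \<open>(\<lambda>b. c * x b) = _\<close>
      by (intro conjI vec_add[OF vec_tensor] pure_carr cv vw(3) y s)
  qed
  then show ?thesis by blast
qed

lemma tensor_lin_eqI:
  assumes V: "vec V" and h: "lin_on (V \<otimes> W) Z h" and h': "lin_on (V \<otimes> W) Z h'"
    and eq: "\<And>v w. v \<in> carr V \<Longrightarrow> w \<in> carr W \<Longrightarrow> h (pure V W v w) = h' (pure V W v w)"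
    and t: "t \<in> carr (V \<otimes> W)"
  shows "h t = h' t"
  using V t
proof (induction rule: tensor_induct)
  case zero
  show ?case unfolding lin_on_zero[OF vec_tensor h] lin_on_zero[OF vec_tensor h'] ..
next
  case (step v w t)
  then show "h (pure V W v w + t) = h' (pure V W v w + t)"
    by (simp add: lin_on_add[OF h] lin_on_add[OF h'] pure_carr eq)
qed

lemma tlift:
  assumes "vec Z" "bilin V W Z b"
  shows lin_tlift: "lin (V \<otimes> W) Z (tlift V W Z b)"
    and tlift_pure: "v \<in> carr V \<Longrightarrow> w \<in> carr W \<Longrightarrow> tlift V W Z b (pure V W v w) = b v w"
proof -
  have "tlift V W Z b \<in> carr (Homk (V \<otimes> W) Z)
      \<and> (\<forall>v\<in>carr V. \<forall>w\<in>carr W. tlift V W Z b (pure V W v w) = b v w)"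
    unfolding tlift_def by (rule theI'[OF tensor_universal[OF assms]])
  then show "lin (V \<otimes> W) Z (tlift V W Z b)"
    and "v \<in> carr V \<Longrightarrow> w \<in> carr W \<Longrightarrow> tlift V W Z b (pure V W v w) = b v w"
    by (auto simp: hom_set_def)
qed

lemma bilinI:
  assumes "\<And>w. w \<in> carr W \<Longrightarrow> lin_on V Z (\<lambda>v. b v w)"
    and "\<And>v. v \<in> carr V \<Longrightarrow> lin_on W Z (b v)"
  shows "bilin V W Z b"
  using assms unfolding bilin_def lin_on_def by blast

lemma lin_on_sc_left: "vec W \<Longrightarrow> lin_on V fld \<xi> \<Longrightarrow> w \<in> carr W \<Longrightarrow> lin_on V W (\<lambda>v. sc W (\<xi> v) w)"
  by (simp add: lin_on_def vec_laws vec_carr)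

lemma lin_on_sc_right: "vec W \<Longrightarrow> lin_on W W (sc W c)"
  by (simp add: lin_on_def vec_laws vec_carr mult.commute)

lemma tmap:
  assumes f: "lin_on V V' f" and g: "lin_on W W' g"
  shows lin_tmap: "lin (V \<otimes> W) (V' \<otimes> W') (tmap V W V' W' f g)"
    and tmap_pure: "v \<in> carr V \<Longrightarrow> w \<in> carr W \<Longrightarrow>
      tmap V W V' W' f g (pure V W v w) = pure V' W' (f v) (g w)"
proof -
  have "bilin V W (V' \<otimes> W') (\<lambda>v w. pure V' W' (f v) (g w))"
    by (rule bilinI) (simp_all add: lin_on_comp[OF f lin_on_pure_left] lin_on_carr[OF g]
        lin_on_comp[OF g lin_on_pure_right] lin_on_carr[OF f])
  note l = tlift[OF vec_tensor this]
  show "lin (V \<otimes> W) (V' \<otimes> W') (tmap V W V' W' f g)"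
    and "v \<in> carr V \<Longrightarrow> w \<in> carr W \<Longrightarrow>
      tmap V W V' W' f g (pure V W v w) = pure V' W' (f v) (g w)"
    unfolding tmap_def using l by blast+
qed

lemma rapply:
  assumes "vec V" "lin_on W fld \<xi>"
  shows lin_rapply: "lin (V \<otimes> W) V (rapply V W \<xi>)"
    and rapply_pure: "v \<in> carr V \<Longrightarrow> w \<in> carr W \<Longrightarrow> rapply V W \<xi> (pure V W v w) = sc V (\<xi> w) v"
proof -
  have "bilin V W V (\<lambda>v w. sc V (\<xi> w) v)"
    by (rule bilinI) (simp_all add: lin_on_sc_left lin_on_sc_right assms)
  note l = tlift[OF assms(1) this]
  show "lin (V \<otimes> W) V (rapply V W \<xi>)"
    and "v \<in> carr V \<Longrightarrow> w \<in> carr W \<Longrightarrow> rapply V W \<xi> (pure V W v w) = sc V (\<xi> w) v"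
    unfolding rapply_def using l by blast+
qed

lemma lapply:
  assumes "vec W" "lin_on V fld \<xi>"
  shows lin_lapply: "lin (V \<otimes> W) W (lapply V W \<xi>)"
    and lapply_pure: "v \<in> carr V \<Longrightarrow> w \<in> carr W \<Longrightarrow> lapply V W \<xi> (pure V W v w) = sc W (\<xi> v) w"
proof -
  have "bilin V W W (\<lambda>v w. sc W (\<xi> v) w)"
    by (rule bilinI) (simp_all add: lin_on_sc_left lin_on_sc_right assms)
  note l = tlift[OF assms(1) this]
  show "lin (V \<otimes> W) W (lapply V W \<xi>)"
    and "v \<in> carr V \<Longrightarrow> w \<in> carr W \<Longrightarrow> lapply V W \<xi> (pure V W v w) = sc W (\<xi> v) w"
    unfolding lapply_def using l by blast+
qed

lemmas lin_on_tmap = lin_imp_lin_on[OF lin_tmap]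
lemmas lin_on_rapply = lin_imp_lin_on[OF lin_rapply]
lemmas lin_on_lapply = lin_imp_lin_on[OF lin_lapply]

lemma bilin_assoc_inner:
  assumes "w \<in> carr W"
  shows "bilin U V (U \<otimes> (V \<otimes> W)) (\<lambda>u v. pure U (V \<otimes> W) u (pure V W v w))"
  using assms
  by (intro bilinI) (simp_all add: lin_on_pure_left pure_carr
      lin_on_comp[OF lin_on_pure_left lin_on_pure_right])

lemma assoc:
  assumes U: "vec U" and W: "vec W"
  shows lin_assoc: "lin ((U \<otimes> V) \<otimes> W) (U \<otimes> (V \<otimes> W)) (assoc U V W)"
    and assoc_pure: "u \<in> carr U \<Longrightarrow> v \<in> carr V \<Longrightarrow> w \<in> carr W \<Longrightarrow>
      assoc U V W (pure (U \<otimes> V) W (pure U V u v) w) = pure U (V \<otimes> W) u (pure V W v w)"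
proof -
  let ?i = "\<lambda>w. tlift U V (U \<otimes> (V \<otimes> W)) (\<lambda>u v. pure U (V \<otimes> W) u (pure V W v w))"
  note i = tlift[OF vec_tensor bilin_assoc_inner]
  have lin_t: "lin_on W (U \<otimes> (V \<otimes> W)) (\<lambda>w. ?i w t)" if t: "t \<in> carr (U \<otimes> V)" for t
    using U t
  proof (induction rule: tensor_induct)
    case zero
    have i0 [simp]: "?i w 0 = 0" if "w \<in> carr W" for w
      by (rule lin_on_zero[OF vec_tensor lin_imp_lin_on[OF i(1)[OF that]]])
    show "lin_on W (U \<otimes> (V \<otimes> W)) (\<lambda>w. ?i w 0)"
      unfolding lin_on_def
      by (auto simp only: i0 vec_zero[OF vec_tensor] vec_add[OF W] vec_scale[OF W] add_0
          sc_zero_right[OF vec_tensor])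
  next
    case (step u v t)
    have "?i w (pure U V u v + t) = pure U (V \<otimes> W) u (pure V W v w) + ?i w t"
      if "w \<in> carr W" for w
      using lin_on_add[OF lin_imp_lin_on[OF i(1)[OF that]] pure_carr[OF step(1,2)] step(3)]
      by (simp only: i(2)[OF that step(1,2)])
    moreover have "lin_on W (U \<otimes> (V \<otimes> W)) (\<lambda>w. pure U (V \<otimes> W) u (pure V W v w) + ?i w t)"
      by (rule lin_on_plus[OF vec_tensor
            lin_on_comp[OF lin_on_pure_right[OF step(2)] lin_on_pure_right[OF step(1)]] step(4)])
    ultimately show "lin_on W (U \<otimes> (V \<otimes> W)) (\<lambda>w'. ?i w' (pure U V u v + t))"
      using vec_add[OF W] vec_scale[OF W] by (simp add: lin_on_def)
  qed
  have "bilin (U \<otimes> V) W (U \<otimes> (V \<otimes> W)) (\<lambda>t w. ?i w t)"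
    by (rule bilinI) (simp_all add: lin_t lin_imp_lin_on[OF i(1)])
  note l = tlift[OF vec_tensor this]
  show "lin ((U \<otimes> V) \<otimes> W) (U \<otimes> (V \<otimes> W)) (assoc U V W)"
    unfolding assoc_def by (rule l(1))
  show "assoc U V W (pure (U \<otimes> V) W (pure U V u v) w) = pure U (V \<otimes> W) u (pure V W v w)"
    if "u \<in> carr U" "v \<in> carr V" "w \<in> carr W"
    unfolding assoc_def using that by (simp add: l(2) pure_carr i(2))
qed

lemma lapply_tmap:
  assumes "vec V" "vec W'" "lin_on V V' f" "lin_on W W' g" "lin_on V' fld \<xi>" "t \<in> carr (V \<otimes> W)"
    and "vec W"
  shows "lapply V' W' \<xi> (tmap V W V' W' f g t) = g (lapply V W (\<lambda>v. \<xi> (f v)) t)"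
proof (rule tensor_lin_eqI[OF assms(1) _ _ _ assms(6)])
  note \<xi>f = lin_on_comp[OF assms(3,5)]
  show "lin_on (V \<otimes> W) W' (\<lambda>t. lapply V' W' \<xi> (tmap V W V' W' f g t))"
    by (rule lin_on_comp[OF lin_on_tmap[OF assms(3,4)] lin_on_lapply[OF assms(2,5)]])
  show "lin_on (V \<otimes> W) W' (\<lambda>t. g (lapply V W (\<lambda>v. \<xi> (f v)) t))"
    by (rule lin_on_comp[OF lin_on_lapply[OF assms(7) \<xi>f] assms(4)])
  show "lapply V' W' \<xi> (tmap V W V' W' f g (pure V W v w)) = g (lapply V W (\<lambda>v. \<xi> (f v)) (pure V W v w))"
    if "v \<in> carr V" "w \<in> carr W" for v w
    using that by (simp add: tmap_pure[OF assms(3,4)] lapply_pure[OF assms(2,5)]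
        lapply_pure[OF assms(7) \<xi>f] lin_on_carr[OF assms(3)] lin_on_carr[OF assms(4)]
        lin_on_scale[OF assms(4)])
qed

lemma rapply_tmap:
  assumes "vec V" "vec V'" "lin_on V V' f" "lin_on W W' g" "lin_on W' fld \<xi>" "t \<in> carr (V \<otimes> W)"
  shows "rapply V' W' \<xi> (tmap V W V' W' f g t) = f (rapply V W (\<lambda>w. \<xi> (g w)) t)"
proof (rule tensor_lin_eqI[OF assms(1) _ _ _ assms(6)])
  note \<xi>g = lin_on_comp[OF assms(4,5)]
  show "lin_on (V \<otimes> W) V' (\<lambda>t. rapply V' W' \<xi> (tmap V W V' W' f g t))"
    by (rule lin_on_comp[OF lin_on_tmap[OF assms(3,4)] lin_on_rapply[OF assms(2,5)]])
  show "lin_on (V \<otimes> W) V' (\<lambda>t. f (rapply V W (\<lambda>w. \<xi> (g w)) t))"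
    by (rule lin_on_comp[OF lin_on_rapply[OF assms(1) \<xi>g] assms(3)])
  show "rapply V' W' \<xi> (tmap V W V' W' f g (pure V W v w)) = f (rapply V W (\<lambda>w. \<xi> (g w)) (pure V W v w))"
    if "v \<in> carr V" "w \<in> carr W" for v w
    using that by (simp add: tmap_pure[OF assms(3,4)] rapply_pure[OF assms(2,5)]
        rapply_pure[OF assms(1) \<xi>g] lin_on_carr[OF assms(3)] lin_on_carr[OF assms(4)]
        lin_on_scale[OF assms(3)])
qed

lemma tensor3_lin_eqI:
  assumes U: "vec U" and h: "lin_on ((U \<otimes> V) \<otimes> W) Z h" and h': "lin_on ((U \<otimes> V) \<otimes> W) Z h'"
    and eq: "\<And>u v w. u \<in> carr U \<Longrightarrow> v \<in> carr V \<Longrightarrow> w \<in> carr W \<Longrightarrow>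
      h (pure (U \<otimes> V) W (pure U V u v) w) = h' (pure (U \<otimes> V) W (pure U V u v) w)"
    and t: "t \<in> carr ((U \<otimes> V) \<otimes> W)"
  shows "h t = h' t"
proof (rule tensor_lin_eqI[OF vec_tensor h h' _ t])
  fix s w assume s: "s \<in> carr (U \<otimes> V)" and w: "w \<in> carr W"
  note p = lin_on_pure_left[OF w, of "U \<otimes> V"]
  show "h (pure (U \<otimes> V) W s w) = h' (pure (U \<otimes> V) W s w)"
    by (rule tensor_lin_eqI[OF U lin_on_comp[OF p h] lin_on_comp[OF p h'] _ s]) (simp add: eq w)
qed

text \<open>A slice by functionals on two factors of a triple tensor product does not see the bracketing.\<close>

lemma lapply_lapply_assoc:
  assumes U: "vec U" and V: "vec V" and W: "vec W" and \<nu>: "lin_on U fld \<nu>" and \<phi>: "lin_on V fld \<phi>"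
    and s: "s \<in> carr ((U \<otimes> V) \<otimes> W)"
  shows "lapply V W \<phi> (lapply U (V \<otimes> W) \<nu> (assoc U V W s))
    = lapply (U \<otimes> V) W (\<lambda>t. \<nu> (rapply U V \<phi> t)) s"
proof (rule tensor3_lin_eqI[OF U _ _ _ s])
  note \<zeta> = lin_on_comp[OF lin_on_rapply[OF U \<phi>] \<nu>]
  show "lin_on ((U \<otimes> V) \<otimes> W) W (\<lambda>s. lapply V W \<phi> (lapply U (V \<otimes> W) \<nu> (assoc U V W s)))"
    by (intro lin_on_comp[OF lin_on_comp[OF lin_imp_lin_on[OF lin_assoc[OF U W]]
          lin_on_lapply[OF vec_tensor \<nu>]] lin_on_lapply[OF W \<phi>]])
  show "lin_on ((U \<otimes> V) \<otimes> W) W (lapply (U \<otimes> V) W (\<lambda>t. \<nu> (rapply U V \<phi> t)))"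
    by (rule lin_on_lapply[OF W \<zeta>])
  show "lapply V W \<phi> (lapply U (V \<otimes> W) \<nu> (assoc U V W (pure (U \<otimes> V) W (pure U V u v) w)))
    = lapply (U \<otimes> V) W (\<lambda>t. \<nu> (rapply U V \<phi> t)) (pure (U \<otimes> V) W (pure U V u v) w)"
    if "u \<in> carr U" "v \<in> carr V" "w \<in> carr W" for u v w
    using that by (simp add: assoc_pure[OF U W] pure_carr lapply_pure[OF vec_tensor \<nu>]
        lapply_pure[OF W \<phi>] lapply_pure[OF W \<zeta>] rapply_pure[OF U \<phi>]
        lin_on_scale[OF lin_on_lapply[OF W \<phi>]] lin_on_scale[OF \<nu>] sc_sc[OF W] mult.commute)
qed

lemma rapply_lapply_assoc:
  assumes U: "vec U" and V: "vec V" and W: "vec W" and \<nu>: "lin_on U fld \<nu>" and \<xi>: "lin_on W fld \<xi>"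
    and s: "s \<in> carr ((U \<otimes> V) \<otimes> W)"
  shows "rapply V W \<xi> (lapply U (V \<otimes> W) \<nu> (assoc U V W s)) = lapply U V \<nu> (rapply (U \<otimes> V) W \<xi> s)"
proof (rule tensor3_lin_eqI[OF U _ _ _ s])
  show "lin_on ((U \<otimes> V) \<otimes> W) V (\<lambda>s. rapply V W \<xi> (lapply U (V \<otimes> W) \<nu> (assoc U V W s)))"
    by (intro lin_on_comp[OF lin_on_comp[OF lin_imp_lin_on[OF lin_assoc[OF U W]]
          lin_on_lapply[OF vec_tensor \<nu>]] lin_on_rapply[OF V \<xi>]])
  show "lin_on ((U \<otimes> V) \<otimes> W) V (\<lambda>s. lapply U V \<nu> (rapply (U \<otimes> V) W \<xi> s))"
    by (rule lin_on_comp[OF lin_on_rapply[OF vec_tensor \<xi>] lin_on_lapply[OF V \<nu>]])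
  show "rapply V W \<xi> (lapply U (V \<otimes> W) \<nu> (assoc U V W (pure (U \<otimes> V) W (pure U V u v) w)))
    = lapply U V \<nu> (rapply (U \<otimes> V) W \<xi> (pure (U \<otimes> V) W (pure U V u v) w))"
    if "u \<in> carr U" "v \<in> carr V" "w \<in> carr W" for u v w
    using that by (simp add: assoc_pure[OF U W] pure_carr lapply_pure[OF vec_tensor \<nu>]
        rapply_pure[OF V \<xi>] rapply_pure[OF vec_tensor \<xi>] lapply_pure[OF V \<nu>]
        lin_on_scale[OF lin_on_rapply[OF V \<xi>]] lin_on_scale[OF lin_on_lapply[OF V \<nu>]]
        sc_sc[OF V] mult.commute)
qed

section \<open>Elements of a tensor product from their slices\<close>

lemma dual_family_mono: "dual_family V K B e \<Longrightarrow> K' \<subseteq> K \<Longrightarrow> dual_family V K' B e"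
  unfolding dual_family_def by blast

text \<open>By linearity this reduces to a pure tensor \<open>v \<otimes> w\<close>, where \<open>K = {w}\<close> works for every dual family.
  For a sum the two sets are joined; here it matters that every family for a larger set still works.\<close>

lemma rapply_expansion_over:
  assumes V: "vec V" and W: "vec W" and t: "t \<in> carr (V \<otimes> W)"
  shows "\<exists>K. finite K \<and> K \<subseteq> carr W
    \<and> (\<forall>B e. dual_family W K B e \<longrightarrow> t = (\<Sum>b\<in>B. pure V W (rapply V W (e b) t) b))"
  using V t
proof (induction rule: tensor_induct)
  case zero
  have "(0 :: ('a, 'b, 'd) tensor) = (\<Sum>b\<in>B. pure V W (rapply V W (e b) 0) b)"
    if B: "dual_family W {} B e" for B e
  proof -
    have "pure V W (rapply V W (e b) 0) b = 0" if "b \<in> B" for b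
      unfolding lin_on_zero[OF vec_tensor lin_on_rapply[OF V lin_imp_lin_on[OF dual_familyD(3)[OF B that]]]]
      by (rule lin_on_zero[OF V lin_on_pure_left[OF dual_familyD(2)[OF B that]]])
    then show ?thesis by simp
  qed
  then show "\<exists>K. finite K \<and> K \<subseteq> carr W
    \<and> (\<forall>B e. dual_family W K B e \<longrightarrow> 0 = (\<Sum>b\<in>B. pure V W (rapply V W (e b) 0) b))" by blast
next
  case (step v w t)
  then obtain K where K: "finite K" "K \<subseteq> carr W"
    "\<And>B e. dual_family W K B e \<Longrightarrow> t = (\<Sum>b\<in>B. pure V W (rapply V W (e b) t) b)" by blast
  let ?p = "pure V W v w"
  note p = pure_carr[OF step(1,2)]
  have "?p + t = (\<Sum>b\<in>B. pure V W (rapply V W (e b) (?p + t)) b)"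
    if B: "dual_family W (insert w K) B e" for B e
  proof -
    note BD = dual_familyD[OF B]
    have "?p = pure V W v (\<Sum>b\<in>B. sc W (e b w) b)"
      by (rule arg_cong[OF BD(4)]) simp
    also have "\<dots> = (\<Sum>b\<in>B. pure V W v (sc W (e b w) b))"
      by (rule lin_on_sum[OF W lin_on_pure_right[OF step(1)]]) (rule vec_scale[OF W BD(2)])
    also have "\<dots> = (\<Sum>b\<in>B. pure V W (rapply V W (e b) ?p) b)"
      by (intro sum.cong refl)
        (simp add: rapply_pure[OF V lin_imp_lin_on[OF BD(3)] step(1,2)] step(1) BD(2)
          pure_scale_left pure_scale_right)
    finally have e1: "?p = (\<Sum>b\<in>B. pure V W (rapply V W (e b) ?p) b)" .
    have e2: "t = (\<Sum>b\<in>B. pure V W (rapply V W (e b) t) b)"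
      by (rule K(3)[OF dual_family_mono[OF B]]) blast
    have "pure V W (rapply V W (e b) (?p + t)) b
        = pure V W (rapply V W (e b) ?p) b + pure V W (rapply V W (e b) t) b" if b: "b \<in> B" for b
    proof -
      note r = lin_on_rapply[OF V lin_imp_lin_on[OF BD(3)[OF b]]]
      show ?thesis
        unfolding lin_on_add[OF r p step(3)]
        by (rule pure_add_left[OF lin_on_carr[OF r p] BD(2)[OF b] lin_on_carr[OF r step(3)]])
    qed
    then have "(\<Sum>b\<in>B. pure V W (rapply V W (e b) (?p + t)) b)
        = (\<Sum>b\<in>B. pure V W (rapply V W (e b) ?p) b) + (\<Sum>b\<in>B. pure V W (rapply V W (e b) t) b)"
      by (simp only: sum.distrib[symmetric] cong: sum.cong)
    then show ?thesis using e1 e2 by metis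
  qed
  then show "\<exists>K. finite K \<and> K \<subseteq> carr W \<and> (\<forall>B e. dual_family W K B e \<longrightarrow>
      ?p + t = (\<Sum>b\<in>B. pure V W (rapply V W (e b) (?p + t)) b))"
    using K(1,2) step(2) by (intro exI[of _ "insert w K"]) blast
qed

lemma rapply_expansion:
  assumes V: "vec V" and W: "vec W" and t: "t \<in> carr (V \<otimes> W)"
  obtains B e where "finite B" "B \<subseteq> carr W" "\<And>b. b \<in> B \<Longrightarrow> lin W fld (e b)"
    "t = (\<Sum>b\<in>B. pure V W (rapply V W (e b) t) b)"
proof -
  obtain K where K: "finite K" "K \<subseteq> carr W"
    "\<And>B e. dual_family W K B e \<Longrightarrow> t = (\<Sum>b\<in>B. pure V W (rapply V W (e b) t) b)"
    using rapply_expansion_over[OF assms] by blast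
  obtain B e where B: "dual_family W K B e" using dual_family_exists[OF W K(1,2)] by blast
  show thesis
    by (rule that[OF dual_familyD(1)[OF B] _ _ K(3)[OF B]]) (use dual_familyD[OF B] in blast)+
qed

lemma rapply_sum_pure:
  assumes V: "vec V" and \<xi>: "lin_on W fld \<xi>" and a: "\<And>b. b \<in> B \<Longrightarrow> a b \<in> carr V"
    and B: "\<And>b. b \<in> B \<Longrightarrow> b \<in> carr W"
  shows "rapply V W \<xi> (\<Sum>b\<in>B. pure V W (a b) b) = (\<Sum>b\<in>B. sc V (\<xi> b) (a b))"
  using lin_on_sum[OF vec_tensor lin_on_rapply[OF V \<xi>], of B "\<lambda>b. pure V W (a b) b"]
  by (simp add: pure_carr a B rapply_pure[OF V \<xi>] cong: sum.cong)

lemma rapply_support: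
  assumes V: "vec V" and W: "vec W" and t: "t \<in> carr (V \<otimes> W)"
  obtains K where "finite K" "K \<subseteq> carr W"
    "\<And>\<xi>. lin W fld \<xi> \<Longrightarrow> (\<And>w. w \<in> K \<Longrightarrow> \<xi> w = 0) \<Longrightarrow> rapply V W \<xi> t = 0"
proof -
  obtain B e where B: "finite B" "B \<subseteq> carr W" "\<And>b. b \<in> B \<Longrightarrow> lin W fld (e b)"
    "t = (\<Sum>b\<in>B. pure V W (rapply V W (e b) t) b)"
    by (rule rapply_expansion[OF assms]) (rule that; assumption)
  have "rapply V W \<xi> t = 0" if \<xi>: "lin W fld \<xi>" and z: "\<And>w. w \<in> B \<Longrightarrow> \<xi> w = 0" for \<xi>
  proof -
    have "rapply V W \<xi> t = rapply V W \<xi> (\<Sum>b\<in>B. pure V W (rapply V W (e b) t) b)"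
      by (rule arg_cong[OF B(4)])
    also have "\<dots> = (\<Sum>b\<in>B. sc V (\<xi> b) (rapply V W (e b) t))"
      using B(2,3) t by (intro rapply_sum_pure V lin_imp_lin_on[OF \<xi>])
        (auto intro!: lin_on_carr[OF lin_on_rapply[OF V lin_imp_lin_on]])
    also have "\<dots> = 0" using z by (simp add: sc_zero_left[OF V])
    finally show ?thesis .
  qed
  then show thesis using that B(1,2) by blast
qed

lemma rapply_separates:
  fixes V :: "('k::field, 'v::ab_group_add, 'x) tvs_scheme"
    and W :: "('k, 'w::ab_group_add, 'y) tvs_scheme"
  assumes V: "vec V" and W: "vec W" and t: "t \<in> carr (V \<otimes> W)" and t': "t' \<in> carr (V \<otimes> W)"
    and eq: "\<And>\<xi>. lin W (fld :: ('k, 'k) tvs) \<xi> \<Longrightarrow> rapply V W \<xi> t = rapply V W \<xi> t'"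
  shows "t = t'"
proof -
  have d: "t - t' \<in> carr (V \<otimes> W)" by (rule vec_diff[OF vec_tensor t t'])
  obtain B and e :: "'w \<Rightarrow> 'w \<Rightarrow> 'k" where B: "finite B" "B \<subseteq> carr W" "\<And>b. b \<in> B \<Longrightarrow> lin W fld (e b)"
    "t - t' = (\<Sum>b\<in>B. pure V W (rapply V W (e b) (t - t')) b)"
    by (rule rapply_expansion[OF V W d]) (rule that; assumption)
  have "pure V W (rapply V W (e b) (t - t')) b = 0" if "b \<in> B" for b
  proof -
    have "rapply V W (e b) (t - t') = 0"
      using lin_on_diff[OF vec_tensor lin_on_rapply[OF V lin_imp_lin_on[OF B(3)[OF that]]] t t']
        eq[OF B(3)[OF that]] by simp
    then show ?thesis using lin_on_zero[OF V lin_on_pure_left[of b W V]] B(2) that by auto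
  qed
  then have "t - t' = 0" by (subst B(4)) (rule sum.neutral, blast)
  then show ?thesis by (simp only: right_minus_eq)
qed

text \<open>The identification of \<open>V \<otimes> W\<close> with the space of continuous linear maps \<open>W\<^sup>* \<rightarrow> V\<close>.\<close>

lemma rapply_represents:
  assumes V: "vec V" and W: "discrete_vec W" and K: "finite K" "K \<subseteq> carr W"
    and G: "lin_on (dual W) V G"
    and van: "\<And>\<xi>. lin W fld \<xi> \<Longrightarrow> (\<And>w. w \<in> K \<Longrightarrow> \<xi> w = 0) \<Longrightarrow> G \<xi> = 0"
  obtains t where "t \<in> carr (V \<otimes> W)" "\<And>\<xi>. lin W fld \<xi> \<Longrightarrow> rapply V W \<xi> t = G \<xi>"
proof -
  obtain B e where B: "dual_family W K B e"
    using dual_family_exists[OF discrete_vec_imp_vec[OF W] K] by blast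
  note BD = dual_familyD[OF B]
  have Ge: "G (e b) \<in> carr V" if "b \<in> B" for b
    using lin_on_carr[OF G] BD(3)[OF that] by (simp add: hom_set_discrete[OF W])
  show thesis
  proof
    show "(\<Sum>b\<in>B. pure V W (G (e b)) b) \<in> carr (V \<otimes> W)"
      by (intro vec_sum[OF vec_tensor] pure_carr Ge BD(2))
    show "rapply V W \<xi> (\<Sum>b\<in>B. pure V W (G (e b)) b) = G \<xi>" if \<xi>: "lin W fld \<xi>" for \<xi>
      using rapply_sum_pure[OF V lin_imp_lin_on[OF \<xi>] Ge BD(2)]
        dual_expansion[OF W V G van B \<xi>] by simp
  qed
qed

lemma lin_on_rapply_functional:
  assumes V: "vec V" and W: "discrete_vec W" and t: "t \<in> carr (V \<otimes> W)"
  shows "lin_on (dual W) V (\<lambda>\<xi>. rapply V W \<xi> t)"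
proof -
  note W' = discrete_vec_imp_vec[OF W]
  obtain B e where B: "finite B" "B \<subseteq> carr W" "\<And>b. b \<in> B \<Longrightarrow> lin W fld (e b)"
    "t = (\<Sum>b\<in>B. pure V W (rapply V W (e b) t) b)"
    by (rule rapply_expansion[OF V W' t]) (rule that; assumption)
  define a where "a b = rapply V W (e b) t" for b
  have a: "a b \<in> carr V" if "b \<in> B" for b
    unfolding a_def by (rule lin_on_carr[OF lin_on_rapply[OF V lin_imp_lin_on[OF B(3)[OF that]]] t])
  have eq: "rapply V W \<xi> t = (\<Sum>b\<in>B. sc V (\<xi> b) (a b))" if "lin W fld \<xi>" for \<xi>
  proof -
    have "rapply V W \<xi> t = rapply V W \<xi> (\<Sum>b\<in>B. pure V W (a b) b)"
      by (rule arg_cong[OF B(4)[folded a_def]])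
    also have "\<dots> = (\<Sum>b\<in>B. sc V (\<xi> b) (a b))"
      using B(2) by (intro rapply_sum_pure[OF V lin_imp_lin_on[OF that]] a) auto
    finally show ?thesis .
  qed
  have "lin_on (dual W) V (\<lambda>\<xi>. (\<Sum>b\<in>B. sc V (\<xi> b) (a b)))"
    unfolding lin_on_def sc_Homk
    by (simp add: a vec_scale[OF V] vec_sum[OF V] sc_add_left[OF V] sum.distrib sc_sum_right[OF V]
        sc_sc[OF V])
  moreover have "lin W fld (\<lambda>x. c * \<xi> x)" "lin W fld (\<xi> + \<eta>)" if "lin W fld \<xi>" "lin W fld \<eta>" for \<xi> \<eta> c
    using lin_plus[OF vec_fld] lin_cmult[OF vec_fld, of W \<xi> c] that by simp_all
  ultimately show ?thesis
    unfolding lin_on_def carr_Homk hom_set_discrete[OF W] sc_Homk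
    by (simp del: plus_fun_apply add: eq)
qed

text \<open>Transports the results on slices by functionals of the right factor to the left factor.\<close>

definition flip :: "('k::field, 'v::ab_group_add, 'x) tvs_scheme \<Rightarrow> ('k, 'w::ab_group_add, 'y) tvs_scheme
    \<Rightarrow> ('k, 'v, 'w) tensor \<Rightarrow> ('k, 'w, 'v) tensor" where
  "flip V W = tlift V W (W \<otimes> V) (\<lambda>v w. pure W V w v)"

lemma flip:
  shows lin_flip: "lin (V \<otimes> W) (W \<otimes> V) (flip V W)"
    and flip_pure: "v \<in> carr V \<Longrightarrow> w \<in> carr W \<Longrightarrow> flip V W (pure V W v w) = pure W V w v"
proof -
  have "bilin V W (W \<otimes> V) (\<lambda>v w. pure W V w v)"
    by (rule bilinI) (simp_all add: lin_on_pure_left lin_on_pure_right)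
  note l = tlift[OF vec_tensor this]
  show "lin (V \<otimes> W) (W \<otimes> V) (flip V W)"
    and "v \<in> carr V \<Longrightarrow> w \<in> carr W \<Longrightarrow> flip V W (pure V W v w) = pure W V w v"
    unfolding flip_def using l by blast+
qed

lemmas lin_on_flip = lin_imp_lin_on[OF lin_flip]

lemma flip_flip:
  assumes "vec V" "t \<in> carr (V \<otimes> W)"
  shows "flip W V (flip V W t) = t"
  by (rule tensor_lin_eqI[OF assms(1) lin_on_comp[OF lin_on_flip lin_on_flip] lin_on_id _ assms(2)])
    (simp add: flip_pure)

lemma rapply_flip:
  assumes V: "vec V" and W: "vec W" and \<xi>: "lin_on V fld \<xi>" and t: "t \<in> carr (V \<otimes> W)"
  shows "rapply W V \<xi> (flip V W t) = lapply V W \<xi> t"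
  by (rule tensor_lin_eqI[OF V lin_on_comp[OF lin_on_flip lin_on_rapply[OF W \<xi>]]
        lin_on_lapply[OF W \<xi>] _ t]) (simp add: flip_pure rapply_pure[OF W \<xi>] lapply_pure[OF W \<xi>])

lemma lapply_expansion:
  assumes V: "vec V" and W: "vec W" and t: "t \<in> carr (V \<otimes> W)"
  obtains B e where "finite B" "B \<subseteq> carr V" "\<And>b. b \<in> B \<Longrightarrow> lin V fld (e b)"
    "t = (\<Sum>b\<in>B. pure V W b (lapply V W (e b) t))"
proof -
  note ft = lin_on_carr[OF lin_on_flip t]
  obtain B e where B: "finite B" "B \<subseteq> carr V" "\<And>b. b \<in> B \<Longrightarrow> lin V fld (e b)"
    "flip V W t = (\<Sum>b\<in>B. pure W V (rapply W V (e b) (flip V W t)) b)"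
    by (rule rapply_expansion[OF W V ft]) (rule that; assumption)
  have r: "rapply W V (e b) (flip V W t) = lapply V W (e b) t" if "b \<in> B" for b
    by (rule rapply_flip[OF V W lin_imp_lin_on[OF B(3)[OF that]] t])
  have c: "lapply V W (e b) t \<in> carr W" if "b \<in> B" for b
    by (rule lin_on_carr[OF lin_on_lapply[OF W lin_imp_lin_on[OF B(3)[OF that]]] t])
  have "t = flip W V (flip V W t)" by (rule flip_flip[OF V t, symmetric])
  also have "\<dots> = flip W V (\<Sum>b\<in>B. pure W V (rapply W V (e b) (flip V W t)) b)"
    by (rule arg_cong[OF B(4)])
  also have "\<dots> = flip W V (\<Sum>b\<in>B. pure W V (lapply V W (e b) t) b)"
    by (simp add: r cong: sum.cong)
  also have "\<dots> = (\<Sum>b\<in>B. flip W V (pure W V (lapply V W (e b) t) b))"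
    using B(2) c by (intro lin_on_sum[OF vec_tensor lin_on_flip] pure_carr) auto
  also have "\<dots> = (\<Sum>b\<in>B. pure V W b (lapply V W (e b) t))"
    using B(2) c by (intro sum.cong refl flip_pure) auto
  finally show thesis using that B(1-3) by blast
qed

lemma lapply_support:
  assumes V: "vec V" and W: "vec W" and t: "t \<in> carr (V \<otimes> W)"
  obtains K where "finite K" "K \<subseteq> carr V"
    "\<And>\<xi>. lin V fld \<xi> \<Longrightarrow> (\<And>v. v \<in> K \<Longrightarrow> \<xi> v = 0) \<Longrightarrow> lapply V W \<xi> t = 0"
proof -
  obtain K where K: "finite K" "K \<subseteq> carr V"
    "\<And>\<xi>. lin V fld \<xi> \<Longrightarrow> (\<And>v. v \<in> K \<Longrightarrow> \<xi> v = 0) \<Longrightarrow> rapply W V \<xi> (flip V W t) = 0"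
    using rapply_support[OF W V lin_on_carr[OF lin_on_flip t]] by blast
  show thesis
    by (rule that[OF K(1,2)]) (simp add: K(3) flip: rapply_flip[OF V W lin_imp_lin_on t])
qed

lemma lapply_separates:
  fixes V :: "('k::field, 'v::ab_group_add, 'x) tvs_scheme"
    and W :: "('k, 'w::ab_group_add, 'y) tvs_scheme"
  assumes V: "vec V" and W: "vec W" and t: "t \<in> carr (V \<otimes> W)" and t': "t' \<in> carr (V \<otimes> W)"
    and eq: "\<And>\<xi>. lin V (fld :: ('k, 'k) tvs) \<xi> \<Longrightarrow> lapply V W \<xi> t = lapply V W \<xi> t'"
  shows "t = t'"
proof -
  have "flip V W t = flip V W t'"
    by (rule rapply_separates[OF W V lin_on_carr[OF lin_on_flip t] lin_on_carr[OF lin_on_flip t']])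
      (simp add: rapply_flip[OF V W lin_imp_lin_on] t t' eq)
  then show ?thesis using flip_flip[OF V] t t' by metis
qed

lemma lapply_represents:
  assumes V: "discrete_vec V" and W: "vec W" and K: "finite K" "K \<subseteq> carr V"
    and G: "lin_on (dual V) W G"
    and van: "\<And>\<xi>. lin V fld \<xi> \<Longrightarrow> (\<And>v. v \<in> K \<Longrightarrow> \<xi> v = 0) \<Longrightarrow> G \<xi> = 0"
  obtains t where "t \<in> carr (V \<otimes> W)" "\<And>\<xi>. lin V fld \<xi> \<Longrightarrow> lapply V W \<xi> t = G \<xi>"
proof -
  note V' = discrete_vec_imp_vec[OF V]
  obtain t where t: "t \<in> carr (W \<otimes> V)" "\<And>\<xi>. lin V fld \<xi> \<Longrightarrow> rapply W V \<xi> t = G \<xi>"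
    using rapply_represents[OF W V K G van] by blast
  note f = lin_on_carr[OF lin_on_flip t(1)]
  show thesis
  proof
    show "flip W V t \<in> carr (V \<otimes> W)" by (rule f)
    show "lapply V W \<xi> (flip W V t) = G \<xi>" if "lin V fld \<xi>" for \<xi>
      using rapply_flip[OF V' W lin_imp_lin_on[OF that] f] flip_flip[OF W t(1)] t(2)[OF that]
      by simp
  qed
qed

lemma lin_on_lapply_functional:
  assumes V: "discrete_vec V" and W: "vec W" and t: "t \<in> carr (V \<otimes> W)"
  shows "lin_on (dual V) W (\<lambda>\<xi>. lapply V W \<xi> t)"
proof -
  note V' = discrete_vec_imp_vec[OF V]
  have eq: "lapply V W \<xi> t = rapply W V \<xi> (flip V W t)" if "\<xi> \<in> carr (dual V)" for \<xi>
    using rapply_flip[OF V' W _ t] that by (simp add: hom_set_discrete[OF V] lin_imp_lin_on)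
  have d: "vec (dual V)" by (rule vec_Homk_discrete[OF V vec_fld])
  show ?thesis
    using lin_on_rapply_functional[OF W V lin_on_carr[OF lin_on_flip t]] vec_add[OF d] vec_scale[OF d]
    unfolding lin_on_def by (simp del: carr_Homk add: eq)
qed

text \<open>Slices separate tensors, so a map into a tensor product is linear as soon as its slices are.\<close>

lemma lin_on_from_lapply:
  fixes V :: "('k::field, 'v::ab_group_add, 'x) tvs_scheme"
  assumes X: "vec X" and V: "vec V" and W: "vec W"
    and h: "\<And>x. x \<in> carr X \<Longrightarrow> h x \<in> carr (V \<otimes> W)"
    and l: "\<And>\<nu>. lin V (fld :: ('k, 'k) tvs) \<nu> \<Longrightarrow> lin_on X W (\<lambda>x. lapply V W \<nu> (h x))"
  shows "lin_on X (V \<otimes> W) h"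
  unfolding lin_on_def
proof (intro conjI ballI allI h)
  fix x y assume x: "x \<in> carr X" and y: "y \<in> carr X"
  show "h (x + y) = h x + h y"
  proof (rule lapply_separates[OF V W h[OF vec_add[OF X x y]] vec_add[OF vec_tensor h[OF x] h[OF y]]])
    fix \<nu> :: "'v \<Rightarrow> 'k" assume \<nu>: "lin V fld \<nu>"
    show "lapply V W \<nu> (h (x + y)) = lapply V W \<nu> (h x + h y)"
      by (simp only: lin_on_add[OF l[OF \<nu>] x y]
          lin_on_add[OF lin_on_lapply[OF W lin_imp_lin_on[OF \<nu>]] h[OF x] h[OF y]])
  qed
next
  fix c x assume x: "x \<in> carr X"
  show "h (sc X c x) = sc (V \<otimes> W) c (h x)"
  proof (rule lapply_separates[OF V W h[OF vec_scale[OF X x]] vec_scale[OF vec_tensor h[OF x]]])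
    fix \<nu> :: "'v \<Rightarrow> 'k" assume \<nu>: "lin V fld \<nu>"
    show "lapply V W \<nu> (h (sc X c x)) = lapply V W \<nu> (sc (V \<otimes> W) c (h x))"
      by (simp only: lin_on_scale[OF l[OF \<nu>] x]
          lin_on_scale[OF lin_on_lapply[OF W lin_imp_lin_on[OF \<nu>]] h[OF x]])
  qed
qed

lemma lin_on_from_rapply:
  fixes W :: "('k::field, 'w::ab_group_add, 'x) tvs_scheme"
  assumes X: "vec X" and V: "vec V" and W: "vec W"
    and h: "\<And>x. x \<in> carr X \<Longrightarrow> h x \<in> carr (V \<otimes> W)"
    and l: "\<And>\<nu>. lin W (fld :: ('k, 'k) tvs) \<nu> \<Longrightarrow> lin_on X V (\<lambda>x. rapply V W \<nu> (h x))"
  shows "lin_on X (V \<otimes> W) h"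
  unfolding lin_on_def
proof (intro conjI ballI allI h)
  fix x y assume x: "x \<in> carr X" and y: "y \<in> carr X"
  show "h (x + y) = h x + h y"
  proof (rule rapply_separates[OF V W h[OF vec_add[OF X x y]] vec_add[OF vec_tensor h[OF x] h[OF y]]])
    fix \<nu> :: "'w \<Rightarrow> 'k" assume \<nu>: "lin W fld \<nu>"
    show "rapply V W \<nu> (h (x + y)) = rapply V W \<nu> (h x + h y)"
      by (simp only: lin_on_add[OF l[OF \<nu>] x y]
          lin_on_add[OF lin_on_rapply[OF V lin_imp_lin_on[OF \<nu>]] h[OF x] h[OF y]])
  qed
next
  fix c x assume x: "x \<in> carr X"
  show "h (sc X c x) = sc (V \<otimes> W) c (h x)"
  proof (rule rapply_separates[OF V W h[OF vec_scale[OF X x]] vec_scale[OF vec_tensor h[OF x]]])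
    fix \<nu> :: "'w \<Rightarrow> 'k" assume \<nu>: "lin W fld \<nu>"
    show "rapply V W \<nu> (h (sc X c x)) = rapply V W \<nu> (sc (V \<otimes> W) c (h x))"
      by (simp only: lin_on_scale[OF l[OF \<nu>] x]
          lin_on_scale[OF lin_on_rapply[OF V lin_imp_lin_on[OF \<nu>]] h[OF x]])
  qed
qed

section \<open>Topology of spaces of linear maps\<close>

lemma continuous_map_into_discrete_iff:
  "continuous_map T (discrete_topology S) f \<longleftrightarrow> f \<in> topspace T \<rightarrow> S
    \<and> (\<forall>x\<in>topspace T. \<exists>U. openin T U \<and> x \<in> U \<and> (\<forall>y\<in>U. f y = f x))" (is "_ \<longleftrightarrow> ?r")
proof
  assume f: "continuous_map T (discrete_topology S) f"
  then have fS: "f \<in> topspace T \<rightarrow> S" by (auto simp: continuous_map_def)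
  moreover have "\<exists>U. openin T U \<and> x \<in> U \<and> (\<forall>y\<in>U. f y = f x)" if "x \<in> topspace T" for x
  proof (intro exI conjI)
    show "openin T {y \<in> topspace T. f y \<in> {f x}}"
      by (rule openin_continuous_map_preimage[OF f]) (use fS that in auto)
  qed (use that in auto)
  ultimately show ?r by blast
next
  assume r: ?r
  have "openin T {x \<in> topspace T. f x \<in> A}" for A
  proof (subst openin_subopen, intro ballI)
    fix x assume x: "x \<in> {x \<in> topspace T. f x \<in> A}"
    then obtain U where U: "openin T U" "x \<in> U" "\<forall>y\<in>U. f y = f x" using r by blast
    have "f y \<in> A" if "y \<in> U" for y using bspec[OF U(3) that] x by simp
    then show "\<exists>U. openin T U \<and> x \<in> U \<and> U \<subseteq> {x \<in> topspace T. f x \<in> A}"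
      using U(1,2) openin_subset[OF U(1)] by blast
  qed
  then show "continuous_map T (discrete_topology S) f"
    using r by (simp add: continuous_map_def)
qed

text \<open>Around each point the finitely many \<open>g\<^sub>j\<close> are all constant on a common neighbourhood.  The finite
  sums that define \<open>\<psi>\<close>-bar and the transposes below are continuous for this reason.\<close>

lemma continuous_map_discrete_factor:
  assumes J: "finite J" and g: "\<And>j. j \<in> J \<Longrightarrow> continuous_map T (discrete_topology (S j)) (g j)"
    and f: "f \<in> topspace T \<rightarrow> R"
    and dep: "\<And>x y. x \<in> topspace T \<Longrightarrow> y \<in> topspace T \<Longrightarrow> (\<And>j. j \<in> J \<Longrightarrow> g j y = g j x) \<Longrightarrow> f y = f x"
  shows "continuous_map T (discrete_topology R) f"
  unfolding continuous_map_into_discrete_iff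
proof (intro conjI ballI f)
  fix x assume x: "x \<in> topspace T"
  define U where "U = topspace T \<inter> \<Inter> ((\<lambda>j. {y \<in> topspace T. g j y \<in> {g j x}}) ` J)"
  have "openin T {y \<in> topspace T. g j y \<in> {g j x}}" if "j \<in> J" for j
    using openin_continuous_map_preimage[OF g[OF that], of "{g j x}"] g[OF that] x
    by (auto simp: continuous_map_def)
  then have "openin T U"
    unfolding U_def using J by (cases "J = {}") (auto intro!: openin_Int openin_Inter)
  moreover have "x \<in> U" using x by (simp add: U_def)
  moreover have "\<forall>y\<in>U. f y = f x" by (auto simp: U_def intro!: dep x)
  ultimately show "\<exists>U. openin T U \<and> x \<in> U \<and> (\<forall>y\<in>U. f y = f x)" by blast
qed

lemma tp_Homk: "tp (Homk V W) = topology_generated_by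
    {{f \<in> hom_set V W. f ` K \<subseteq> U} | K U. compactin (tp V) K \<and> openin (tp W) U}"
  by (simp add: Homk_def)

lemma compactin_discrete_vec: "discrete_vec V \<Longrightarrow> compactin (tp V) K \<longleftrightarrow> finite K \<and> K \<subseteq> carr V"
  using compactin_discrete_topology[of "carr V" K] discrete_vec_tp[of V] by auto

text \<open>Compact subsets of a discrete space are finite, so on maps out of a discrete space the
  compact-open topology is the topology of pointwise convergence.\<close>

lemma openin_Homk_finite_determined:
  assumes V: "discrete_vec V" and W: "openin (tp (Homk V Z)) W" and \<phi>: "\<phi> \<in> W"
  shows "\<exists>K. finite K \<and> K \<subseteq> carr V
    \<and> (\<forall>\<phi>'\<in>hom_set V Z. (\<forall>v\<in>K. \<phi>' v = \<phi> v) \<longrightarrow> \<phi>' \<in> W)"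
  using openin_topology_generated_by[OF W[unfolded tp_Homk]] \<phi>
proof (induction arbitrary: \<phi>)
  case Empty
  then show ?case by blast
next
  case (Int a b)
  obtain K1 where K1: "finite K1" "K1 \<subseteq> carr V"
    "\<forall>\<phi>'\<in>hom_set V Z. (\<forall>v\<in>K1. \<phi>' v = \<phi> v) \<longrightarrow> \<phi>' \<in> a"
    using Int.IH(1)[of \<phi>] Int.prems by blast
  obtain K2 where K2: "finite K2" "K2 \<subseteq> carr V"
    "\<forall>\<phi>'\<in>hom_set V Z. (\<forall>v\<in>K2. \<phi>' v = \<phi> v) \<longrightarrow> \<phi>' \<in> b"
    using Int.IH(2)[of \<phi>] Int.prems by blast
  from K1 K2 show ?case by (intro exI[of _ "K1 \<union> K2"]) blast
next
  case (UN \<K>)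
  then obtain k where "k \<in> \<K>" "\<phi> \<in> k" by blast
  with UN.IH[of k \<phi>] show ?case by blast
next
  case (Basis s)
  then obtain K U where s: "s = {f \<in> hom_set V Z. f ` K \<subseteq> U}" and K: "compactin (tp V) K" by blast
  have "\<phi> ` K \<subseteq> U" using Basis.prems s by blast
  then show ?case
    using K[unfolded compactin_discrete_vec[OF V]] unfolding s
    by (intro exI[of _ K]) (auto simp: image_subset_iff)
qed

lemma continuous_map_into_Homk:
  assumes V: "discrete_vec V" and F: "F \<in> topspace T \<rightarrow> hom_set V Z"
    and cont: "\<And>v. v \<in> carr V \<Longrightarrow> continuous_map T (tp Z) (\<lambda>x. F x v)"
  shows "continuous_map T (tp (Homk V Z)) F"
  unfolding tp_Homk
proof (rule continuous_on_generated_topo)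
  show "F ` topspace T \<subseteq> \<Union>{{f \<in> hom_set V Z. f ` K \<subseteq> U} | K U. compactin (tp V) K \<and> openin (tp Z) U}"
    using F carr_Homk[of V Z, unfolded tp_Homk topology_generated_by_topspace]
    by (simp only: image_subset_iff_funcset)
next
  fix W assume "W \<in> {{f \<in> hom_set V Z. f ` K \<subseteq> U} | K U. compactin (tp V) K \<and> openin (tp Z) U}"
  then obtain K U where W: "W = {f \<in> hom_set V Z. f ` K \<subseteq> U}" and K: "finite K" "K \<subseteq> carr V"
    and U: "openin (tp Z) U" by (auto simp: compactin_discrete_vec[OF V])
  have "F -` W \<inter> topspace T = topspace T \<inter> \<Inter> ((\<lambda>v. {x \<in> topspace T. F x v \<in> U}) ` K)"
    using F by (auto simp: W)
  moreover have "openin T (topspace T \<inter> \<Inter> ((\<lambda>v. {x \<in> topspace T. F x v \<in> U}) ` K))"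
    using K openin_continuous_map_preimage[OF cont U]
    by (cases "K = {}") (auto intro!: openin_Int openin_Inter)
  ultimately show "openin T (F -` W \<inter> topspace T)" by simp
qed

lemma continuous_map_evaluation:
  assumes v: "v \<in> carr V"
  shows "continuous_map (tp (Homk V Z)) (tp Z) (\<lambda>\<phi>. \<phi> v)"
  unfolding continuous_map_alt
proof (intro conjI allI impI)
  show "(\<lambda>\<phi>. \<phi> v) \<in> carr (Homk V Z) \<rightarrow> carr Z" using v by (auto simp: hom_set_def lin_def)
  fix U assume U: "openin (tp Z) U"
  have "openin (tp (Homk V Z)) {f \<in> hom_set V Z. f ` {v} \<subseteq> U}"
    unfolding tp_Homk by (rule topology_generated_by_Basis) (use v U in \<open>blast intro: finite_imp_compactin\<close>)
  moreover have "{f \<in> hom_set V Z. f ` {v} \<subseteq> U} = (\<lambda>\<phi>. \<phi> v) -` U \<inter> carr (Homk V Z)" by auto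
  ultimately show "openin (tp (Homk V Z)) ((\<lambda>\<phi>. \<phi> v) -` U \<inter> carr (Homk V Z))" by simp
qed

lemma continuous_map_into_discrete_vec: "discrete_vec M \<Longrightarrow> f \<in> hom_set T M \<Longrightarrow>
    continuous_map (tp T) (discrete_topology (carr M)) f"
  by (simp add: hom_set_def flip: discrete_vec_tp)

lemma hom_setI_discrete: "discrete_vec M \<Longrightarrow> lin T M f \<Longrightarrow>
    continuous_map (tp T) (discrete_topology (carr M)) f \<Longrightarrow> f \<in> hom_set T M"
  by (simp add: hom_set_def flip: discrete_vec_tp)

lemma hom_set_lin: "f \<in> hom_set V W \<Longrightarrow> lin V W f"
  by (simp add: hom_set_def)

text \<open>\<open>f\<close> vanishes on a neighbourhood of \<open>0\<close>, and this contains all maps that are zero on some finite set.\<close>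

lemma hom_set_finite_support:
  assumes V: "discrete_vec V" and Z: "vec Z" and M: "discrete_vec M" and f: "f \<in> hom_set (Homk V Z) M"
  obtains K where "finite K" "K \<subseteq> carr V"
    "\<And>\<phi>. \<phi> \<in> hom_set V Z \<Longrightarrow> (\<And>v. v \<in> K \<Longrightarrow> \<phi> v = 0) \<Longrightarrow> f \<phi> = 0"
proof -
  have f0: "f 0 = 0"
    by (rule lin_on_zero[OF vec_Homk_discrete[OF V Z] lin_imp_lin_on[OF hom_set_lin[OF f]]])
  have z: "0 \<in> carr (Homk V Z)" by (rule vec_zero[OF vec_Homk_discrete[OF V Z]])
  obtain U where U: "openin (tp (Homk V Z)) U" "0 \<in> U" "\<forall>\<phi>\<in>U. f \<phi> = f 0"
    using continuous_map_into_discrete_vec[OF M f] z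
    unfolding continuous_map_into_discrete_iff by blast
  obtain K where "finite K" "K \<subseteq> carr V"
    "\<forall>\<phi>\<in>hom_set V Z. (\<forall>v\<in>K. \<phi> v = 0) \<longrightarrow> \<phi> \<in> U"
    using openin_Homk_finite_determined[OF V U(1,2)] by (auto simp only: zero_fun_apply)
  then show thesis using U(3) f0 that by simp
qed

lemma hom_set_comp_discrete:
  assumes M: "discrete_vec M" and M': "vec M'" and f: "f \<in> hom_set N M" and g: "lin M M' g"
  shows "g \<circ> f \<in> hom_set N M'"
proof -
  have "g \<in> hom_set M M'" using g by (simp add: hom_set_discrete[OF M])
  with f lin_comp[OF discrete_vec_imp_vec[OF M] hom_set_lin[OF f] g] show ?thesis
    by (auto simp: hom_set_def intro: continuous_map_compose)
qed

lemma vec_Homk_to_discrete: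
  assumes M: "discrete_vec M"
  shows "vec (Homk N M)"
proof -
  note M' = discrete_vec_imp_vec[OF M]
  interpret F: vector_space "\<lambda>c f x. sc M c (f x)"
    by (rule vector_space_pointwise[OF vec_vector_space[OF M']])
  have "0 \<in> hom_set N M"
    by (rule hom_setI_discrete[OF M lin_const_zero[OF M']],
        rule continuous_map_discrete_factor[where J = "{}"]) (auto simp: vec_zero[OF M'])
  moreover have "f + g \<in> hom_set N M" if f: "f \<in> hom_set N M" and g: "g \<in> hom_set N M" for f g
  proof (rule hom_setI_discrete[OF M])
    show l: "lin N M (f + g)" by (rule lin_plus[OF M' hom_set_lin[OF f] hom_set_lin[OF g]])
    show "continuous_map (tp N) (discrete_topology (carr M)) (f + g)"
    proof (rule continuous_map_discrete_factor[where J = "{f, g}" and g = "\<lambda>j. j"])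
      show "f + g \<in> carr N \<rightarrow> carr M" using l by (auto simp: lin_def)
      show "(f + g) y = (f + g) x" if "\<And>j. j \<in> {f, g} \<Longrightarrow> j y = j x" for x y
        using that[of f] that[of g] by simp
    qed (use continuous_map_into_discrete_vec[OF M] f g in auto)
  qed
  moreover have "(\<lambda>x. sc M c (f x)) \<in> hom_set N M" if f: "f \<in> hom_set N M" for c f
  proof (rule hom_setI_discrete[OF M])
    show l: "lin N M (\<lambda>x. sc M c (f x))" by (rule lin_cmult[OF M' hom_set_lin[OF f]])
    show "continuous_map (tp N) (discrete_topology (carr M)) (\<lambda>x. sc M c (f x))"
    proof (rule continuous_map_discrete_factor[where J = "{f}" and g = "\<lambda>j. j"])
      show "(\<lambda>x. sc M c (f x)) \<in> carr N \<rightarrow> carr M" using l by (auto simp: lin_def)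
    qed (use continuous_map_into_discrete_vec[OF M] f in auto)
  qed
  ultimately show ?thesis
    unfolding vec_def carr_Homk sc_Homk by (simp add: F.subspaceI F.vector_space_axioms)
qed

section \<open>Homomorphisms into a comodule as equations on slices\<close>

text \<open>The data through which homomorphisms to comodules see \<open>N\<close>.  It is shared by contramodules and by the
  duals \<open>X\<^sup>*\<close> of left comodules, so that the same criterion applies to both.\<close>

definition contra_space :: "('k::field, 'e::ab_group_add, 'x) tvs_scheme
    \<Rightarrow> ('k, 'e, 'n::ab_group_add, 'y) contramod_scheme \<Rightarrow> bool" where
  "contra_space E N \<longleftrightarrow> vec N \<and> (\<forall>c. continuous_map (tp N) (tp N) (sc N c))
     \<and> contra N \<in> hom_set (Homk E N) N"

lemma lin_scalar_multiples:
  assumes "vec N" "lin E fld \<xi>" "n \<in> carr N"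
  shows "lin E N (\<lambda>e. sc N (\<xi> e) n)"
  using assms lin_on_sc_left[OF assms(1) lin_imp_lin_on[OF assms(2)] assms(3)]
  by (simp add: lin_iff sc_zero_left)

text \<open>Existence uses that \<open>f\<close> vanishes on the maps \<open>E \<rightarrow> N\<close> that are zero on some finite set \<open>K\<close>:
  if \<open>e\<^sub>b\<close> is a dual family for \<open>K\<close>, the map \<open>n \<mapsto> \<Sum>\<^sub>b f(e\<^sub>b n) \<otimes> b\<close> has the required slices.\<close>

lemma psi_bar:
  fixes N :: "('k::field, 'n::ab_group_add, 'y) tvs_scheme"
  assumes E: "discrete_vec E" and N: "vec N" and cN: "\<And>c. continuous_map (tp N) (tp N) (sc N c)"
    and M: "discrete_vec M" and f: "f \<in> hom_set (Homk E N) M"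
  shows psi_bar_hom: "psi_bar E N M f \<in> hom_set N (M \<otimes> E)"
    and psi_bar_slice: "\<And>n \<xi>. n \<in> carr N \<Longrightarrow> lin E fld \<xi> \<Longrightarrow>
      rapply M E \<xi> (psi_bar E N M f n) = f (\<lambda>e. sc N (\<xi> e) n)"
    and psi_bar_unique: "\<And>g. g \<in> hom_set N (M \<otimes> E) \<Longrightarrow>
      (\<And>n \<xi>. n \<in> carr N \<Longrightarrow> lin E fld \<xi> \<Longrightarrow> rapply M E \<xi> (g n) = f (\<lambda>e. sc N (\<xi> e) n))
      \<Longrightarrow> psi_bar E N M f = g"
proof -
  note E' = discrete_vec_imp_vec[OF E] and M' = discrete_vec_imp_vec[OF M]
  note fl = lin_imp_lin_on[OF hom_set_lin[OF f]]
  have vH: "vec (Homk E N)" by (rule vec_Homk_discrete[OF E N])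
  let ?a = "\<lambda>\<xi> n e. sc N (\<xi> e) n"
  have aH: "?a \<xi> n \<in> carr (Homk E N)" if "lin E fld \<xi>" "n \<in> carr N" for \<xi> n
    using lin_scalar_multiples[OF N that] by (simp add: hom_set_discrete[OF E])
  define P where "P g \<longleftrightarrow> g \<in> hom_set N (M \<otimes> E)
    \<and> (\<forall>n\<in>carr N. \<forall>\<xi>. lin E fld \<xi> \<longrightarrow> rapply M E \<xi> (g n) = f (?a \<xi> n))" for g
  have uniq: "g = g'" if "P g" "P g'" for g g'
  proof (rule lin_cancel_outside[of N "M \<otimes> E"])
    show "lin N (M \<otimes> E) g" "lin N (M \<otimes> E) g'" using that by (auto simp: P_def hom_set_lin)
    then show "g n = g' n" if "n \<in> carr N" for n
      using \<open>P g\<close> \<open>P g'\<close> that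
      by (intro rapply_separates[OF M' E']) (auto simp: P_def dest: lin_on_carr[OF lin_imp_lin_on])
  qed
  obtain K where K: "finite K" "K \<subseteq> carr E"
    "\<And>\<phi>. \<phi> \<in> hom_set E N \<Longrightarrow> (\<And>v. v \<in> K \<Longrightarrow> \<phi> v = 0) \<Longrightarrow> f \<phi> = 0"
    using hom_set_finite_support[OF E N M f] by blast
  obtain B e where B: "dual_family E K B e" using dual_family_exists[OF E' K(1,2)] by blast
  note BD = dual_familyD[OF B]
  define g where "g n = (if n \<in> carr N then \<Sum>b\<in>B. pure M E (f (?a (e b) n)) b else 0)" for n
  have fa: "f (?a (e b) n) \<in> carr M" if "b \<in> B" "n \<in> carr N" for b n
    by (rule lin_on_carr[OF fl aH[OF BD(3)[OF that(1)] that(2)]])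
  have slice: "rapply M E \<xi> (g n) = f (?a \<xi> n)" if n: "n \<in> carr N" and \<xi>: "lin E fld \<xi>" for n \<xi>
  proof -
    have "lin_on (dual E) (Homk E N) (\<lambda>\<xi>. ?a \<xi> n)"
      unfolding lin_on_def
      using aH n
      by (auto simp: hom_set_discrete[OF E] sc_Homk fun_eq_iff sc_add_left[OF N] sc_sc[OF N])
    then have "lin_on (dual E) M (\<lambda>\<xi>. f (?a \<xi> n))" by (rule lin_on_comp[OF _ fl])
    from dual_expansion[OF E M' this _ B \<xi>]
    have "f (?a \<xi> n) = (\<Sum>b\<in>B. sc M (\<xi> b) (f (?a (e b) n)))"
      using K(3) aH[OF _ n] by (simp add: sc_zero_left[OF N])
    also have "\<dots> = rapply M E \<xi> (g n)"
      using n rapply_sum_pure[OF M' lin_imp_lin_on[OF \<xi>] fa[OF _ n] BD(2)]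
      by (simp add: g_def)
    finally show ?thesis by simp
  qed
  have g_carr: "g n \<in> carr (M \<otimes> E)" if "n \<in> carr N" for n
    using that fa BD(2) by (auto simp: g_def intro!: vec_sum[OF vec_tensor] pure_carr)
  have "P g"
    unfolding P_def
  proof (intro conjI ballI allI impI hom_setI_discrete[OF discrete_vec_tensor])
    have "lin_on N (M \<otimes> E) g"
    proof (rule lin_on_from_rapply[OF N M' E' g_carr])
      fix \<xi> assume \<xi>: "lin E fld \<xi>"
      have "lin_on N (Homk E N) (?a \<xi>)"
        unfolding lin_on_def using aH[OF \<xi>]
        by (simp add: fun_eq_iff sc_Homk sc_add_right[OF N] sc_sc[OF N] mult.commute)
      from lin_on_comp[OF this fl] show "lin_on N M (\<lambda>n. rapply M E \<xi> (g n))"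
        unfolding lin_on_def using vec_add[OF N] vec_scale[OF N] by (simp add: slice[OF _ \<xi>])
    qed
    then show "lin N (M \<otimes> E) g" by (simp add: lin_iff g_def)
    show "continuous_map (tp N) (discrete_topology (carr (M \<otimes> E))) g"
    proof (rule continuous_map_discrete_factor[OF BD(1), where g = "\<lambda>b n. f (?a (e b) n)"])
      fix b assume b: "b \<in> B"
      have "continuous_map (tp N) (tp (Homk E N)) (?a (e b))"
        by (rule continuous_map_into_Homk[OF E]) (use aH[OF BD(3)[OF b]] cN in auto)
      from continuous_map_compose[OF this continuous_map_into_discrete_vec[OF M f]]
      show "continuous_map (tp N) (discrete_topology (carr M)) (\<lambda>n. f (?a (e b) n))"
        by (simp add: comp_def)
    next
      fix x y assume "x \<in> carr N" "y \<in> carr N" "\<And>b. b \<in> B \<Longrightarrow> f (?a (e b) y) = f (?a (e b) x)"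
      then show "g y = g x" by (simp add: g_def cong: sum.cong)
    qed (use g_carr in auto)
  qed (use slice in auto)
  then have "P (psi_bar E N M f)"
    using theI[of P, OF _ uniq]
    unfolding psi_bar_def P_def carr_Homk hom_set_discrete[OF E] by simp
  then show "psi_bar E N M f \<in> hom_set N (M \<otimes> E)"
    and "\<And>n \<xi>. n \<in> carr N \<Longrightarrow> lin E fld \<xi> \<Longrightarrow>
      rapply M E \<xi> (psi_bar E N M f n) = f (\<lambda>e. sc N (\<xi> e) n)"
    and "\<And>g. g \<in> hom_set N (M \<otimes> E) \<Longrightarrow>
      (\<And>n \<xi>. n \<in> carr N \<Longrightarrow> lin E fld \<xi> \<Longrightarrow> rapply M E \<xi> (g n) = f (\<lambda>e. sc N (\<xi> e) n))
      \<Longrightarrow> psi_bar E N M f = g"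
    using uniq by (auto simp: P_def)
qed

lemma carr_HomCC: "carr (HomCC E N M)
    = {\<gamma> \<in> hom_set N M. psi_bar E N M (\<gamma> \<circ> contra N) = rcoact M \<circ> \<gamma>}"
  by (simp add: HomCC_def)

lemma sc_HomCC: "sc (HomCC E N M) = (\<lambda>c \<gamma> n. sc M c (\<gamma> n))"
  by (simp add: HomCC_def)

text \<open>Slices by functionals on \<open>E\<close> separate the elements of \<open>M \<otimes> E\<close>, and they are known for \<open>\<psi>\<close>-bar.\<close>

lemma HomCC_iff:
  assumes E: "discrete_vec E" and N: "contra_space E N" and M: "discrete_vec M"
    and \<mu>: "lin M (M \<otimes> E) (rcoact M)"
  shows "\<gamma> \<in> carr (HomCC E N M) \<longleftrightarrow> \<gamma> \<in> hom_set N M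
    \<and> (\<forall>n\<in>carr N. \<forall>\<xi>. lin E fld \<xi> \<longrightarrow>
        rapply M E \<xi> (rcoact M (\<gamma> n)) = \<gamma> (contra N (\<lambda>e. sc N (\<xi> e) n)))"
proof (cases "\<gamma> \<in> hom_set N M")
  case \<gamma>: True
  note Nd = N[unfolded contra_space_def]
  have f: "\<gamma> \<circ> contra N \<in> hom_set (Homk E N) M"
    using Nd \<gamma> lin_comp[of N "Homk E N" "contra N" M \<gamma>]
    by (auto simp: hom_set_def intro: continuous_map_compose)
  have vN: "vec N" and cN: "\<And>c. continuous_map (tp N) (tp N) (sc N c)" using Nd by blast+
  note pb = psi_bar[OF E vN cN M f]
  have g: "rcoact M \<circ> \<gamma> \<in> hom_set N (M \<otimes> E)"
    by (rule hom_set_comp_discrete[OF M vec_tensor \<gamma> \<mu>])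
  have "psi_bar E N M (\<gamma> \<circ> contra N) = rcoact M \<circ> \<gamma> \<longleftrightarrow>
    (\<forall>n\<in>carr N. \<forall>\<xi>. lin E fld \<xi> \<longrightarrow>
        rapply M E \<xi> ((rcoact M \<circ> \<gamma>) n) = (\<gamma> \<circ> contra N) (\<lambda>e. sc N (\<xi> e) n))" (is "?l \<longleftrightarrow> ?r")
  proof
    show ?r if e: ?l using pb(2) unfolding e by blast
    show ?l if ?r using that by (intro pb(3)[OF g]) blast
  qed
  then show ?thesis using \<gamma> unfolding carr_HomCC by simp
qed (auto simp: carr_HomCC)

lemma discrete_vec_HomCC:
  assumes E: "discrete_vec E" and N: "contra_space E N" and M: "discrete_vec M"
    and \<mu>: "lin M (M \<otimes> E) (rcoact M)"
  shows "discrete_vec (HomCC E N M)"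
proof -
  note M' = discrete_vec_imp_vec[OF M] and \<mu>' = lin_imp_lin_on[OF \<mu>]
  note vH = vec_Homk_to_discrete[OF M, of N]
  interpret F: vector_space "\<lambda>c f x. sc M c (f x)"
    by (rule vector_space_pointwise[OF vec_vector_space[OF M']])
  note iff = HomCC_iff[OF E N M \<mu>]
  have \<mu>0: "rcoact M 0 = 0" by (rule lin_on_zero[OF M' \<mu>'])
  have r: "lin_on (M \<otimes> E) M (rapply M E \<xi>)" if "lin E fld \<xi>" for \<xi>
    by (rule lin_on_rapply[OF M' lin_imp_lin_on[OF that]])
  have c: "\<gamma> n \<in> carr M" if "\<gamma> \<in> hom_set N M" "n \<in> carr N" for \<gamma> n
    by (rule lin_on_carr[OF lin_imp_lin_on[OF hom_set_lin[OF that(1)]] that(2)])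
  have "0 \<in> carr (HomCC E N M)"
    unfolding iff using vec_zero[OF vH]
    by (auto simp: \<mu>0 lin_on_zero[OF vec_tensor r])
  moreover have "x + y \<in> carr (HomCC E N M)"
    if "x \<in> carr (HomCC E N M)" "y \<in> carr (HomCC E N M)" for x y
    using that vec_add[OF vH, of x y] unfolding iff
    by (auto simp: c lin_on_add[OF \<mu>'] lin_on_add[OF r] lin_on_carr[OF \<mu>'])
  moreover have "(\<lambda>n. sc M a (x n)) \<in> carr (HomCC E N M)"
    if "x \<in> carr (HomCC E N M)" for a x
    using that vec_scale[OF vH, of x a] unfolding iff
    by (auto simp: c lin_on_scale[OF \<mu>'] lin_on_scale[OF r] lin_on_carr[OF \<mu>'] sc_Homk)
  ultimately have "vec (HomCC E N M)"
    unfolding vec_def sc_HomCC by (intro conjI F.vector_space_axioms F.subspaceI)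
  then show ?thesis by (simp add: discrete_vec_def) (simp add: HomCC_def)
qed

section \<open>Maps out of a pseudocompact space have finite rank\<close>

text \<open>Induction on \<open>J\<close>: the kernel \<open>A\<^sub>0\<close> of \<open>p\<^sub>j\<close> on \<open>A\<close> is treated by induction, and \<open>A\<close> is spanned by \<open>A\<^sub>0\<close>
  together with preimages of a finite basis of \<open>p\<^sub>j(A)\<close>.\<close>

lemma finite_rank_of_kernel:
  fixes N :: "('k::field, 'n::ab_group_add, 'x) tvs_scheme"
    and M :: "('k, 'm::ab_group_add, 'y) tvs_scheme"
    and V :: "'j \<Rightarrow> ('k, 'v::ab_group_add) tvs"
  assumes J: "finite J" and N: "vec N" and M: "vec M" and g: "lin_on N M g"
    and V: "\<And>j. j \<in> J \<Longrightarrow> vec (V j)" "\<And>j. j \<in> J \<Longrightarrow> fin_dim (V j)"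
    and p: "\<And>j. j \<in> J \<Longrightarrow> lin_on N (V j) (p j)"
    and A: "module.subspace (sc N) A" "A \<subseteq> carr N"
    and ker: "\<And>n. n \<in> A \<Longrightarrow> (\<And>j. j \<in> J \<Longrightarrow> p j n = 0) \<Longrightarrow> g n = 0"
  shows "\<exists>S. finite S \<and> S \<subseteq> carr M \<and> g ` A \<subseteq> module.span (sc M) S"
  using J V p A ker
proof (induction J arbitrary: A)
  interpret M: vector_space "sc M" by (rule vec_vector_space[OF M])
  case empty
  then have "g ` A \<subseteq> M.span {}" by auto
  then show ?case by (intro exI[of _ "{}"]) simp
next
  interpret N: vector_space "sc N" by (rule vec_vector_space[OF N])
  interpret M: vector_space "sc M" by (rule vec_vector_space[OF M])
  case (insert j J)
  have Vj: "vec (V j)" "fin_dim (V j)" and pj: "lin_on N (V j) (p j)" using insert.prems by simp_all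
  interpret W: vector_space "sc (V j)" by (rule vec_vector_space[OF Vj(1)])
  note A = insert.prems(4,5)
  have AN: "x \<in> carr N" if "x \<in> A" for x using A(2) that by blast
  define A0 where "A0 = {n \<in> A. p j n = 0}"
  have A0: "N.subspace A0" "A0 \<subseteq> carr N"
  proof (rule N.subspaceI)
    show "0 \<in> A0" using N.subspace_0[OF A(1)] lin_on_zero[OF N pj] by (simp add: A0_def)
    show "x + y \<in> A0" if "x \<in> A0" "y \<in> A0" for x y
      using that N.subspace_add[OF A(1)] lin_on_add[OF pj AN AN] by (simp add: A0_def)
    show "sc N c x \<in> A0" if "x \<in> A0" for c x
      using that N.subspace_scale[OF A(1)] lin_on_scale[OF pj AN] by (simp add: A0_def)
    show "A0 \<subseteq> carr N" using A(2) by (auto simp: A0_def)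
  qed
  have "\<exists>S. finite S \<and> S \<subseteq> carr M \<and> g ` A0 \<subseteq> M.span S"
  proof (rule insert.IH[OF _ _ _ A0])
    show "g n = 0" if "n \<in> A0" "\<And>i. i \<in> J \<Longrightarrow> p i n = 0" for n
      using that by (intro insert.prems(6)) (auto simp: A0_def)
  qed (use insert.prems in auto)
  then obtain S0 where S0: "finite S0" "S0 \<subseteq> carr M" "g ` A0 \<subseteq> M.span S0" by blast
  obtain B where B: "finite B" "carr (V j) \<subseteq> W.span B" using Vj(2) by (auto simp: fin_dim_def)
  obtain T where T: "T \<subseteq> p j ` A" "W.independent T" "p j ` A \<subseteq> W.span T"
    using W.maximal_independent_subset by blast
  have "T \<subseteq> W.span B" using T(1) B(2) lin_on_carr[OF pj AN] by blast
  then have fT: "finite T" using W.independent_span_bound[OF B(1) T(2)] by blast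
  have "\<forall>t\<in>T. \<exists>a\<in>A. p j a = t" using T(1) by blast
  then obtain r where r: "\<And>t. t \<in> T \<Longrightarrow> r t \<in> A" "\<And>t. t \<in> T \<Longrightarrow> p j (r t) = t" by metis
  let ?S = "S0 \<union> g ` r ` T"
  have "g n \<in> M.span ?S" if n: "n \<in> A" for n
  proof -
    have "p j n \<in> W.span T" using T(3) n by blast
    then obtain c where c: "p j n = (\<Sum>t\<in>T. sc (V j) (c t) t)"
      unfolding W.span_finite[OF fT] by blast
    \<comment> \<open>a correction with the same image under \<open>p\<^sub>j\<close>, so that \<open>n - s\<close> lies in \<open>A\<^sub>0\<close>\<close>
    define s where "s = (\<Sum>t\<in>T. sc N (c t) (r t))"
    have tA: "sc N (c t) (r t) \<in> A" if "t \<in> T" for t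
      using N.subspace_scale[OF A(1) r(1)[OF that]] .
    have sA: "s \<in> A" unfolding s_def by (rule N.subspace_sum[OF A(1) tA])
    have "p j s = (\<Sum>t\<in>T. p j (sc N (c t) (r t)))"
      unfolding s_def by (rule lin_on_sum[OF N pj AN[OF tA]])
    also have "\<dots> = p j n"
      unfolding c by (intro sum.cong refl) (simp add: lin_on_scale[OF pj AN[OF r(1)]] r(2))
    finally have "p j (n - s) = 0" using lin_on_diff[OF N pj AN[OF n] AN[OF sA]] by simp
    then have d: "n - s \<in> A0" using N.subspace_diff[OF A(1) n sA] by (simp add: A0_def)
    have "g s = (\<Sum>t\<in>T. g (sc N (c t) (r t)))"
      unfolding s_def by (rule lin_on_sum[OF N g AN[OF tA]])
    also have "\<dots> = (\<Sum>t\<in>T. sc M (c t) (g (r t)))"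
      by (intro sum.cong refl) (simp add: lin_on_scale[OF g AN[OF r(1)]])
    also have "\<dots> \<in> M.span ?S" by (intro M.span_sum M.span_scale M.span_base) blast
    finally have "g s \<in> M.span ?S" .
    moreover have "g (n - s) \<in> M.span ?S" using S0(3) d M.span_mono[of S0 ?S] by blast
    ultimately have "g (n - s) + g s \<in> M.span ?S" by (rule M.span_add[rotated])
    then show ?thesis using lin_on_diff[OF N g AN[OF n] AN[OF sA]] by simp
  qed
  moreover have "?S \<subseteq> carr M" using S0(2) lin_on_carr[OF g AN[OF r(1)]] by blast
  ultimately show ?case using S0(1) fT by (intro exI[of _ ?S]) blast
qed

text \<open>The kernel of a map to a discrete space is open, so it contains the kernel of the projection to
  finitely many finite dimensional spaces of the inverse system.\<close>

lemma pseudocompact_finite_rank: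
  fixes N :: "('k::field, 'n::ab_group_add, 'x) tvs_scheme"
  assumes N: "pseudocompact N" and M: "discrete_vec M" and \<gamma>: "\<gamma> \<in> hom_set N M"
  shows "\<exists>S. finite S \<and> S \<subseteq> carr M \<and> \<gamma> ` carr N \<subseteq> module.span (sc M) S"
proof -
  have vN: "vec N" using N by (simp add: pseudocompact_def top_vec_def)
  note vM = discrete_vec_imp_vec[OF M]
  obtain I r and V :: "'n set \<Rightarrow> ('k, nat \<Rightarrow> 'k) tvs" and \<phi> p where
    V: "\<forall>i\<in>I. discrete_vec (V i) \<and> fin_dim (V i)" and lim: "is_inverse_limit I r V \<phi> N p"
    using N unfolding pseudocompact_def by blast
  define h where "h = (\<lambda>z. \<lambda>i\<in>I. p i z)"
  define T where "T = {s. \<forall>i j. (i, j) \<in> r \<longrightarrow> \<phi> i j (s j) = s i}"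
  have p: "lin_on N (V i) (p i)" if "i \<in> I" for i
    using lim that by (simp add: is_inverse_limit_def lin_imp_lin_on)
  have homeo: "homeomorphic_map (tp N) (subtopology (product_topology (\<lambda>i. tp (V i)) I) T) h"
    using lim by (simp add: is_inverse_limit_def h_def T_def)
  obtain U where U: "openin (tp N) U" "0 \<in> U" "\<forall>n\<in>U. \<gamma> n = \<gamma> 0"
    using continuous_map_into_discrete_vec[OF M \<gamma>] vec_zero[OF vN]
    unfolding continuous_map_into_discrete_iff by blast
  have "openin (subtopology (product_topology (\<lambda>i. tp (V i)) I) T) (h ` U)"
    using homeomorphic_imp_open_map[OF homeo] U(1) by (simp add: open_map_def)
  then obtain W where W: "openin (product_topology (\<lambda>i. tp (V i)) I) W" "h ` U = W \<inter> T"
    unfolding openin_subtopology by blast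
  have "h 0 \<in> W" using U(2) W(2) by blast
  then obtain X where X: "finite {i \<in> I. X i \<noteq> carr (V i)}" "h 0 \<in> Pi\<^sub>E I X" "Pi\<^sub>E I X \<subseteq> W"
    using bspec[OF W(1)[unfolded openin_product_topology_alt] \<open>h 0 \<in> W\<close>] by (elim exE conjE)
  \<comment> \<open>outside \<open>J\<close> the basic neighbourhood imposes no condition\<close>
  define J where "J = {i \<in> I. X i \<noteq> carr (V i)}"
  have ker: "\<gamma> n = 0" if n: "n \<in> carr N" and pn: "\<And>i. i \<in> J \<Longrightarrow> p i n = 0" for n
  proof -
    have "p i n \<in> X i" if i: "i \<in> I" for i
    proof (cases "i \<in> J")
      case True
      then have "p i n = p i 0" using pn lin_on_zero[OF vN p[OF i]] by simp
      then show ?thesis using X(2) i by (auto simp: h_def PiE_iff)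
    next
      case False
      then show ?thesis using i lin_on_carr[OF p[OF i] n] by (simp add: J_def)
    qed
    then have "h n \<in> W" using X(3) by (auto simp: h_def)
    moreover have "h n \<in> T"
      using homeomorphic_imp_surjective_map[OF homeo] n by auto
    ultimately have "h n \<in> h ` U" using W(2) by blast
    then have "n \<in> U"
      using homeomorphic_imp_injective_map[OF homeo] n openin_subset[OF U(1)]
      by (auto simp: inj_on_def)
    then show ?thesis
      using U(3) lin_on_zero[OF vN lin_imp_lin_on[OF hom_set_lin[OF \<gamma>]]] by simp
  qed
  show ?thesis
    by (rule finite_rank_of_kernel[where J = J and p = p and V = V])
      (use X(1) V p ker vN vM vec_subspace[OF vN] lin_imp_lin_on[OF hom_set_lin[OF \<gamma>]] in
        \<open>auto simp: J_def dest: discrete_vec_imp_vec\<close>)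
qed

text \<open>The image of \<open>\<gamma>\<close> lies in the span of finitely many tensors, each involving finitely many elements of \<open>U\<close>.\<close>

lemma pseudocompact_lapply_support:
  fixes N :: "('k::field, 'n::ab_group_add, 'x) tvs_scheme"
    and U :: "('k, 'u::ab_group_add, 'y) tvs_scheme" and W :: "('k, 'w::ab_group_add, 'z) tvs_scheme"
  assumes N: "pseudocompact N" and U: "vec U" and W: "vec W" and \<gamma>: "\<gamma> \<in> hom_set N (U \<otimes> W)"
  obtains K where "finite K" "K \<subseteq> carr U"
    "\<And>\<nu> n. lin U fld \<nu> \<Longrightarrow> (\<And>u. u \<in> K \<Longrightarrow> \<nu> u = 0) \<Longrightarrow> n \<in> carr N \<Longrightarrow> lapply U W \<nu> (\<gamma> n) = 0"
proof -
  interpret T: vector_space "sc (U \<otimes> W)" by (rule vec_vector_space[OF vec_tensor])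
  obtain S where S: "finite S" "S \<subseteq> carr (U \<otimes> W)" "\<gamma> ` carr N \<subseteq> T.span S"
    using pseudocompact_finite_rank[OF N discrete_vec_tensor \<gamma>] by blast
  have "\<exists>K. finite K \<and> K \<subseteq> carr U \<and>
    (\<forall>\<nu>. lin U fld \<nu> \<longrightarrow> (\<forall>u\<in>K. \<nu> u = 0) \<longrightarrow> lapply U W \<nu> s = 0)" if "s \<in> S" for s
  proof -
    have "s \<in> carr (U \<otimes> W)" using S(2) that by blast
    then show ?thesis
    proof (rule lapply_support[OF U W])
      fix K assume K: "finite K" "K \<subseteq> carr U"
        "\<And>\<nu>. lin U fld \<nu> \<Longrightarrow> (\<And>u. u \<in> K \<Longrightarrow> \<nu> u = 0) \<Longrightarrow> lapply U W \<nu> s = 0"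
      show ?thesis by (intro exI[of _ K] conjI K(1,2) allI impI K(3)) blast+
    qed
  qed
  then obtain k where k: "\<And>s. s \<in> S \<Longrightarrow> finite (k s)" "\<And>s. s \<in> S \<Longrightarrow> k s \<subseteq> carr U"
    "\<And>s \<nu>. s \<in> S \<Longrightarrow> lin U fld \<nu> \<Longrightarrow> \<forall>u\<in>k s. \<nu> u = 0 \<Longrightarrow> lapply U W \<nu> s = 0"
    by metis
  show thesis
  proof (rule that[of "\<Union>(k ` S)"])
    show "finite (\<Union>(k ` S))" "\<Union>(k ` S) \<subseteq> carr U" using S(1) k(1,2) by auto
    fix \<nu> n assume \<nu>: "lin U fld \<nu>" "\<And>u. u \<in> \<Union>(k ` S) \<Longrightarrow> \<nu> u = 0" and n: "n \<in> carr N"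
    note l = lin_on_lapply[OF W lin_imp_lin_on[OF \<nu>(1)]]
    have s0: "lapply U W \<nu> s = 0" if "s \<in> S" for s using k(3)[OF that \<nu>(1)] \<nu>(2) that by blast
    obtain c where c: "\<gamma> n = (\<Sum>s\<in>S. sc (U \<otimes> W) (c s) s)"
      using S(3) n unfolding T.span_finite[OF S(1)] by blast
    have "lapply U W \<nu> (\<gamma> n) = (\<Sum>s\<in>S. lapply U W \<nu> (sc (U \<otimes> W) (c s) s))"
      unfolding c by (rule lin_on_sum[OF vec_tensor l]) (use S(2) vec_scale[OF vec_tensor] in blast)
    also have "\<dots> = 0"
      by (rule sum.neutral) (use S(2) in \<open>auto simp: lin_on_scale[OF l] s0 sc_zero_right[OF W]\<close>)
    finally show "lapply U W \<nu> (\<gamma> n) = 0" .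
  qed
qed

lemma contramodule_contra_space:
  assumes "contramodule E N"
  shows "contra_space E N"
proof -
  have N: "top_vec N" and c: "contra N \<in> hom_set (Homk E N) N"
    using assms by (simp_all add: contramodule_def pseudocompact_def)
  have "continuous_map (tp N) (tp N) (sc N c)" for c
  proof -
    have "continuous_map (tp N) (prod_topology (discrete_topology UNIV) (tp N)) (\<lambda>x. (c, x))"
      by (simp add: continuous_map_pairedI)
    moreover have "continuous_map (prod_topology (discrete_topology UNIV) (tp N)) (tp N) (\<lambda>(c, x). sc N c x)"
      using N by (simp add: top_vec_def)
    ultimately have "continuous_map (tp N) (tp N) ((\<lambda>(c, x). sc N c x) \<circ> (\<lambda>x. (c, x)))"
      by (rule continuous_map_compose)
    then show ?thesis by (simp add: comp_def)
  qed
  then show ?thesis using N c by (simp add: contra_space_def top_vec_def)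
qed

section \<open>Coactions through the actions of functionals\<close>

text \<open>The action of \<open>C\<^sup>*\<close> on a left \<open>C\<close>-comodule, and below that of \<open>D\<^sup>*\<close> on a right \<open>D\<close>-comodule.\<close>

definition lact :: "('k::field, 'c::ab_group_add, 'x) tvs_scheme
    \<Rightarrow> ('k, 'c, 'd, 'm::ab_group_add, 'z) bicomod_scheme \<Rightarrow> ('c \<Rightarrow> 'k) \<Rightarrow> 'm \<Rightarrow> 'm" where
  "lact C M f m = lapply C M f (lcoact M m)"

definition ract :: "('k::field, 'd::ab_group_add, 'x) tvs_scheme
    \<Rightarrow> ('k, 'd, 'm::ab_group_add, 'z) rcomod_scheme \<Rightarrow> ('d \<Rightarrow> 'k) \<Rightarrow> 'm \<Rightarrow> 'm" where
  "ract D M \<xi> m = rapply M D \<xi> (rcoact M m)"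

lemma right_comoduleD:
  assumes "right_comodule D M"
  shows "discrete_vec M" "vec M" "lin M (M \<otimes> D) (rcoact M)" "lin_on M (M \<otimes> D) (rcoact M)"
  using assms unfolding right_comodule_def by (auto dest: discrete_vec_imp_vec lin_imp_lin_on)

lemma bicomoduleD:
  assumes "bicomodule C D M"
  shows "right_comodule D M" "discrete_vec M" "vec M" "lin M (C \<otimes> M) (lcoact M)"
    "lin_on M (C \<otimes> M) (lcoact M)"
  using assms unfolding bicomodule_def left_comodule_def by (auto dest: discrete_vec_imp_vec lin_imp_lin_on)

lemma lin_ract:
  assumes "right_comodule D M" "lin D fld \<xi>"
  shows "lin M M (ract D M \<xi>)"
  using lin_comp[OF vec_tensor right_comoduleD(3)[OF assms(1)]
      lin_rapply[OF right_comoduleD(2)[OF assms(1)] lin_imp_lin_on[OF assms(2)]]]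
  by (simp add: comp_def ract_def[abs_def])

lemma lin_lact:
  assumes "bicomodule C D M" "lin C fld f"
  shows "lin M M (lact C M f)"
  using lin_comp[OF vec_tensor bicomoduleD(4)[OF assms(1)]
      lin_lapply[OF bicomoduleD(3)[OF assms(1)] lin_imp_lin_on[OF assms(2)]]]
  by (simp add: comp_def lact_def[abs_def])

text \<open>The bicomodule axiom, sliced by \<open>f \<otimes> id \<otimes> \<xi>\<close>.\<close>

lemma ract_lact_commute:
  assumes M: "bicomodule C D M" and C: "vec C" and D: "vec D"
    and f: "lin C fld f" and \<xi>: "lin D fld \<xi>" and m: "m \<in> carr M"
  shows "ract D M \<xi> (lact C M f m) = lact C M f (ract D M \<xi> m)"
proof -
  note M' = bicomoduleD[OF M] and R = right_comoduleD[OF bicomoduleD(1)[OF M]]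
  note f' = lin_imp_lin_on[OF f] and \<xi>' = lin_imp_lin_on[OF \<xi>]
  note rm = lin_on_carr[OF R(4) m] and lm = lin_on_carr[OF M'(5) m]
  have "rapply M D \<xi> (lapply C (M \<otimes> D) f
        (assoc C M D (tmap M D (C \<otimes> M) D (lcoact M) (\<lambda>x. x) (rcoact M m))))
      = lapply C M f (rapply (C \<otimes> M) D \<xi> (tmap M D (C \<otimes> M) D (lcoact M) (\<lambda>x. x) (rcoact M m)))"
    by (rule rapply_lapply_assoc[OF C R(2) D f' \<xi>' lin_on_carr[OF lin_on_tmap[OF M'(5) lin_on_id] rm]])
  also have "\<dots> = lact C M f (ract D M \<xi> m)"
    by (simp add: rapply_tmap[OF R(2) vec_tensor M'(5) lin_on_id \<xi>' rm] lact_def ract_def)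
  finally have 1: "rapply M D \<xi> (lapply C (M \<otimes> D) f
        (assoc C M D (tmap M D (C \<otimes> M) D (lcoact M) (\<lambda>x. x) (rcoact M m))))
      = lact C M f (ract D M \<xi> m)" .
  have "rapply M D \<xi> (lapply C (M \<otimes> D) f (tmap C M C (M \<otimes> D) (\<lambda>x. x) (rcoact M) (lcoact M m)))
      = ract D M \<xi> (lact C M f m)"
    by (simp add: lapply_tmap[OF C vec_tensor lin_on_id R(4) f' lm R(2)] lact_def ract_def)
  then show ?thesis using 1 M m unfolding bicomodule_def by metis
qed

section \<open>The left coaction on homomorphisms\<close>

lemma bicomodule_discrete_vec_HomCC:
  assumes "bicomodule C D M" "discrete_vec D" "contra_space D N"
  shows "discrete_vec (HomCC D N M)"
  using assms discrete_vec_HomCC right_comoduleD(1,3)[OF bicomoduleD(1)[OF assms(1)]] by blast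

text \<open>The action of \<open>C\<^sup>*\<close> on \<open>M\<close> is by endomorphisms of the right \<open>D\<close>-comodule \<open>M\<close>.\<close>

lemma lact_comp_HomCC:
  assumes M: "bicomodule C D M" and C: "vec C" and D: "discrete_vec D" and N: "contra_space D N"
    and \<gamma>: "\<gamma> \<in> carr (HomCC D N M)" and f: "lin C fld f"
  shows "lact C M f \<circ> \<gamma> \<in> carr (HomCC D N M)"
proof -
  note R = right_comoduleD[OF bicomoduleD(1)[OF M]]
  note iff = HomCC_iff[OF D N R(1,3)]
  note \<gamma>' = \<gamma>[unfolded iff]
  have "rapply M D \<xi> (rcoact M (lact C M f (\<gamma> n))) = lact C M f (\<gamma> (contra N (\<lambda>e. sc N (\<xi> e) n)))"
    if n: "n \<in> carr N" and \<xi>: "lin D fld \<xi>" for n \<xi>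
    using ract_lact_commute[OF M C discrete_vec_imp_vec[OF D] f \<xi>, of "\<gamma> n"] \<gamma>' n \<xi>
      lin_on_carr[OF lin_imp_lin_on[OF hom_set_lin]] by (auto simp: ract_def)
  moreover have "lact C M f \<circ> \<gamma> \<in> hom_set N M"
    using hom_set_comp_discrete[OF R(1,2) _ lin_lact[OF M f]] \<gamma>' by blast
  ultimately show ?thesis unfolding iff by simp
qed

text \<open>Since \<open>\<lambda> \<gamma> : N \<rightarrow> C \<otimes> M\<close> has finite rank, \<open>f \<mapsto> f \<gamma>\<close> vanishes on the annihilator of a finite subset of \<open>C\<close>;
  hence it is the slice map of an element of \<open>C \<otimes> X\<close>, which is \<open>\<rho>(\<gamma>)\<close>.\<close>

lemma HomCC_coact:
  fixes C :: "('k::field, 'c::ab_group_add, 'x) coalg_scheme"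
    and M :: "('k, 'c, 'd::ab_group_add, 'm::ab_group_add, 'z) bicomod_scheme"
    and N :: "('k, 'd, 'n::ab_group_add, 'u) contramod_scheme"
  assumes C: "discrete_vec C" and D: "discrete_vec D" and M: "bicomodule C D M"
    and N: "contramodule D N"
  shows lin_HomCC_coact: "lin (HomCC D N M) (C \<otimes> HomCC D N M) (HomCC_coact C D M N)"
    and lapply_HomCC_coact: "\<And>f \<gamma>. lin C fld f \<Longrightarrow> \<gamma> \<in> carr (HomCC D N M) \<Longrightarrow>
      lapply C (HomCC D N M) f (HomCC_coact C D M N \<gamma>) = lact C M f \<circ> \<gamma>"
proof -
  let ?X = "HomCC D N M"
  note C' = discrete_vec_imp_vec[OF C] and cN = contramodule_contra_space[OF N]
  note M' = bicomoduleD[OF M]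
  have X: "vec ?X" by (rule discrete_vec_imp_vec[OF bicomodule_discrete_vec_HomCC[OF M D cN]])
  have Npc: "pseudocompact N" using N by (simp add: contramodule_def)
  have \<gamma>h: "\<gamma> \<in> hom_set N M" if "\<gamma> \<in> carr ?X" for \<gamma> using that by (simp add: carr_HomCC)
  have ex: "\<exists>t. t \<in> carr (C \<otimes> ?X) \<and> (\<forall>f. lin C fld f \<longrightarrow> lapply C ?X f t = lact C M f \<circ> \<gamma>)"
    if \<gamma>: "\<gamma> \<in> carr ?X" for \<gamma>
  proof -
    have "lcoact M \<circ> \<gamma> \<in> hom_set N (C \<otimes> M)"
      by (rule hom_set_comp_discrete[OF M'(2) vec_tensor \<gamma>h[OF \<gamma>] M'(4)])
    then show ?thesis
    proof (rule pseudocompact_lapply_support[OF Npc C' M'(3)])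
      fix K assume K: "finite K" "K \<subseteq> carr C" "\<And>f n. lin C fld f \<Longrightarrow> (\<And>u. u \<in> K \<Longrightarrow> f u = 0) \<Longrightarrow>
        n \<in> carr N \<Longrightarrow> lapply C M f ((lcoact M \<circ> \<gamma>) n) = 0"
      have van: "lact C M f \<circ> \<gamma> = 0" if f: "lin C fld f" "\<And>u. u \<in> K \<Longrightarrow> f u = 0" for f
      proof
        show "(lact C M f \<circ> \<gamma>) n = 0 n" for n
          using K(3)[OF f, of n] lin_outside[OF hom_set_lin[OF \<gamma>h[OF \<gamma>]], of n]
            lin_on_zero[OF M'(3) lin_imp_lin_on[OF lin_lact[OF M f(1)]]]
          by (cases "n \<in> carr N") (simp_all add: lact_def)
      qed
      have t: "lcoact M (\<gamma> n) \<in> carr (C \<otimes> M)" for n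
        using lin_on_carr[OF M'(5)] lin_on_carr[OF lin_imp_lin_on[OF hom_set_lin[OF \<gamma>h[OF \<gamma>]]]]
          lin_outside[OF hom_set_lin[OF \<gamma>h[OF \<gamma>]], of n] vec_zero[OF M'(3)]
        by (cases "n \<in> carr N") auto
      have G: "lin_on (dual C) ?X (\<lambda>f. lact C M f \<circ> \<gamma>)"
        using lact_comp_HomCC[OF M C' D cN \<gamma>] lin_on_lapply_functional[OF C M'(3) t]
        unfolding lin_on_def carr_Homk hom_set_discrete[OF C]
        by (simp add: fun_eq_iff lact_def sc_HomCC del: plus_fun_apply) (simp add: plus_fun_def lact_def)
      show ?thesis
        using lapply_represents[OF C X K(1,2) G van] by blast
    qed
  qed
  define P where "P \<rho> \<longleftrightarrow> lin ?X (C \<otimes> ?X) \<rho> \<and> (\<forall>f. lin C fld f \<longrightarrow> (\<forall>\<gamma>\<in>carr ?X.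
    lapply C ?X f (\<rho> \<gamma>) = lact C M f \<circ> \<gamma>))" for \<rho>
  have uniq: "\<rho> = \<rho>'" if "P \<rho>" "P \<rho>'" for \<rho> \<rho>'
  proof (rule lin_cancel_outside)
    show l: "lin ?X (C \<otimes> ?X) \<rho>" "lin ?X (C \<otimes> ?X) \<rho>'" using that by (auto simp: P_def)
    fix \<gamma> assume \<gamma>: "\<gamma> \<in> carr ?X"
    show "\<rho> \<gamma> = \<rho>' \<gamma>"
      by (rule lapply_separates[OF C' X lin_on_carr[OF lin_imp_lin_on[OF l(1)] \<gamma>]
            lin_on_carr[OF lin_imp_lin_on[OF l(2)] \<gamma>]]) (use that \<gamma> in \<open>simp add: P_def\<close>)
  qed
  obtain \<rho>0 where \<rho>0: "\<And>\<gamma>. \<gamma> \<in> carr ?X \<Longrightarrow> \<rho>0 \<gamma> \<in> carr (C \<otimes> ?X)"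
    "\<And>\<gamma> f. \<gamma> \<in> carr ?X \<Longrightarrow> lin C fld f \<Longrightarrow> lapply C ?X f (\<rho>0 \<gamma>) = lact C M f \<circ> \<gamma>"
    using ex by metis
  define \<rho> where "\<rho> \<gamma> = (if \<gamma> \<in> carr ?X then \<rho>0 \<gamma> else 0)" for \<gamma>
  have "lin_on ?X (C \<otimes> ?X) \<rho>"
  proof (rule lin_on_from_lapply[OF X C' X])
    show "\<rho> \<gamma> \<in> carr (C \<otimes> ?X)" if "\<gamma> \<in> carr ?X" for \<gamma> using \<rho>0(1) that by (simp add: \<rho>_def)
    fix f :: "'c \<Rightarrow> 'k" assume f: "lin C fld f"
    note lf = lin_imp_lin_on[OF lin_lact[OF M f]]
    have in_M: "\<gamma> n \<in> carr M" if "\<gamma> \<in> carr ?X" for \<gamma> n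
      using lin_on_carr[OF lin_imp_lin_on[OF hom_set_lin[OF \<gamma>h[OF that]]]]
        lin_outside[OF hom_set_lin[OF \<gamma>h[OF that]], of n] vec_zero[OF M'(3)]
      by (cases "n \<in> carr N") auto
    have "lin_on ?X ?X (\<lambda>\<gamma>. lact C M f \<circ> \<gamma>)"
      unfolding lin_on_def using lact_comp_HomCC[OF M C' D cN _ f] in_M
      by (auto simp: fun_eq_iff sc_HomCC lin_on_add[OF lf] lin_on_scale[OF lf])
    then show "lin_on ?X ?X (\<lambda>\<gamma>. lapply C ?X f (\<rho> \<gamma>))"
      unfolding lin_on_def using vec_add[OF X] vec_scale[OF X] by (simp add: \<rho>_def \<rho>0(2) f)
  qed
  then have "P \<rho>" using \<rho>0(2) by (auto simp: P_def lin_iff \<rho>_def)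
  then have "P (HomCC_coact C D M N)"
    using theI[of P, OF _ uniq]
    unfolding HomCC_coact_def P_def carr_Homk hom_set_discrete[OF C]
    by (simp add: comp_def lact_def)
  then show "lin ?X (C \<otimes> ?X) (HomCC_coact C D M N)"
    and "\<And>f \<gamma>. lin C fld f \<Longrightarrow> \<gamma> \<in> carr ?X \<Longrightarrow>
      lapply C ?X f (HomCC_coact C D M N \<gamma>) = lact C M f \<circ> \<gamma>"
    by (auto simp: P_def)
qed

section \<open>The contramodule dual to a comodule\<close>

text \<open>The records \<open>cotensor\<close> and \<open>dual_contramodule\<close> take their topology and scalars from other records;
  these rules carry facts over.\<close>

lemma tvs_cong:
  assumes "tp V = tp V'" "sc V = sc V'"
  shows lin_cong_dom: "lin V W f \<longleftrightarrow> lin V' W f"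
    and hom_set_cong_ran: "hom_set U V = hom_set U V'"
    and Homk_cong_ran: "Homk U V = Homk U V'"
    and discrete_vec_cong: "discrete_vec V \<longleftrightarrow> discrete_vec V'"
  using assms by (simp_all add: hom_set_def lin_def Homk_def discrete_vec_def vec_def cong: conj_cong)

lemma tensor_cong:
  assumes "tp V = tp V'" "sc V = sc V'"
  shows tensor_cong_left: "V \<otimes> W = V' \<otimes> W"
    and rapply_cong: "rapply V W \<xi> = rapply V' W \<xi>"
proof -
  have "bilin V W fld = bilin V' W fld"
    using assms by (simp add: bilin_def[abs_def])
  then have p: "pure V W = pure V' W" by (simp add: pure_def[abs_def])
  show t: "V \<otimes> W = V' \<otimes> W" using assms by (simp add: tensor_def p)
  show "rapply V W \<xi> = rapply V' W \<xi>"
    unfolding rapply_def tlift_def t p Homk_cong_ran[OF assms] assms ..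
qed

lemma dual_contramodule_tvs:
  "tp (dual_contramodule C X \<rho>) = tp (dual X)" "sc (dual_contramodule C X \<rho>) = sc (dual X)"
  by (simp_all add: dual_contramodule_def)

lemma bilin_of_hom_dual:
  assumes C: "discrete_vec C" and X: "discrete_vec X" and \<phi>: "\<phi> \<in> hom_set C (dual X)"
  shows "bilin C X fld \<phi>"
proof (rule bilinI)
  note l = lin_imp_lin_on[OF hom_set_lin[OF \<phi>]]
  show "lin_on C fld (\<lambda>c. \<phi> c x)" for x
    unfolding lin_on_def
    by (simp add: lin_on_add[OF l] lin_on_scale[OF l] sc_Homk)
  show "lin_on X fld (\<phi> c)" if "c \<in> carr C" for c
    using lin_on_carr[OF l that] by (simp add: hom_set_lin lin_imp_lin_on)
qed

lemma psi_slice: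
  assumes C: "discrete_vec C" and X: "discrete_vec X" and f: "lin C fld f" and n: "lin X fld n"
    and t: "t \<in> carr (C \<otimes> X)"
  shows "psi C X fld (\<lambda>c. sc (dual X) (f c) n) t = n (lapply C X f t)"
proof -
  note C' = discrete_vec_imp_vec[OF C] and X' = discrete_vec_imp_vec[OF X]
  have "n \<in> carr (dual X)" using n by (simp add: hom_set_discrete[OF X])
  then have "lin C (dual X) (\<lambda>c. sc (dual X) (f c) n)"
    by (rule lin_scalar_multiples[OF vec_Homk_discrete[OF X vec_fld] f])
  then have b: "bilin C X fld (\<lambda>c. sc (dual X) (f c) n)"
    by (intro bilin_of_hom_dual[OF C X]) (simp add: hom_set_discrete[OF C])
  show ?thesis
    unfolding psi_def
    by (rule tensor_lin_eqI[OF C' lin_imp_lin_on[OF lin_tlift[OF vec_fld b]]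
          lin_on_comp[OF lin_on_lapply[OF X' lin_imp_lin_on[OF f]] lin_imp_lin_on[OF n]] _ t],
        simp add: tlift_pure[OF vec_fld b] lapply_pure[OF X' lin_imp_lin_on[OF f]]
        lin_on_scale[OF lin_imp_lin_on[OF n]], simp add: sc_Homk)
qed

text \<open>Continuity of the contraaction: \<open>\<rho>(x) = \<Sum>\<^sub>b b \<otimes> x\<^sub>b\<close> is a finite sum, so the value of
  \<open>\<psi>(\<phi>) \<circ> \<rho>\<close> at \<open>x\<close> depends only on the finitely many scalars \<open>\<phi>(b)(x\<^sub>b)\<close>.\<close>

lemma dual_contramodule_contra_space:
  fixes C :: "('k::field, 'c::ab_group_add, 'x) coalg_scheme"
    and X :: "('k, 'v::ab_group_add, 'y) tvs_scheme"
  assumes C: "discrete_vec C" and X: "discrete_vec X" and \<rho>: "lin X (C \<otimes> X) \<rho>"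
  shows "contra_space C (dual_contramodule C X \<rho>)"
proof -
  note C' = discrete_vec_imp_vec[OF C] and X' = discrete_vec_imp_vec[OF X]
  note \<rho>' = lin_imp_lin_on[OF \<rho>]
  let ?T = "dual_contramodule C X \<rho>"
  note T = dual_contramodule_tvs[of C X \<rho>]
  have vd: "vec (dual X)" by (rule vec_Homk_discrete[OF X vec_fld])
  have H: "hom_set C ?T = hom_set C (dual X)" and HH: "Homk C ?T = Homk C (dual X)"
    by (rule hom_set_cong_ran[OF T], rule Homk_cong_ran[OF T])
  have vT: "vec ?T" using vd unfolding vec_def T .
  have scale: "continuous_map (tp ?T) (tp ?T) (sc ?T c)" for c
    unfolding T
  proof (rule continuous_map_into_Homk[OF X])
    show "sc (dual X) c \<in> carr (dual X) \<rightarrow> hom_set X fld"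
      using vec_scale[OF vd] by auto
    fix x assume "x \<in> carr X"
    then have "continuous_map (tp (dual X)) (discrete_topology UNIV) (\<lambda>n. n x)"
      using continuous_map_evaluation[of x X fld] by (simp add: tp_fld)
    then show "continuous_map (tp (dual X)) (tp fld) (\<lambda>n. sc (dual X) c n x)"
      unfolding tp_fld
      \<comment> \<open>a single function to factor through, hence the dummy index\<close>
      by - (rule continuous_map_discrete_factor[where J = "{()}" and g = "\<lambda>_ n. n x"],
        auto simp: sc_Homk)
  qed
  let ?\<theta> = "contra ?T"
  have \<theta>: "?\<theta> \<phi> = (if \<phi> \<in> hom_set C (dual X) then tlift C X fld \<phi> \<circ> \<rho> else 0)" for \<phi>
    by (simp add: dual_contramodule_def psi_def)
  have b: "bilin C X fld \<phi>" if "\<phi> \<in> hom_set C (dual X)" for \<phi> by (rule bilin_of_hom_dual[OF C X that])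
  have \<theta>_carr: "?\<theta> \<phi> \<in> hom_set X fld" if "\<phi> \<in> hom_set C (dual X)" for \<phi>
    using lin_comp[OF vec_tensor \<rho> lin_tlift[OF vec_fld b[OF that]]] that
    by (simp add: \<theta> hom_set_discrete[OF X])
  have vH: "vec (Homk C (dual X))" by (rule vec_Homk_discrete[OF C vd])
  have \<rho>c: "\<rho> x \<in> carr (C \<otimes> X)" for x
    using lin_on_carr[OF \<rho>'] lin_outside[OF \<rho>, of x] vec_zero[OF vec_tensor, of C X]
    by (cases "x \<in> carr X") auto
  have add: "tlift C X fld (\<phi> + \<phi>') t = tlift C X fld \<phi> t + tlift C X fld \<phi>' t"
    if \<phi>: "\<phi> \<in> hom_set C (dual X)" "\<phi>' \<in> hom_set C (dual X)" and t: "t \<in> carr (C \<otimes> X)" for \<phi> \<phi>' t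
  proof -
    have s: "\<phi> + \<phi>' \<in> hom_set C (dual X)" using vec_add[OF vH] \<phi> by simp
    note l = lin_imp_lin_on[OF lin_tlift[OF vec_fld b]]
    show ?thesis
      by (rule tensor_lin_eqI[OF C' l[OF s] lin_on_plus[OF vec_fld l[OF \<phi>(1)] l[OF \<phi>(2)]] _ t])
        (simp add: tlift_pure[OF vec_fld b[OF s]] tlift_pure[OF vec_fld b[OF \<phi>(1)]]
          tlift_pure[OF vec_fld b[OF \<phi>(2)]])
  qed
  have scl: "tlift C X fld (sc (Homk C (dual X)) c \<phi>) t = c * tlift C X fld \<phi> t"
    if \<phi>: "\<phi> \<in> hom_set C (dual X)" and t: "t \<in> carr (C \<otimes> X)" for c \<phi> t
  proof -
    have s: "sc (Homk C (dual X)) c \<phi> \<in> hom_set C (dual X)" using vec_scale[OF vH] \<phi> by simp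
    note l = lin_imp_lin_on[OF lin_tlift[OF vec_fld b]]
    have "lin_on (C \<otimes> X) fld (\<lambda>t. c * tlift C X fld \<phi> t)"
      using lin_on_comp[OF l[OF \<phi>] lin_on_sc_right[OF vec_fld, of c]] by simp
    from tensor_lin_eqI[OF C' l[OF s] this _ t] show ?thesis
      by (simp add: tlift_pure[OF vec_fld b[OF s]] tlift_pure[OF vec_fld b[OF \<phi>]])
        (simp add: sc_Homk)
  qed
  have "lin (Homk C (dual X)) (dual X) ?\<theta>"
    unfolding lin_iff lin_on_def
  proof (intro conjI ballI allI impI)
    show "?\<theta> (x + y) = ?\<theta> x + ?\<theta> y"
      if "x \<in> carr (Homk C (dual X))" "y \<in> carr (Homk C (dual X))" for x y
      using that vec_add[OF vH that] by (simp add: \<theta> fun_eq_iff add \<rho>c del: plus_fun_apply) simp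
    show "?\<theta> (sc (Homk C (dual X)) c x) = sc (dual X) c (?\<theta> x)"
      if "x \<in> carr (Homk C (dual X))" for c x
      using that vec_scale[OF vH that, of c] by (simp add: \<theta> fun_eq_iff scl \<rho>c sc_Homk[of X])
  qed (use \<theta>_carr in \<open>simp_all add: \<theta>\<close>)
  moreover have "continuous_map (tp (Homk C (dual X))) (tp (dual X)) ?\<theta>"
  proof (rule continuous_map_into_Homk[OF X])
    show "?\<theta> \<in> carr (Homk C (dual X)) \<rightarrow> hom_set X fld" using \<theta>_carr by simp
    fix x assume "x \<in> carr X"
    obtain B and e :: "'c \<Rightarrow> 'c \<Rightarrow> 'k" where B: "finite B" "B \<subseteq> carr C"
      "\<And>b. b \<in> B \<Longrightarrow> lin C fld (e b)" "\<rho> x = (\<Sum>b\<in>B. pure C X b (lapply C X (e b) (\<rho> x)))"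
      by (rule lapply_expansion[OF C' X' \<rho>c[of x]]) (rule that; assumption)
    define y where "y b = lapply C X (e b) (\<rho> x)" for b
    have y: "y b \<in> carr X" if "b \<in> B" for b
      unfolding y_def by (rule lin_on_carr[OF lin_on_lapply[OF X' lin_imp_lin_on[OF B(3)[OF that]]] \<rho>c])
    have val: "?\<theta> \<phi> x = (\<Sum>b\<in>B. \<phi> b (y b))" if \<phi>: "\<phi> \<in> hom_set C (dual X)" for \<phi>
    proof -
      have "?\<theta> \<phi> x = tlift C X fld \<phi> (\<rho> x)" using \<phi> by (simp add: \<theta>)
      also have "\<dots> = tlift C X fld \<phi> (\<Sum>b\<in>B. pure C X b (y b))"
        by (rule arg_cong[OF B(4)[folded y_def]])
      also have "\<dots> = (\<Sum>b\<in>B. tlift C X fld \<phi> (pure C X b (y b)))"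
        using B(2) y by (intro lin_on_sum[OF vec_tensor lin_imp_lin_on[OF lin_tlift[OF vec_fld b[OF \<phi>]]]]
            pure_carr) auto
      also have "\<dots> = (\<Sum>b\<in>B. \<phi> b (y b))"
        using B(2) y by (intro sum.cong refl tlift_pure[OF vec_fld b[OF \<phi>]]) auto
      finally show ?thesis .
    qed
    show "continuous_map (tp (Homk C (dual X))) (tp fld) (\<lambda>\<phi>. ?\<theta> \<phi> x)"
      unfolding tp_fld
    proof (rule continuous_map_discrete_factor[OF B(1), where g = "\<lambda>b \<phi>. \<phi> b (y b)"])
      fix b assume b: "b \<in> B"
      have "continuous_map (tp (Homk C (dual X))) (tp (dual X)) (\<lambda>\<phi>. \<phi> b)"
        by (rule continuous_map_evaluation) (use b B(2) in blast)
      from continuous_map_compose[OF this continuous_map_evaluation[OF y[OF b], of fld]]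
      show "continuous_map (tp (Homk C (dual X))) (discrete_topology UNIV) (\<lambda>\<phi>. \<phi> b (y b))"
        by (simp add: comp_def tp_fld)
    qed (simp_all add: val)
  qed
  ultimately have "?\<theta> \<in> hom_set (Homk C (dual X)) (dual X)" by (simp add: hom_set_def)
  then have "?\<theta> \<in> hom_set (Homk C ?T) ?T"
    unfolding HH hom_set_cong_ran[OF T] .
  then show ?thesis using vT scale by (simp add: contra_space_def)
qed

section \<open>The cotensor product through slices\<close>

lemma cotensor_tvs:
  "tp (cotensor C D L M) = tp (cotensor_space C L M)" "sc (cotensor C D L M) = sc (cotensor_space C L M)"
  by (simp_all add: cotensor_def Let_def)

lemma sc_cotensor_space: "sc (cotensor_space C L M) = sc (L \<otimes> M)"
  by (simp add: cotensor_space_def)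

text \<open>Apply \<open>\<nu> \<otimes> f \<otimes> id\<close> to both sides of the equation in \<open>L \<otimes> C \<otimes> M\<close>.\<close>

lemma carr_cotensor_space_iff:
  fixes C :: "('k::field, 'c::ab_group_add, 'x) coalg_scheme"
    and L :: "('k, 'c, 'l::ab_group_add, 'y) rcomod_scheme"
  assumes C: "vec C" and L: "right_comodule C L" and M: "bicomodule C D M"
  shows "t \<in> carr (cotensor_space C L M) \<longleftrightarrow> t \<in> carr (L \<otimes> M)
    \<and> (\<forall>\<nu> f. lin L fld \<nu> \<longrightarrow> lin C fld f \<longrightarrow>
        lapply L M (\<nu> \<circ> ract C L f) t = lact C M f (lapply L M \<nu> t))"
proof (cases "t \<in> carr (L \<otimes> M)")
  case t: True
  note L' = right_comoduleD[OF L] and M' = bicomoduleD[OF M]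
  let ?s = "tmap L M (L \<otimes> C) M (rcoact L) (\<lambda>x. x) t"
  let ?a = "assoc L C M ?s" and ?b = "tmap L M L (C \<otimes> M) (\<lambda>x. x) (lcoact M) t"
  have s: "?s \<in> carr ((L \<otimes> C) \<otimes> M)" by (rule lin_on_carr[OF lin_on_tmap[OF L'(4) lin_on_id] t])
  have a: "?a \<in> carr (L \<otimes> (C \<otimes> M))"
    by (rule lin_on_carr[OF lin_imp_lin_on[OF lin_assoc[OF L'(2) M'(3)]] s])
  have b: "?b \<in> carr (L \<otimes> (C \<otimes> M))" by (rule lin_on_carr[OF lin_on_tmap[OF lin_on_id M'(5)] t])
  have la: "lapply C M f (lapply L (C \<otimes> M) \<nu> ?a) = lapply L M (\<nu> \<circ> ract C L f) t"
    and lb: "lapply C M f (lapply L (C \<otimes> M) \<nu> ?b) = lact C M f (lapply L M \<nu> t)"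
    if \<nu>: "lin L fld \<nu>" and f: "lin C fld f" for \<nu> f
  proof -
    note \<nu>' = lin_imp_lin_on[OF \<nu>] and f' = lin_imp_lin_on[OF f]
    show "lapply C M f (lapply L (C \<otimes> M) \<nu> ?a) = lapply L M (\<nu> \<circ> ract C L f) t"
      unfolding lapply_lapply_assoc[OF L'(2) C M'(3) \<nu>' f' s]
        lapply_tmap[OF L'(2) M'(3) L'(4) lin_on_id lin_on_comp[OF lin_on_rapply[OF L'(2) f'] \<nu>'] t M'(3)]
      by (simp add: comp_def ract_def)
    show "lapply C M f (lapply L (C \<otimes> M) \<nu> ?b) = lact C M f (lapply L M \<nu> t)"
      unfolding lapply_tmap[OF L'(2) vec_tensor lin_on_id M'(5) \<nu>' t M'(3)] by (simp add: lact_def)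
  qed
  have "?a = ?b \<longleftrightarrow> (\<forall>\<nu> f. lin L fld \<nu> \<longrightarrow> lin C fld f \<longrightarrow>
        lapply L M (\<nu> \<circ> ract C L f) t = lact C M f (lapply L M \<nu> t))" (is "_ \<longleftrightarrow> ?r")
  proof
    show ?r if "?a = ?b" using la lb unfolding that by metis
    show "?a = ?b" if ?r
    proof (rule lapply_separates[OF L'(2) vec_tensor a b])
      fix \<nu> :: "'l \<Rightarrow> 'k" assume \<nu>: "lin L fld \<nu>"
      note l = lin_on_lapply[OF vec_tensor lin_imp_lin_on[OF \<nu>]]
      show "lapply L (C \<otimes> M) \<nu> ?a = lapply L (C \<otimes> M) \<nu> ?b"
        by (rule lapply_separates[OF C M'(3) lin_on_carr[OF l a] lin_on_carr[OF l b]])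
          (use that la[OF \<nu>] lb[OF \<nu>] \<nu> in simp)
    qed
  qed
  then show ?thesis using t by (simp add: cotensor_space_def)
qed (simp add: cotensor_space_def)

lemma lin_on_cotensor_inclusion: "lin_on (cotensor_space C L M) (L \<otimes> M) (\<lambda>t. t)"
  by (simp add: lin_on_def sc_cotensor_space) (simp add: cotensor_space_def)

lemma discrete_vec_cotensor_space:
  assumes C: "vec C" and L: "right_comodule C L" and M: "bicomodule C D M"
  shows "discrete_vec (cotensor_space C L M)"
proof -
  note L' = right_comoduleD[OF L] and M' = bicomoduleD[OF M]
  interpret T: vector_space "sc (L \<otimes> M)" by (rule vec_vector_space[OF vec_tensor])
  note iff = carr_cotensor_space_iff[OF C L M]
  have l1: "lin_on (L \<otimes> M) M (lapply L M (\<nu> \<circ> ract C L f))"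
    and l2: "lin_on (L \<otimes> M) M (\<lambda>t. lact C M f (lapply L M \<nu> t))"
    if "lin L fld \<nu>" "lin C fld f" for \<nu> f
    using lin_on_lapply[OF M'(3) lin_imp_lin_on[OF lin_comp[OF L'(2) lin_ract[OF L that(2)] that(1)]]]
      lin_on_comp[OF lin_on_lapply[OF M'(3) lin_imp_lin_on[OF that(1)]]
        lin_imp_lin_on[OF lin_lact[OF M that(2)]]] by blast+
  have "T.subspace (carr (cotensor_space C L M))"
  proof (rule T.subspaceI)
    show "0 \<in> carr (cotensor_space C L M)"
      unfolding iff
      by (intro conjI allI impI vec_zero[OF vec_tensor])
        (metis lin_on_zero[OF vec_tensor l1] lin_on_zero[OF vec_tensor l2])
    show "x + y \<in> carr (cotensor_space C L M)"
      if "x \<in> carr (cotensor_space C L M)" "y \<in> carr (cotensor_space C L M)" for x y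
      using that unfolding iff
      by (simp add: vec_add[OF vec_tensor] lin_on_add[OF l1] lin_on_add[OF l2])
    show "sc (L \<otimes> M) c x \<in> carr (cotensor_space C L M)"
      if "x \<in> carr (cotensor_space C L M)" for c x
      using that unfolding iff
      by (simp add: vec_scale[OF vec_tensor] lin_on_scale[OF l1] lin_on_scale[OF l2])
  qed
  then have "vec (cotensor_space C L M)"
    unfolding vec_def sc_cotensor_space by (intro conjI T.vector_space_axioms)
  then show ?thesis by (simp add: discrete_vec_def) (simp add: cotensor_space_def)
qed

text \<open>For \<open>t \<in> L \<box> M\<close> the element \<open>(id \<otimes> \<xi>)(t)\<close>, with \<open>\<xi>\<close> acting on \<open>M\<close>, is again in \<open>L \<box> M\<close>, because the actions of
  \<open>C\<^sup>*\<close> and \<open>D\<^sup>*\<close> on \<open>M\<close> commute.  As a function of \<open>\<xi>\<close> it is the slice map of an element of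
  \<open>(L \<box> M) \<otimes> D\<close>, the value of the coaction at \<open>t\<close>.\<close>

lemma cotensor_rcoact:
  fixes C :: "('k::field, 'c::ab_group_add, 'x) coalg_scheme"
    and D :: "('k, 'd::ab_group_add, 'w) coalg_scheme"
    and L :: "('k, 'c, 'l::ab_group_add, 'y) rcomod_scheme"
    and M :: "('k, 'c, 'd, 'm::ab_group_add, 'z) bicomod_scheme"
  assumes C: "vec C" and D: "discrete_vec D" and L: "right_comodule C L" and M: "bicomodule C D M"
  shows lin_cotensor_rcoact:
      "lin (cotensor C D L M) (cotensor C D L M \<otimes> D) (rcoact (cotensor C D L M))"
    and cotensor_rcoact_slice: "\<And>t \<nu> \<xi>. t \<in> carr (cotensor_space C L M) \<Longrightarrow>
      lin L fld \<nu> \<Longrightarrow> lin D fld \<xi> \<Longrightarrow>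
      lapply L M \<nu> (rapply (cotensor C D L M) D \<xi> (rcoact (cotensor C D L M) t))
        = ract D M \<xi> (lapply L M \<nu> t)"
proof -
  let ?P = "cotensor_space C L M" and ?Q = "cotensor C D L M"
  note D' = discrete_vec_imp_vec[OF D] and L' = right_comoduleD[OF L] and M' = bicomoduleD[OF M]
  note R = right_comoduleD[OF M'(1)]
  note iff = carr_cotensor_space_iff[OF C L M]
  have P: "vec ?P" by (rule discrete_vec_imp_vec[OF discrete_vec_cotensor_space[OF C L M]])
  have PLM: "t \<in> carr (L \<otimes> M)" if "t \<in> carr ?P" for t using that unfolding iff by blast
  note inc = lin_on_cotensor_inclusion[of C L M]
  define S where "S \<mu> \<longleftrightarrow> (\<forall>t\<in>carr ?P. \<forall>\<nu> \<xi>. lin L fld \<nu> \<longrightarrow> lin D fld \<xi> \<longrightarrow>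
    lapply L M \<nu> (rapply ?P D \<xi> (\<mu> t)) = ract D M \<xi> (lapply L M \<nu> t))" for \<mu>
  have S_iff: "(\<forall>t\<in>carr ?P. assoc L M D (tmap ?P D (L \<otimes> M) D (\<lambda>x. x) (\<lambda>x. x) (\<mu> t))
      = tmap L M L (M \<otimes> D) (\<lambda>x. x) (rcoact M) t) \<longleftrightarrow> S \<mu>" if \<mu>: "lin ?P (?P \<otimes> D) \<mu>" for \<mu>
  proof -
    have "assoc L M D (tmap ?P D (L \<otimes> M) D (\<lambda>x. x) (\<lambda>x. x) (\<mu> t))
        = tmap L M L (M \<otimes> D) (\<lambda>x. x) (rcoact M) t
      \<longleftrightarrow> (\<forall>\<nu> \<xi>. lin L fld \<nu> \<longrightarrow> lin D fld \<xi> \<longrightarrow>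
        lapply L M \<nu> (rapply ?P D \<xi> (\<mu> t)) = ract D M \<xi> (lapply L M \<nu> t))" (is "?a = ?b \<longleftrightarrow> ?r")
      if t: "t \<in> carr ?P" for t
    proof -
      let ?s = "tmap ?P D (L \<otimes> M) D (\<lambda>x. x) (\<lambda>x. x) (\<mu> t)"
      have \<mu>t: "\<mu> t \<in> carr (?P \<otimes> D)" by (rule lin_on_carr[OF lin_imp_lin_on[OF \<mu>] t])
      have s: "?s \<in> carr ((L \<otimes> M) \<otimes> D)" by (rule lin_on_carr[OF lin_on_tmap[OF inc lin_on_id] \<mu>t])
      have a: "?a \<in> carr (L \<otimes> (M \<otimes> D))"
        by (rule lin_on_carr[OF lin_imp_lin_on[OF lin_assoc[OF L'(2) D']] s])
      have b: "?b \<in> carr (L \<otimes> (M \<otimes> D))"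
        by (rule lin_on_carr[OF lin_on_tmap[OF lin_on_id R(4)] PLM[OF t]])
      have la: "rapply M D \<xi> (lapply L (M \<otimes> D) \<nu> ?a) = lapply L M \<nu> (rapply ?P D \<xi> (\<mu> t))"
        and lb: "rapply M D \<xi> (lapply L (M \<otimes> D) \<nu> ?b) = ract D M \<xi> (lapply L M \<nu> t)"
        if \<nu>: "lin L fld \<nu>" and \<xi>: "lin D fld \<xi>" for \<nu> \<xi>
      proof -
        note \<nu>' = lin_imp_lin_on[OF \<nu>] and \<xi>' = lin_imp_lin_on[OF \<xi>]
        show "rapply M D \<xi> (lapply L (M \<otimes> D) \<nu> ?a) = lapply L M \<nu> (rapply ?P D \<xi> (\<mu> t))"
          unfolding rapply_lapply_assoc[OF L'(2) R(2) D' \<nu>' \<xi>' s]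
            rapply_tmap[OF P vec_tensor inc lin_on_id \<xi>' \<mu>t] ..
        show "rapply M D \<xi> (lapply L (M \<otimes> D) \<nu> ?b) = ract D M \<xi> (lapply L M \<nu> t)"
          unfolding lapply_tmap[OF L'(2) vec_tensor lin_on_id R(4) \<nu>' PLM[OF t] R(2)]
          by (simp add: ract_def)
      qed
      show ?thesis
      proof
        show ?r if "?a = ?b" using la lb unfolding that by metis
        show "?a = ?b" if ?r
        proof (rule lapply_separates[OF L'(2) vec_tensor a b])
          fix \<nu> :: "'l \<Rightarrow> 'k" assume \<nu>: "lin L fld \<nu>"
          note l = lin_on_lapply[OF vec_tensor lin_imp_lin_on[OF \<nu>]]
          show "lapply L (M \<otimes> D) \<nu> ?a = lapply L (M \<otimes> D) \<nu> ?b"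
            by (rule rapply_separates[OF R(2) D' lin_on_carr[OF l a] lin_on_carr[OF l b]])
              (use that la[OF \<nu>] lb[OF \<nu>] \<nu> in simp)
        qed
      qed
    qed
    then show ?thesis unfolding S_def by (intro ball_cong refl)
  qed
  have uniq: "\<mu> = \<mu>'" if l: "lin ?P (?P \<otimes> D) \<mu>" "lin ?P (?P \<otimes> D) \<mu>'" and "S \<mu>" "S \<mu>'" for \<mu> \<mu>'
  proof (rule lin_cancel_outside[OF l])
    fix t assume t: "t \<in> carr ?P"
    note c = lin_on_carr[OF lin_imp_lin_on[OF l(1)] t] lin_on_carr[OF lin_imp_lin_on[OF l(2)] t]
    show "\<mu> t = \<mu>' t"
    proof (rule rapply_separates[OF P D' c])
      fix \<xi> :: "'d \<Rightarrow> 'k" assume \<xi>: "lin D fld \<xi>"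
      note r = lin_on_rapply[OF P lin_imp_lin_on[OF \<xi>]]
      show "rapply ?P D \<xi> (\<mu> t) = rapply ?P D \<xi> (\<mu>' t)"
        by (rule lapply_separates[OF L'(2) R(2) PLM[OF lin_on_carr[OF r c(1)]]
              PLM[OF lin_on_carr[OF r c(2)]]]) (use \<open>S \<mu>\<close> \<open>S \<mu>'\<close> t \<xi> in \<open>simp add: S_def\<close>)
    qed
  qed
  let ?G = "\<lambda>\<xi>. tmap L M L M (\<lambda>x. x) (ract D M \<xi>)"
  have lr: "lin_on M M (ract D M \<xi>)" if "lin D fld \<xi>" for \<xi>
    by (rule lin_imp_lin_on[OF lin_ract[OF M'(1) that]])
  have Gl: "lapply L M \<nu> (?G \<xi> t) = ract D M \<xi> (lapply L M \<nu> t)"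
    if "lin L fld \<nu>" "lin D fld \<xi>" "t \<in> carr (L \<otimes> M)" for \<nu> \<xi> t
    by (rule lapply_tmap[OF L'(2) R(2) lin_on_id lr[OF that(2)] lin_imp_lin_on[OF that(1)] that(3) R(2)])
  have GP: "?G \<xi> t \<in> carr ?P" if \<xi>: "lin D fld \<xi>" and t: "t \<in> carr ?P" for \<xi> t
    unfolding iff
  proof (intro conjI allI impI)
    show "?G \<xi> t \<in> carr (L \<otimes> M)" by (rule lin_on_carr[OF lin_on_tmap[OF lin_on_id lr[OF \<xi>]] PLM[OF t]])
    fix \<nu> :: "'l \<Rightarrow> 'k" and f :: "'c \<Rightarrow> 'k" assume \<nu>: "lin L fld \<nu>" and f: "lin C fld f"
    have \<nu>f: "lin L fld (\<nu> \<circ> ract C L f)" by (rule lin_comp[OF L'(2) lin_ract[OF L f] \<nu>])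
    have m: "lapply L M \<nu> t \<in> carr M"
      by (rule lin_on_carr[OF lin_on_lapply[OF R(2) lin_imp_lin_on[OF \<nu>]] PLM[OF t]])
    have "lapply L M (\<nu> \<circ> ract C L f) t = lact C M f (lapply L M \<nu> t)"
      using t \<nu> f unfolding iff by blast
    then show "lapply L M (\<nu> \<circ> ract C L f) (?G \<xi> t) = lact C M f (lapply L M \<nu> (?G \<xi> t))"
      by (simp only: Gl[OF \<nu>f \<xi> PLM[OF t]] Gl[OF \<nu> \<xi> PLM[OF t]] ract_lact_commute[OF M C D' f \<xi> m])
  qed
  have ex: "\<exists>s. s \<in> carr (?P \<otimes> D) \<and> (\<forall>\<xi>. lin D fld \<xi> \<longrightarrow> rapply ?P D \<xi> s = ?G \<xi> t)"
    if t: "t \<in> carr ?P" for t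
  proof -
    obtain B e where B: "finite B" "B \<subseteq> carr L" "\<And>b. b \<in> B \<Longrightarrow> lin L fld (e b)"
      "t = (\<Sum>b\<in>B. pure L M b (lapply L M (e b) t))"
      by (rule lapply_expansion[OF L'(2) R(2) PLM[OF t]]) (rule that; assumption)
    define m where "m b = lapply L M (e b) t" for b
    have m: "m b \<in> carr M" if "b \<in> B" for b
      unfolding m_def
      by (rule lin_on_carr[OF lin_on_lapply[OF R(2) lin_imp_lin_on[OF B(3)[OF that]]] PLM[OF t]])
    have "\<exists>K. finite K \<and> K \<subseteq> carr D \<and>
        (\<forall>\<xi>. lin D fld \<xi> \<longrightarrow> (\<forall>d\<in>K. \<xi> d = 0) \<longrightarrow> ract D M \<xi> (m b) = 0)" if b: "b \<in> B" for b
    proof (rule rapply_support[OF R(2) D' lin_on_carr[OF R(4) m[OF b]]])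
      fix K assume K: "finite K" "K \<subseteq> carr D" "\<And>\<xi>. lin D fld \<xi> \<Longrightarrow> (\<And>w. w \<in> K \<Longrightarrow> \<xi> w = 0) \<Longrightarrow>
        rapply M D \<xi> (rcoact M (m b)) = 0"
      show ?thesis unfolding ract_def by (intro exI[of _ K] conjI K(1,2) allI impI K(3)) blast+
    qed
    then obtain k where k: "\<And>b. b \<in> B \<Longrightarrow> finite (k b)" "\<And>b. b \<in> B \<Longrightarrow> k b \<subseteq> carr D"
      "\<And>b \<xi>. b \<in> B \<Longrightarrow> lin D fld \<xi> \<Longrightarrow> \<forall>d\<in>k b. \<xi> d = 0 \<Longrightarrow> ract D M \<xi> (m b) = 0"
      by metis
    have K: "finite (\<Union>(k ` B))" "\<Union>(k ` B) \<subseteq> carr D" using B(1) k(1,2) by auto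
    have van: "?G \<xi> t = 0" if \<xi>: "lin D fld \<xi>" and z: "\<And>d. d \<in> \<Union>(k ` B) \<Longrightarrow> \<xi> d = 0" for \<xi>
    proof -
      have r0: "ract D M \<xi> (m b) = 0" if "b \<in> B" for b using k(3)[OF that \<xi>] z that by blast
      have p0: "pure L M b 0 = 0" if "b \<in> B" for b
        by (rule lin_on_zero[OF R(2) lin_on_pure_right]) (use that B(2) in blast)
      have "?G \<xi> t = ?G \<xi> (\<Sum>b\<in>B. pure L M b (m b))" by (rule arg_cong[OF B(4)[folded m_def]])
      also have "\<dots> = (\<Sum>b\<in>B. ?G \<xi> (pure L M b (m b)))"
        using B(2) m by (intro lin_on_sum[OF vec_tensor lin_on_tmap[OF lin_on_id lr[OF \<xi>]]] pure_carr) auto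
      also have "\<dots> = (\<Sum>b\<in>B. pure L M b (ract D M \<xi> (m b)))"
        using B(2) m by (intro sum.cong refl tmap_pure[OF lin_on_id lr[OF \<xi>]]) auto
      also have "\<dots> = 0" by (intro sum.neutral ballI) (simp only: r0 p0)
      finally show ?thesis .
    qed
    have dD: "vec (dual D)" by (rule vec_Homk_discrete[OF D vec_fld])
    have "lin_on (dual D) (L \<otimes> M) (\<lambda>\<xi>. ?G \<xi> t)"
    proof (rule lin_on_from_lapply[OF dD L'(2) R(2)])
      show "?G \<xi> t \<in> carr (L \<otimes> M)" if "\<xi> \<in> carr (dual D)" for \<xi>
        using PLM[OF GP[OF _ t]] that by (simp add: hom_set_discrete[OF D])
      fix \<nu> :: "'l \<Rightarrow> 'k" assume \<nu>: "lin L fld \<nu>"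
      have "lapply L M \<nu> t \<in> carr M"
        by (rule lin_on_carr[OF lin_on_lapply[OF R(2) lin_imp_lin_on[OF \<nu>]] PLM[OF t]])
      from lin_on_rapply_functional[OF R(2) D lin_on_carr[OF R(4) this]]
      show "lin_on (dual D) M (\<lambda>\<xi>. lapply L M \<nu> (?G \<xi> t))"
        unfolding lin_on_def using vec_add[OF dD] vec_scale[OF dD] Gl[OF \<nu> _ PLM[OF t]]
        by (simp add: hom_set_discrete[OF D] ract_def)
    qed
    then have G: "lin_on (dual D) ?P (\<lambda>\<xi>. ?G \<xi> t)"
      using GP[OF _ t] by (simp add: lin_on_def hom_set_discrete[OF D] sc_cotensor_space)
    show ?thesis using rapply_represents[OF P D K G van] by blast
  qed
  obtain \<mu>0 where \<mu>0: "\<And>t. t \<in> carr ?P \<Longrightarrow> \<mu>0 t \<in> carr (?P \<otimes> D)"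
    "\<And>t \<xi>. t \<in> carr ?P \<Longrightarrow> lin D fld \<xi> \<Longrightarrow> rapply ?P D \<xi> (\<mu>0 t) = ?G \<xi> t"
    using ex by metis
  define \<mu> where "\<mu> t = (if t \<in> carr ?P then \<mu>0 t else 0)" for t
  have "lin_on ?P (?P \<otimes> D) \<mu>"
  proof (rule lin_on_from_rapply[OF P P D'])
    show "\<mu> t \<in> carr (?P \<otimes> D)" if "t \<in> carr ?P" for t using \<mu>0(1) that by (simp add: \<mu>_def)
    fix \<xi> :: "'d \<Rightarrow> 'k" assume \<xi>: "lin D fld \<xi>"
    have "lin_on ?P ?P (?G \<xi>)"
      using lin_on_comp[OF inc lin_on_tmap[OF lin_on_id lr[OF \<xi>]]] GP[OF \<xi>]
      by (simp add: lin_on_def sc_cotensor_space)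
    then show "lin_on ?P ?P (\<lambda>t. rapply ?P D \<xi> (\<mu> t))"
      unfolding lin_on_def using vec_add[OF P] vec_scale[OF P] by (simp add: \<mu>_def \<mu>0(2) \<xi>)
  qed
  then have \<mu>l: "lin ?P (?P \<otimes> D) \<mu>" by (simp add: lin_iff \<mu>_def)
  have \<mu>S: "S \<mu>" unfolding S_def by (simp add: \<mu>_def \<mu>0(2) Gl PLM)
  let ?E = "\<lambda>\<mu>. lin ?P (?P \<otimes> D) \<mu> \<and> (\<forall>t\<in>carr ?P.
    assoc L M D (tmap ?P D (L \<otimes> M) D (\<lambda>x. x) (\<lambda>x. x) (\<mu> t)) = tmap L M L (M \<otimes> D) (\<lambda>x. x) (rcoact M) t)"
  have "?E (THE \<mu>. ?E \<mu>)"
  proof (rule theI[of ?E])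
    show "?E \<mu>" using S_iff[OF \<mu>l] \<mu>l \<mu>S by blast
    show "\<mu>' = \<mu>" if "?E \<mu>'" for \<mu>'
      using that S_iff[of \<mu>'] uniq[OF _ \<mu>l _ \<mu>S, of \<mu>'] by blast
  qed
  moreover have "rcoact ?Q = (THE \<mu>. ?E \<mu>)" by (simp add: cotensor_def Let_def)
  ultimately have "lin ?P (?P \<otimes> D) (rcoact ?Q)" and S: "S (rcoact ?Q)"
    using S_iff[of "rcoact ?Q"] by simp_all
  moreover note tc = tensor_cong[OF cotensor_tvs[of C D L M]] lin_cong_dom[OF cotensor_tvs[of C D L M]]
  ultimately show "lin ?Q (?Q \<otimes> D) (rcoact ?Q)" by (simp only: tc)
  show "lapply L M \<nu> (rapply ?Q D \<xi> (rcoact ?Q t)) = ract D M \<xi> (lapply L M \<nu> t)"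
    if "t \<in> carr ?P" "lin L fld \<nu>" "lin D fld \<xi>" for t \<nu> \<xi>
    using S that unfolding S_def tc by blast
qed

section \<open>Homomorphisms into the cotensor product and out of the dual\<close>

lemma hom_set_zero_outside: "f \<in> hom_set N M \<Longrightarrow> x \<notin> carr N \<Longrightarrow> f x = 0"
  by (rule lin_outside[OF hom_set_lin])

lemma hom_set_carr: "vec M \<Longrightarrow> f \<in> hom_set N M \<Longrightarrow> f x \<in> carr M"
  by (cases "x \<in> carr N")
    (auto simp: hom_set_zero_outside vec_zero intro: lin_on_carr[OF lin_imp_lin_on[OF hom_set_lin]])

text \<open>The equation between slices says that \<open>\<gamma>\<close> lands in \<open>L \<box> M\<close>.  Given this, compatibility with \<open>D\<close> can be
  tested on slices, because slicing carries the coaction of \<open>L \<box> M\<close> to that of \<open>M\<close>.\<close>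

lemma HomCC_cotensor_iff:
  fixes L :: "('k::field, 'c::ab_group_add, 'l::ab_group_add, 'y) rcomod_scheme"
  assumes C: "vec C" and D: "discrete_vec D" and L: "right_comodule C L" and M: "bicomodule C D M"
    and N: "contra_space D N"
  shows "\<gamma> \<in> carr (HomCC D N (cotensor C D L M)) \<longleftrightarrow> \<gamma> \<in> hom_set N (L \<otimes> M)
    \<and> (\<forall>\<nu>. lin L fld \<nu> \<longrightarrow> lapply L M \<nu> \<circ> \<gamma> \<in> carr (HomCC D N M))
    \<and> (\<forall>\<nu> f. lin L fld \<nu> \<longrightarrow> lin C fld f \<longrightarrow>
         lapply L M (\<nu> \<circ> ract C L f) \<circ> \<gamma> = lact C M f \<circ> (lapply L M \<nu> \<circ> \<gamma>))"
proof -
  let ?P = "cotensor_space C L M" and ?Q = "cotensor C D L M"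
  note L' = right_comoduleD[OF L] and R = right_comoduleD[OF bicomoduleD(1)[OF M]]
  note tvs = cotensor_tvs[of C D L M]
  note coact = cotensor_rcoact[OF C D L M]
  note D' = discrete_vec_imp_vec[OF D]
  have P: "discrete_vec ?P" by (rule discrete_vec_cotensor_space[OF C L M])
  then have Q: "discrete_vec ?Q" unfolding discrete_vec_cong[OF tvs] .
  have vQ: "vec ?Q" by (rule discrete_vec_imp_vec[OF Q])
  have PLM: "t \<in> carr (L \<otimes> M)" if "t \<in> carr ?P" for t
    using that unfolding carr_cotensor_space_iff[OF C L M] by blast
  have carrQ: "carr ?Q = carr ?P" by (simp only: tvs)
  note iffQ = HomCC_iff[OF D N Q coact(1)] and iffM = HomCC_iff[OF D N R(1,3)]
  have N': "vec N" and cN: "contra N \<in> hom_set (Homk D N) N" using N by (auto simp: contra_space_def)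
  have \<theta>N: "contra N \<phi> \<in> carr N" for \<phi> by (rule hom_set_carr[OF N' cN])
  have hom: "\<gamma> \<in> hom_set N ?Q \<longleftrightarrow> \<gamma> \<in> hom_set N (L \<otimes> M) \<and> (\<forall>n\<in>carr N. \<gamma> n \<in> carr ?P)"
  proof
    assume \<gamma>: "\<gamma> \<in> hom_set N ?Q"
    have "lin_on N (L \<otimes> M) \<gamma>"
      using lin_on_comp[OF lin_imp_lin_on[OF hom_set_lin[OF \<gamma>[unfolded hom_set_cong_ran[OF tvs]]]]
          lin_on_cotensor_inclusion] .
    then have "lin N (L \<otimes> M) \<gamma>" using hom_set_zero_outside[OF \<gamma>] by (simp add: lin_iff)
    moreover have "continuous_map (tp N) (discrete_topology (carr (L \<otimes> M))) \<gamma>"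
      by (rule continuous_map_discrete_factor[where J = "{\<gamma>}" and g = "\<lambda>j. j" and S = "\<lambda>_. carr ?Q"])
        (use continuous_map_into_discrete_vec[OF Q \<gamma>] hom_set_carr[OF vQ \<gamma>] carrQ PLM in auto)
    ultimately show "\<gamma> \<in> hom_set N (L \<otimes> M) \<and> (\<forall>n\<in>carr N. \<gamma> n \<in> carr ?P)"
      using hom_setI_discrete[OF discrete_vec_tensor] hom_set_carr[OF vQ \<gamma>] carrQ by blast
  next
    assume \<gamma>: "\<gamma> \<in> hom_set N (L \<otimes> M) \<and> (\<forall>n\<in>carr N. \<gamma> n \<in> carr ?P)"
    then have "lin N ?Q \<gamma>"
      using hom_set_lin[of \<gamma> N "L \<otimes> M"] unfolding lin_iff lin_on_def carrQ tvs sc_cotensor_space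
      by blast
    moreover have "continuous_map (tp N) (discrete_topology (carr ?Q)) \<gamma>"
      by (rule continuous_map_discrete_factor[where J = "{\<gamma>}" and g = "\<lambda>j. j" and S = "\<lambda>_. carr (L \<otimes> M)"])
        (use continuous_map_into_discrete_vec[OF discrete_vec_tensor, of \<gamma> N L M] \<gamma> carrQ in auto)
    ultimately show "\<gamma> \<in> hom_set N ?Q" by (rule hom_setI_discrete[OF Q])
  qed
  show ?thesis
  proof (cases "\<gamma> \<in> hom_set N (L \<otimes> M)")
    case \<gamma>: True
    note \<gamma>c = hom_set_carr[OF vec_tensor \<gamma>]
    have l0: "lapply L M \<nu> 0 = 0" if "lin L fld \<nu>" for \<nu>
      by (rule lin_on_zero[OF vec_tensor lin_on_lapply[OF R(2) lin_imp_lin_on[OF that]]])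
    have lh: "lapply L M \<nu> \<circ> \<gamma> \<in> hom_set N M" if "lin L fld \<nu>" for \<nu>
      by (rule hom_set_comp_discrete[OF discrete_vec_tensor R(2) \<gamma> lin_lapply[OF R(2) lin_imp_lin_on[OF that]]])
    have \<nu>f: "lin L fld (\<nu> \<circ> ract C L f)" if "lin L fld \<nu>" "lin C fld f" for \<nu> f
      by (rule lin_comp[OF L'(2) lin_ract[OF L that(2)] that(1)])
    have land: "(\<forall>n\<in>carr N. \<gamma> n \<in> carr ?P) \<longleftrightarrow> (\<forall>\<nu> f. lin L fld \<nu> \<longrightarrow> lin C fld f \<longrightarrow>
         lapply L M (\<nu> \<circ> ract C L f) \<circ> \<gamma> = lact C M f \<circ> (lapply L M \<nu> \<circ> \<gamma>))" (is "?l \<longleftrightarrow> ?r")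
    proof
      assume ?r
      then show ?l unfolding carr_cotensor_space_iff[OF C L M] using \<gamma>c by (auto simp: fun_eq_iff)
    next
      assume l: ?l
      have "(lapply L M (\<nu> \<circ> ract C L f) \<circ> \<gamma>) n = (lact C M f \<circ> (lapply L M \<nu> \<circ> \<gamma>)) n"
        if \<nu>: "lin L fld \<nu>" and f: "lin C fld f" for \<nu> f n
      proof (cases "n \<in> carr N")
        case True
        then show ?thesis using l \<nu> f unfolding carr_cotensor_space_iff[OF C L M] by simp
      next
        case False
        then show ?thesis
          using hom_set_zero_outside[OF \<gamma> False] l0[OF \<nu>] l0[OF \<nu>f[OF \<nu> f]]
            lin_on_zero[OF R(2) lin_imp_lin_on[OF lin_lact[OF M f]]] by simp
      qed
      then show ?r by blast
    qed
    have eq: "(\<forall>n\<in>carr N. \<forall>\<xi>. lin D fld \<xi> \<longrightarrow>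
          rapply ?Q D \<xi> (rcoact ?Q (\<gamma> n)) = \<gamma> (contra N (\<lambda>e. sc N (\<xi> e) n)))
        \<longleftrightarrow> (\<forall>\<nu>. lin L fld \<nu> \<longrightarrow> lapply L M \<nu> \<circ> \<gamma> \<in> carr (HomCC D N M))" (is "?l \<longleftrightarrow> ?r")
      if P\<gamma>: "\<forall>n\<in>carr N. \<gamma> n \<in> carr ?P"
    proof -
      have sl: "lapply L M \<nu> (rapply ?Q D \<xi> (rcoact ?Q (\<gamma> n))) = rapply M D \<xi> (rcoact M (lapply L M \<nu> (\<gamma> n)))"
        if "n \<in> carr N" "lin L fld \<nu>" "lin D fld \<xi>" for n \<nu> \<xi>
        using coact(2)[OF _ that(2,3)] P\<gamma> that(1) by (simp add: ract_def)
      have c: "rapply ?Q D \<xi> (rcoact ?Q (\<gamma> n)) \<in> carr (L \<otimes> M)" if "n \<in> carr N" "lin D fld \<xi>" for n \<xi>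
        using lin_on_carr[OF lin_on_rapply[OF vQ lin_imp_lin_on[OF that(2)]]
            lin_on_carr[OF lin_imp_lin_on[OF coact(1)]]] P\<gamma> that(1) carrQ PLM by blast
      show ?thesis
      proof
        assume l: ?l
        show ?r unfolding iffM using lh l by (simp flip: sl)
      next
        assume r: ?r
        show ?l
        proof (intro ballI allI impI)
          fix n \<xi> assume n: "n \<in> carr N" and \<xi>: "lin D fld \<xi>"
          show "rapply ?Q D \<xi> (rcoact ?Q (\<gamma> n)) = \<gamma> (contra N (\<lambda>e. sc N (\<xi> e) n))"
            by (rule lapply_separates[OF L'(2) R(2) c[OF n \<xi>] \<gamma>c])
              (use r n \<xi> in \<open>simp add: sl iffM\<close>)
        qed
      qed
    qed
    show ?thesis unfolding iffQ hom using \<gamma> land eq by blast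
  next
    case False
    then show ?thesis unfolding iffQ hom by blast
  qed
qed

text \<open>The contraaction of \<open>X\<^sup>*\<close> on \<open>c \<mapsto> f(c) n\<close> is \<open>n\<close> composed with the action of \<open>f\<close> on \<open>X\<close>.\<close>

lemma HomCC_hfun_iff:
  fixes C :: "('k::field, 'c::ab_group_add, 'x) coalg_scheme"
    and D :: "('k, 'd::ab_group_add, 'w) coalg_scheme"
    and M :: "('k, 'c, 'd, 'm::ab_group_add, 'z) bicomod_scheme"
    and N :: "('k, 'd, 'n::ab_group_add, 'u) contramod_scheme"
  assumes C: "discrete_vec C" and D: "discrete_vec D" and L: "right_comodule C L"
    and M: "bicomodule C D M" and N: "contramodule D N"
  shows "\<beta> \<in> carr (HomCC C (hfun C D M N) L) \<longleftrightarrow> \<beta> \<in> hom_set (dual (HomCC D N M)) L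
    \<and> (\<forall>n f. lin (HomCC D N M) fld n \<longrightarrow> lin C fld f \<longrightarrow>
        ract C L f (\<beta> n) = \<beta> (\<lambda>x. if x \<in> carr (HomCC D N M) then n (lact C M f \<circ> x) else 0))"
proof -
  let ?X = "HomCC D N M" and ?\<rho> = "HomCC_coact C D M N" and ?T = "hfun C D M N"
  have X: "discrete_vec ?X"
    by (rule bicomodule_discrete_vec_HomCC[OF M D contramodule_contra_space[OF N]])
  note X' = discrete_vec_imp_vec[OF X] and C' = discrete_vec_imp_vec[OF C]
  note \<rho> = HomCC_coact[OF C D M N] and L' = right_comoduleD[OF L]
  have T: "contra_space C ?T"
    unfolding hfun_def by (rule dual_contramodule_contra_space[OF C X \<rho>(1)])
  have tvs: "tp ?T = tp (dual ?X)" "sc ?T = sc (dual ?X)"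
    by (simp_all add: hfun_def dual_contramodule_def)
  have carrT: "carr ?T = {n. lin ?X fld n}" by (simp add: tvs hom_set_discrete[OF X])
  have hT: "hom_set ?T L = hom_set (dual ?X) L"
    by (simp add: hom_set_def tvs lin_def)
  have act: "contra ?T (\<lambda>c. sc ?T (f c) n) = (\<lambda>x. if x \<in> carr ?X then n (lact C M f \<circ> x) else 0)"
    if n: "lin ?X fld n" and f: "lin C fld f" for n f
  proof -
    have nd: "n \<in> carr (dual ?X)" using n by (simp add: hom_set_discrete[OF X])
    have l: "lin C (dual ?X) (\<lambda>c. sc (dual ?X) (f c) n)"
      by (rule lin_scalar_multiples[OF vec_Homk_discrete[OF X vec_fld] f nd])
    have "contra ?T (\<lambda>c. sc ?T (f c) n) = psi C ?X fld (\<lambda>c. sc (dual ?X) (f c) n) \<circ> ?\<rho>"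
      unfolding tvs using l by (simp add: hfun_def dual_contramodule_def hom_set_discrete[OF C])
    also have "\<dots> = (\<lambda>x. if x \<in> carr ?X then n (lact C M f \<circ> x) else 0)"
    proof
      fix x
      show "(psi C ?X fld (\<lambda>c. sc (dual ?X) (f c) n) \<circ> ?\<rho>) x
          = (if x \<in> carr ?X then n (lact C M f \<circ> x) else 0)"
      proof (cases "x \<in> carr ?X")
        case True
        then show ?thesis
          using psi_slice[OF C X f n lin_on_carr[OF lin_imp_lin_on[OF \<rho>(1)] True]] \<rho>(2)[OF f True]
          by simp
      next
        case False
        have "psi C ?X fld (\<lambda>c. sc (dual ?X) (f c) n) 0 = n (lapply C ?X f 0)"
          by (rule psi_slice[OF C X f n vec_zero[OF vec_tensor]])
        also have "\<dots> = 0"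
          by (simp only: lin_on_zero[OF vec_tensor lin_on_lapply[OF X' lin_imp_lin_on[OF f]]]
              lin_on_zero[OF X' lin_imp_lin_on[OF n]])
        finally show ?thesis using lin_outside[OF \<rho>(1) False] False by simp
      qed
    qed
    finally show ?thesis .
  qed
  show ?thesis
    unfolding HomCC_iff[OF C T L'(1,3)] hT carrT using act by (auto simp: ract_def)
qed

section \<open>The transposition\<close>

text \<open>The two maps encode the same linear map \<open>\<nu> \<mapsto> \<gamma>\<^sub>\<nu>\<close> from \<open>L\<^sup>*\<close> to \<open>X = Hom\<^sub>D(N, M)\<close>: composed with
  \<open>X \<rightarrow> X\<^sup>*\<^sup>*\<close> it is the transpose of \<open>\<beta> : X\<^sup>* \<rightarrow> L\<close>.\<close>

definition transposes :: "('k::field, 'd::ab_group_add, 'w) coalg_scheme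
    \<Rightarrow> ('k, 'c::ab_group_add, 'l::ab_group_add, 'y) rcomod_scheme
    \<Rightarrow> ('k, 'c, 'd, 'm::ab_group_add, 'z) bicomod_scheme
    \<Rightarrow> ('k, 'd, 'n::ab_group_add, 'u) contramod_scheme
    \<Rightarrow> ('n \<Rightarrow> ('k, 'l, 'm) tensor) \<Rightarrow> ((('n \<Rightarrow> 'm) \<Rightarrow> 'k) \<Rightarrow> 'l) \<Rightarrow> bool" where
  "transposes D L M N \<gamma> \<beta> \<longleftrightarrow> (\<forall>\<nu> n. lin L fld \<nu> \<longrightarrow> lin (HomCC D N M) fld n \<longrightarrow>
     \<nu> (\<beta> n) = n (lapply L M \<nu> \<circ> \<gamma>))"

lemma transposesD: "transposes D L M N \<gamma> \<beta> \<Longrightarrow> lin L fld \<nu> \<Longrightarrow> lin (HomCC D N M) fld n \<Longrightarrow>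
    \<nu> (\<beta> n) = n (lapply L M \<nu> \<circ> \<gamma>)"
  by (simp add: transposes_def)

locale cotensor_hom =
  fixes C :: "('k::field, 'c::ab_group_add) coalg" and D :: "('k, 'd::ab_group_add) coalg"
    and L :: "('k, 'c, 'l::ab_group_add) rcomod" and M :: "('k, 'c, 'd, 'm::ab_group_add) bicomod"
    and N :: "('k, 'd, 'n::ab_group_add) contramod"
  assumes C: "discrete_vec C" and D: "discrete_vec D" and L: "right_comodule C L"
    and M: "bicomodule C D M" and N: "contramodule D N"
begin

abbreviation X where "X \<equiv> HomCC D N M"

lemmas C' = discrete_vec_imp_vec[OF C] and D' = discrete_vec_imp_vec[OF D]
lemmas L' = right_comoduleD[OF L] and M' = right_comoduleD[OF bicomoduleD(1)[OF M]]
lemmas cN = contramodule_contra_space[OF N]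

lemma N': "vec N" "pseudocompact N"
  using cN N by (auto simp: contra_space_def contramodule_def)

lemma discrete_vec_X: "discrete_vec X"
  by (rule bicomodule_discrete_vec_HomCC[OF M D cN])

lemmas X' = discrete_vec_imp_vec[OF discrete_vec_X]

lemma X_hom: "x \<in> carr X \<Longrightarrow> x \<in> hom_set N M"
  by (simp add: carr_HomCC)

lemma lin_conv: "lin L fld \<nu> \<Longrightarrow> lin C fld f \<Longrightarrow> lin L fld (\<nu> \<circ> ract C L f)"
  by (rule lin_comp[OF L'(2) lin_ract[OF L]])

lemmas lact_X = lact_comp_HomCC[OF M C' D cN]

lemma lin_lact_transpose:
  assumes n: "lin X fld n" and f: "lin C fld f"
  shows "lin X fld (\<lambda>x. if x \<in> carr X then n (lact C M f \<circ> x) else 0)"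
proof -
  note lf = lin_imp_lin_on[OF lin_lact[OF M f]]
  have "lin_on X X (\<lambda>x. lact C M f \<circ> x)"
    unfolding lin_on_def using lact_X[OF _ f] hom_set_carr[OF M'(2) X_hom]
    by (auto simp: fun_eq_iff sc_HomCC lin_on_add[OF lf] lin_on_scale[OF lf])
  from lin_on_comp[OF this lin_imp_lin_on[OF n]] show ?thesis
    unfolding lin_iff lin_on_def using vec_add[OF X'] vec_scale[OF X'] by simp
qed

text \<open>Applying functionals to the two equivariance conditions gives the same equation
  \<open>\<gamma>\<^bsub>\<nu> * f\<^esub> = f \<gamma>\<^sub>\<nu>\<close> in \<open>X\<close>.\<close>

lemma transposes_equivariant_iff:
  assumes \<beta>: "\<beta> \<in> hom_set (dual X) L" and \<gamma>\<beta>: "transposes D L M N \<gamma> \<beta>"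
    and sl: "\<And>\<nu>. lin L fld \<nu> \<Longrightarrow> lapply L M \<nu> \<circ> \<gamma> \<in> carr X"
  shows "(\<forall>\<nu> f. lin L fld \<nu> \<longrightarrow> lin C fld f \<longrightarrow>
         lapply L M (\<nu> \<circ> ract C L f) \<circ> \<gamma> = lact C M f \<circ> (lapply L M \<nu> \<circ> \<gamma>))
    \<longleftrightarrow> (\<forall>n f. lin X fld n \<longrightarrow> lin C fld f \<longrightarrow>
        ract C L f (\<beta> n) = \<beta> (\<lambda>x. if x \<in> carr X then n (lact C M f \<circ> x) else 0))" (is "?l \<longleftrightarrow> ?r")
proof -
  have \<beta>c: "\<beta> n \<in> carr L" for n by (rule hom_set_carr[OF L'(2) \<beta>])
  have 1: "\<nu> (ract C L f (\<beta> n)) = n (lapply L M (\<nu> \<circ> ract C L f) \<circ> \<gamma>)"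
    and 2: "\<nu> (\<beta> (\<lambda>x. if x \<in> carr X then n (lact C M f \<circ> x) else 0))
      = n (lact C M f \<circ> (lapply L M \<nu> \<circ> \<gamma>))"
    if \<nu>: "lin L fld \<nu>" and f: "lin C fld f" and n: "lin X fld n" for \<nu> f n
    using transposesD[OF \<gamma>\<beta> lin_conv[OF \<nu> f] n]
      transposesD[OF \<gamma>\<beta> \<nu> lin_lact_transpose[OF n f]] sl[OF \<nu>] by simp_all
  show ?thesis
  proof
    assume l: ?l
    show ?r
    proof (intro allI impI)
      fix n f assume n: "lin X fld n" and f: "lin C fld f"
      show "ract C L f (\<beta> n) = \<beta> (\<lambda>x. if x \<in> carr X then n (lact C M f \<circ> x) else 0)"
        by (rule functionals_separate[OF L'(2) lin_on_carr[OF lin_imp_lin_on[OF lin_ract[OF L f]] \<beta>c] \<beta>c])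
          (use l 1[OF _ f n] 2[OF _ f n] f in simp)
    qed
  next
    assume r: ?r
    show ?l
    proof (intro allI impI)
      fix \<nu> f assume \<nu>: "lin L fld \<nu>" and f: "lin C fld f"
      show "lapply L M (\<nu> \<circ> ract C L f) \<circ> \<gamma> = lact C M f \<circ> (lapply L M \<nu> \<circ> \<gamma>)"
      proof (rule functionals_separate[OF X' sl[OF lin_conv[OF \<nu> f]] lact_X[OF sl[OF \<nu>] f]])
        fix n :: "('n \<Rightarrow> 'm) \<Rightarrow> 'k" assume n: "lin X fld n"
        have "ract C L f (\<beta> n) = \<beta> (\<lambda>x. if x \<in> carr X then n (lact C M f \<circ> x) else 0)"
          using r n f by blast
        then show "n (lapply L M (\<nu> \<circ> ract C L f) \<circ> \<gamma>) = n (lact C M f \<circ> (lapply L M \<nu> \<circ> \<gamma>))"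
          using 1[OF \<nu> f n] 2[OF \<nu> f n] by simp
      qed
    qed
  qed
qed

lemma transposes_unique_right:
  assumes "\<beta> \<in> hom_set (dual X) L" "\<beta>' \<in> hom_set (dual X) L"
    and "transposes D L M N \<gamma> \<beta>" "transposes D L M N \<gamma> \<beta>'"
  shows "\<beta> = \<beta>'"
proof (rule lin_cancel_outside[OF hom_set_lin[OF assms(1)] hom_set_lin[OF assms(2)]])
  fix n assume "n \<in> carr (dual X)"
  then have n: "lin X fld n" by (simp add: hom_set_lin)
  show "\<beta> n = \<beta>' n"
    by (rule functionals_separate[OF L'(2) hom_set_carr[OF L'(2) assms(1)] hom_set_carr[OF L'(2) assms(2)]])
      (simp add: transposesD[OF assms(3) _ n] transposesD[OF assms(4) _ n])
qed

lemma transposes_unique_left: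
  assumes \<gamma>: "\<gamma> \<in> hom_set N (L \<otimes> M)" "\<gamma>' \<in> hom_set N (L \<otimes> M)"
    and sl: "\<And>\<nu>. lin L fld \<nu> \<Longrightarrow> lapply L M \<nu> \<circ> \<gamma> \<in> carr X"
      "\<And>\<nu>. lin L fld \<nu> \<Longrightarrow> lapply L M \<nu> \<circ> \<gamma>' \<in> carr X"
    and t: "transposes D L M N \<gamma> \<beta>" "transposes D L M N \<gamma>' \<beta>"
  shows "\<gamma> = \<gamma>'"
proof
  fix p
  show "\<gamma> p = \<gamma>' p"
  proof (rule lapply_separates[OF L'(2) M'(2) hom_set_carr[OF vec_tensor \<gamma>(1)] hom_set_carr[OF vec_tensor \<gamma>(2)]])
    fix \<nu> :: "'l \<Rightarrow> 'k" assume \<nu>: "lin L fld \<nu>"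
    have "lapply L M \<nu> \<circ> \<gamma> = lapply L M \<nu> \<circ> \<gamma>'"
      by (rule functionals_separate[OF X' sl(1)[OF \<nu>] sl(2)[OF \<nu>]])
        (metis transposesD[OF t(1) \<nu>] transposesD[OF t(2) \<nu>])
    then show "lapply L M \<nu> (\<gamma> p) = lapply L M \<nu> (\<gamma>' p)" by (metis comp_apply)
  qed
qed

text \<open>With a dual family \<open>e\<^sub>b\<close> for a finite set that supports \<open>\<gamma>\<close>, take \<open>\<beta>(n) = \<Sum>\<^sub>b n(\<gamma>\<^bsub>e\<^sub>b\<^esub>) b\<close>.\<close>

lemma transpose_exists_right:
  assumes \<gamma>: "\<gamma> \<in> hom_set N (L \<otimes> M)" and sl: "\<And>\<nu>. lin L fld \<nu> \<Longrightarrow> lapply L M \<nu> \<circ> \<gamma> \<in> carr X"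
  shows "\<exists>\<beta>\<in>hom_set (dual X) L. transposes D L M N \<gamma> \<beta>"
proof (rule pseudocompact_lapply_support[OF N'(2) L'(2) M'(2) \<gamma>])
  fix K assume K: "finite K" "K \<subseteq> carr L" "\<And>\<nu> n. lin L fld \<nu> \<Longrightarrow> (\<And>u. u \<in> K \<Longrightarrow> \<nu> u = 0) \<Longrightarrow>
    n \<in> carr N \<Longrightarrow> lapply L M \<nu> (\<gamma> n) = 0"
  obtain B and e :: "'l \<Rightarrow> 'l \<Rightarrow> 'k" where B: "dual_family L K B e"
    using dual_family_exists[OF L'(2) K(1,2)] by blast
  note BD = dual_familyD[OF B]
  define x where "x b = lapply L M (e b) \<circ> \<gamma>" for b
  have x: "x b \<in> carr X" if "b \<in> B" for b unfolding x_def by (rule sl[OF BD(3)[OF that]])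
  have van: "lapply L M \<nu> \<circ> \<gamma> = 0" if \<nu>: "lin L fld \<nu>" "\<And>u. u \<in> K \<Longrightarrow> \<nu> u = 0" for \<nu>
  proof
    show "(lapply L M \<nu> \<circ> \<gamma>) n = 0 n" for n
      using K(3)[OF \<nu>, of n] hom_set_zero_outside[OF X_hom[OF sl[OF \<nu>(1)]], of n]
      by (cases "n \<in> carr N") auto
  qed
  have G: "lin_on (dual L) X (\<lambda>\<nu>. lapply L M \<nu> \<circ> \<gamma>)"
    using sl lin_on_lapply_functional[OF L'(1) M'(2) hom_set_carr[OF vec_tensor \<gamma>]]
    unfolding lin_on_def carr_Homk hom_set_discrete[OF L'(1)]
    by (simp add: fun_eq_iff sc_HomCC del: plus_fun_apply) (simp add: plus_fun_def)
  have exp: "lapply L M \<nu> \<circ> \<gamma> = (\<Sum>b\<in>B. sc X (\<nu> b) (x b))" if "lin L fld \<nu>" for \<nu>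
    using dual_expansion[OF L'(1) X' G van B that] by (simp add: x_def)
  define \<beta> where "\<beta> n = (if lin X fld n then \<Sum>b\<in>B. sc L (n (x b)) b else 0)" for n
  have cd: "carr (dual X) = {n. lin X fld n}" by (simp add: hom_set_discrete[OF discrete_vec_X])
  have \<beta>c: "\<beta> n \<in> carr L" for n
    using BD(2) by (auto simp: \<beta>_def vec_zero[OF L'(2)] intro!: vec_sum[OF L'(2)] vec_scale[OF L'(2)])
  have "lin (dual X) L \<beta>"
    unfolding lin_iff lin_on_def
  proof (intro conjI ballI allI impI \<beta>c)
    have dX: "vec (dual X)" by (rule vec_Homk_discrete[OF discrete_vec_X vec_fld])
    show "\<beta> (n + n') = \<beta> n + \<beta> n'" if "n \<in> carr (dual X)" "n' \<in> carr (dual X)" for n n'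
      using that vec_add[OF dX that] unfolding cd
      by (simp add: \<beta>_def sc_add_left[OF L'(2)] sum.distrib)
    show "\<beta> (sc (dual X) c n) = sc L c (\<beta> n)" if "n \<in> carr (dual X)" for c n
      using that vec_scale[OF dX that, of c] unfolding cd
      by (simp add: \<beta>_def sc_Homk sc_sum_right[OF L'(2)] sc_sc[OF L'(2)])
    show "\<beta> n = 0" if "n \<notin> carr (dual X)" for n using that unfolding cd by (simp add: \<beta>_def)
  qed
  moreover have "continuous_map (tp (dual X)) (discrete_topology (carr L)) \<beta>"
  proof (rule continuous_map_discrete_factor[OF BD(1), where g = "\<lambda>b n. n (x b)"])
    show "continuous_map (tp (dual X)) (discrete_topology UNIV) (\<lambda>n. n (x b))" if "b \<in> B" for b
      using continuous_map_evaluation[OF x[OF that], of fld] by (simp add: tp_fld)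
    show "\<beta> \<in> carr (dual X) \<rightarrow> carr L" using \<beta>c by blast
    show "\<beta> m = \<beta> n" if "n \<in> carr (dual X)" "m \<in> carr (dual X)" "\<And>b. b \<in> B \<Longrightarrow> m (x b) = n (x b)" for n m
      using that unfolding cd by (simp add: \<beta>_def cong: sum.cong)
  qed
  ultimately have \<beta>: "\<beta> \<in> hom_set (dual X) L" by (rule hom_setI_discrete[OF L'(1)])
  have "\<nu> (\<beta> n) = n (lapply L M \<nu> \<circ> \<gamma>)" if \<nu>: "lin L fld \<nu>" and n: "lin X fld n" for \<nu> n
  proof -
    note \<nu>' = lin_imp_lin_on[OF \<nu>] and n' = lin_imp_lin_on[OF n]
    have "\<nu> (\<beta> n) = (\<Sum>b\<in>B. \<nu> (sc L (n (x b)) b))"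
      using n BD(2) by (simp add: \<beta>_def lin_on_sum[OF L'(2) \<nu>'] vec_scale[OF L'(2)])
    also have "\<dots> = (\<Sum>b\<in>B. n (sc X (\<nu> b) (x b)))"
      by (intro sum.cong refl) (simp add: lin_on_scale[OF \<nu>' BD(2)] lin_on_scale[OF n' x] mult.commute)
    also have "\<dots> = n (lapply L M \<nu> \<circ> \<gamma>)"
      unfolding exp[OF \<nu>] by (rule lin_on_sum[OF X' n', symmetric]) (rule vec_scale[OF X' x])
    finally show ?thesis .
  qed
  then show ?thesis using \<beta> by (auto simp: transposes_def)
qed

text \<open>With a dual family \<open>e\<^sub>b\<close> for a finite set that supports \<open>\<beta>\<close>, take \<open>\<gamma>(p) = \<Sum>\<^sub>b \<beta>(e\<^sub>b) \<otimes> b(p)\<close>.\<close>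

lemma transpose_exists_left:
  assumes \<beta>: "\<beta> \<in> hom_set (dual X) L"
  shows "\<exists>\<gamma>\<in>hom_set N (L \<otimes> M). (\<forall>\<nu>. lin L fld \<nu> \<longrightarrow> lapply L M \<nu> \<circ> \<gamma> \<in> carr X)
    \<and> transposes D L M N \<gamma> \<beta>"
proof (rule hom_set_finite_support[OF discrete_vec_X vec_fld L'(1) \<beta>])
  fix K assume K: "finite K" "K \<subseteq> carr X"
    "\<And>n. n \<in> hom_set X fld \<Longrightarrow> (\<And>x. x \<in> K \<Longrightarrow> n x = 0) \<Longrightarrow> \<beta> n = 0"
  obtain B and e :: "('n \<Rightarrow> 'm) \<Rightarrow> ('n \<Rightarrow> 'm) \<Rightarrow> 'k" where B: "dual_family X K B e"
    using dual_family_exists[OF X' K(1,2)] by blast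
  note BD = dual_familyD[OF B]
  define y where "y b = \<beta> (e b)" for b
  have y: "y b \<in> carr L" for b unfolding y_def by (rule hom_set_carr[OF L'(2) \<beta>])
  have exp: "\<beta> n = (\<Sum>b\<in>B. sc L (n b) (y b))" if "lin X fld n" for n
    using dual_expansion[OF discrete_vec_X L'(2) lin_imp_lin_on[OF hom_set_lin[OF \<beta>]] K(3) B that]
    by (simp add: y_def hom_set_discrete[OF discrete_vec_X])
  define \<gamma> where "\<gamma> p = (if p \<in> carr N then \<Sum>b\<in>B. pure L M (y b) (b p) else 0)" for p
  have bh: "b \<in> hom_set N M" if "b \<in> B" for b by (rule X_hom[OF BD(2)[OF that]])
  note bc = hom_set_carr[OF M'(2) bh]
  have pc: "pure L M (y b) (b p) \<in> carr (L \<otimes> M)" if "b \<in> B" for b p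
    by (rule pure_carr[OF y bc[OF that]])
  have \<gamma>c: "\<gamma> p \<in> carr (L \<otimes> M)" for p
  proof -
    have "(\<Sum>b\<in>B. pure L M (y b) (b p)) \<in> carr (L \<otimes> M)" by (rule vec_sum[OF vec_tensor pc])
    then show ?thesis using vec_zero[OF vec_tensor, of L M] by (simp add: \<gamma>_def)
  qed
  have slice: "lapply L M \<nu> \<circ> \<gamma> = (\<Sum>b\<in>B. sc X (\<nu> (y b)) b)" if \<nu>: "lin L fld \<nu>" for \<nu>
  proof
    note l = lin_on_lapply[OF M'(2) lin_imp_lin_on[OF \<nu>]]
    fix p
    show "(lapply L M \<nu> \<circ> \<gamma>) p = (\<Sum>b\<in>B. sc X (\<nu> (y b)) b) p"
    proof (cases "p \<in> carr N")
      case True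
      have "lapply L M \<nu> (\<gamma> p) = (\<Sum>b\<in>B. lapply L M \<nu> (pure L M (y b) (b p)))"
        unfolding \<gamma>_def if_P[OF True] by (rule lin_on_sum[OF vec_tensor l pc])
      also have "\<dots> = (\<Sum>b\<in>B. sc M (\<nu> (y b)) (b p))"
        by (intro sum.cong refl lapply_pure[OF M'(2) lin_imp_lin_on[OF \<nu>] y bc])
      finally show ?thesis by (simp add: sum_fun_apply sc_HomCC)
    next
      case False
      have "sc M (\<nu> (y b)) (b p) = 0" if "b \<in> B" for b
        unfolding hom_set_zero_outside[OF bh[OF that] False] by (rule sc_zero_right[OF M'(2)])
      moreover have "lapply L M \<nu> (\<gamma> p) = 0"
        using False lin_on_zero[OF vec_tensor l] by (simp only: \<gamma>_def if_False)
      ultimately show ?thesis by (simp add: sum_fun_apply sc_HomCC)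
    qed
  qed
  have sl: "lapply L M \<nu> \<circ> \<gamma> \<in> carr X" if "lin L fld \<nu>" for \<nu>
    unfolding slice[OF that] by (intro vec_sum[OF X'] vec_scale[OF X'] BD(2))
  have "lin_on N (L \<otimes> M) \<gamma>"
  proof (rule lin_on_from_lapply[OF N'(1) L'(2) M'(2) \<gamma>c])
    fix \<nu> :: "'l \<Rightarrow> 'k" assume "lin L fld \<nu>"
    from lin_imp_lin_on[OF hom_set_lin[OF X_hom[OF sl[OF this]]]]
    show "lin_on N M (\<lambda>p. lapply L M \<nu> (\<gamma> p))" by (simp add: comp_def)
  qed
  then have "lin N (L \<otimes> M) \<gamma>" by (simp add: lin_iff \<gamma>_def)
  moreover have "continuous_map (tp N) (discrete_topology (carr (L \<otimes> M))) \<gamma>"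
  proof (rule continuous_map_discrete_factor[OF BD(1), where g = "\<lambda>b. b"])
    show "continuous_map (tp N) (discrete_topology (carr M)) b" if "b \<in> B" for b
      by (rule continuous_map_into_discrete_vec[OF M'(1) bh[OF that]])
    show "\<gamma> \<in> carr N \<rightarrow> carr (L \<otimes> M)" using \<gamma>c by blast
    show "\<gamma> q = \<gamma> p" if "p \<in> carr N" "q \<in> carr N" "\<And>b. b \<in> B \<Longrightarrow> b q = b p" for p q
      unfolding \<gamma>_def if_P[OF that(1)] if_P[OF that(2)]
      by (intro sum.cong refl arg_cong[of _ _ "pure L M _"] that(3))
  qed
  ultimately have \<gamma>: "\<gamma> \<in> hom_set N (L \<otimes> M)" by (rule hom_setI_discrete[OF discrete_vec_tensor])
  have "\<nu> (\<beta> n) = n (lapply L M \<nu> \<circ> \<gamma>)" if \<nu>: "lin L fld \<nu>" and n: "lin X fld n" for \<nu> n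
  proof -
    note \<nu>' = lin_imp_lin_on[OF \<nu>] and n' = lin_imp_lin_on[OF n]
    have "n (lapply L M \<nu> \<circ> \<gamma>) = (\<Sum>b\<in>B. n (sc X (\<nu> (y b)) b))"
      unfolding slice[OF \<nu>] by (rule lin_on_sum[OF X' n']) (rule vec_scale[OF X' BD(2)])
    also have "\<dots> = (\<Sum>b\<in>B. \<nu> (sc L (n b) (y b)))"
      by (intro sum.cong refl) (simp add: lin_on_scale[OF \<nu>' y] lin_on_scale[OF n' BD(2)] mult.commute)
    also have "\<dots> = \<nu> (\<beta> n)"
      unfolding exp[OF n] by (rule lin_on_sum[OF L'(2) \<nu>', symmetric]) (rule vec_scale[OF L'(2) y])
    finally show ?thesis by simp
  qed
  then show ?thesis using \<gamma> sl by (auto simp: transposes_def)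
qed

end

definition cotensor_transpose :: "('k::field, 'c::ab_group_add) coalg \<Rightarrow> ('k, 'd::ab_group_add) coalg
    \<Rightarrow> ('k, 'c, 'l::ab_group_add) rcomod \<Rightarrow> ('k, 'c, 'd, 'm::ab_group_add) bicomod
    \<Rightarrow> ('k, 'd, 'n::ab_group_add) contramod
    \<Rightarrow> ('n \<Rightarrow> ('k, 'l, 'm) tensor) \<Rightarrow> ((('n \<Rightarrow> 'm) \<Rightarrow> 'k) \<Rightarrow> 'l)" where
  "cotensor_transpose C D L M N \<gamma> = (if \<gamma> \<in> carr (HomCC D N (cotensor C D L M))
     then THE \<beta>. \<beta> \<in> hom_set (dual (HomCC D N M)) L \<and> transposes D L M N \<gamma> \<beta> else 0)"

context cotensor_hom
begin

abbreviation Y where "Y \<equiv> HomCC D N (cotensor C D L M)"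
abbreviation Z where "Z \<equiv> HomCC C (hfun C D M N) L"

lemmas Y_iff = HomCC_cotensor_iff[OF C' D L M cN]
lemmas Z_iff = HomCC_hfun_iff[OF C D L M N]

lemma Y_slice: "\<gamma> \<in> carr Y \<Longrightarrow> lin L fld \<nu> \<Longrightarrow> lapply L M \<nu> \<circ> \<gamma> \<in> carr X"
  by (simp add: Y_iff)

lemma cotensor_transpose:
  assumes \<gamma>: "\<gamma> \<in> carr Y"
  shows cotensor_transpose_hom: "cotensor_transpose C D L M N \<gamma> \<in> hom_set (dual X) L"
    and cotensor_transpose_transposes: "transposes D L M N \<gamma> (cotensor_transpose C D L M N \<gamma>)"
    and cotensor_transpose_carr: "cotensor_transpose C D L M N \<gamma> \<in> carr Z"
proof -
  let ?P = "\<lambda>\<beta>. \<beta> \<in> hom_set (dual X) L \<and> transposes D L M N \<gamma> \<beta>"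
  have "\<exists>\<beta>. ?P \<beta>" using transpose_exists_right[of \<gamma>] \<gamma> unfolding Y_iff by blast
  then have "\<exists>!\<beta>. ?P \<beta>" using transposes_unique_right by blast
  from theI'[OF this] have *: "?P (cotensor_transpose C D L M N \<gamma>)" using \<gamma> by (simp add: cotensor_transpose_def)
  then show "cotensor_transpose C D L M N \<gamma> \<in> hom_set (dual X) L" "transposes D L M N \<gamma> (cotensor_transpose C D L M N \<gamma>)"
    by blast+
  show "cotensor_transpose C D L M N \<gamma> \<in> carr Z"
    unfolding Z_iff using * transposes_equivariant_iff[of "cotensor_transpose C D L M N \<gamma>" \<gamma>] \<gamma>[unfolded Y_iff]
    by blast
qed

lemma cotensor_transpose_eqI:
  assumes "\<gamma> \<in> carr Y" "\<beta> \<in> hom_set (dual X) L" "transposes D L M N \<gamma> \<beta>"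
  shows "cotensor_transpose C D L M N \<gamma> = \<beta>"
  by (rule transposes_unique_right[OF cotensor_transpose_hom[OF assms(1)] assms(2) cotensor_transpose_transposes[OF assms(1)] assms(3)])

lemma discrete_vec_Y: "discrete_vec Y"
proof -
  have "discrete_vec (cotensor C D L M)"
    using discrete_vec_cotensor_space[OF C' L M] unfolding discrete_vec_cong[OF cotensor_tvs] .
  then show ?thesis by (rule discrete_vec_HomCC[OF D cN _ lin_cotensor_rcoact[OF C' D L M]])
qed

lemma lin_cotensor_transpose: "lin Y Z (cotensor_transpose C D L M N)"
  unfolding lin_iff lin_on_def
proof (intro conjI ballI allI impI)
  note vY = discrete_vec_imp_vec[OF discrete_vec_Y]
  have vH: "vec (Homk (dual X) L)" by (rule vec_Homk_to_discrete[OF L'(1)])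
  show "cotensor_transpose C D L M N \<gamma> \<in> carr Z" if "\<gamma> \<in> carr Y" for \<gamma> by (rule cotensor_transpose_carr[OF that])
  show "cotensor_transpose C D L M N \<gamma> = 0" if "\<gamma> \<notin> carr Y" for \<gamma> using that by (simp add: cotensor_transpose_def)
  have \<gamma>c: "\<gamma> p \<in> carr (L \<otimes> M)" if "\<gamma> \<in> carr Y" for \<gamma> p
    using that hom_set_carr[OF vec_tensor, of \<gamma> N L M] by (simp add: Y_iff)
  show "cotensor_transpose C D L M N (\<gamma> + \<gamma>') = cotensor_transpose C D L M N \<gamma> + cotensor_transpose C D L M N \<gamma>'"
    if \<gamma>: "\<gamma> \<in> carr Y" "\<gamma>' \<in> carr Y" for \<gamma> \<gamma>'
  proof (rule cotensor_transpose_eqI[OF vec_add[OF vY \<gamma>]])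
    show "cotensor_transpose C D L M N \<gamma> + cotensor_transpose C D L M N \<gamma>' \<in> hom_set (dual X) L"
      using vec_add[OF vH] cotensor_transpose_hom \<gamma> by simp
    show "transposes D L M N (\<gamma> + \<gamma>') (cotensor_transpose C D L M N \<gamma> + cotensor_transpose C D L M N \<gamma>')"
      unfolding transposes_def
    proof (intro allI impI)
      fix \<nu> n assume \<nu>: "lin L fld \<nu>" and n: "lin X fld n"
      note l = lin_on_lapply[OF M'(2) lin_imp_lin_on[OF \<nu>]]
      have "lapply L M \<nu> \<circ> (\<gamma> + \<gamma>') = (lapply L M \<nu> \<circ> \<gamma>) + (lapply L M \<nu> \<circ> \<gamma>')"
        by (rule ext) (simp add: lin_on_add[OF l \<gamma>c[OF \<gamma>(1)] \<gamma>c[OF \<gamma>(2)]])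
      then show "\<nu> ((cotensor_transpose C D L M N \<gamma> + cotensor_transpose C D L M N \<gamma>') n)
          = n (lapply L M \<nu> \<circ> (\<gamma> + \<gamma>'))"
        by (simp add: lin_on_add[OF lin_imp_lin_on[OF n] Y_slice[OF \<gamma>(1) \<nu>] Y_slice[OF \<gamma>(2) \<nu>]]
            lin_on_add[OF lin_imp_lin_on[OF \<nu>]] hom_set_carr[OF L'(2) cotensor_transpose_hom] \<gamma>
            transposesD[OF cotensor_transpose_transposes \<nu> n])
    qed
  qed
  show "cotensor_transpose C D L M N (sc Y c \<gamma>) = sc Z c (cotensor_transpose C D L M N \<gamma>)"
    if \<gamma>: "\<gamma> \<in> carr Y" for c \<gamma>
  proof (rule cotensor_transpose_eqI[OF vec_scale[OF vY \<gamma>]])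
    show "sc Z c (cotensor_transpose C D L M N \<gamma>) \<in> hom_set (dual X) L"
      using vec_scale[OF vH, of "cotensor_transpose C D L M N \<gamma>" c] cotensor_transpose_hom[OF \<gamma>]
      by (simp add: sc_HomCC sc_Homk)
    show "transposes D L M N (sc Y c \<gamma>) (sc Z c (cotensor_transpose C D L M N \<gamma>))"
      unfolding transposes_def
    proof (intro allI impI)
      fix \<nu> n assume \<nu>: "lin L fld \<nu>" and n: "lin X fld n"
      note l = lin_on_lapply[OF M'(2) lin_imp_lin_on[OF \<nu>]]
      have "lapply L M \<nu> \<circ> sc Y c \<gamma> = sc X c (lapply L M \<nu> \<circ> \<gamma>)"
        by (rule ext) (simp add: sc_HomCC cotensor_tvs sc_cotensor_space lin_on_scale[OF l \<gamma>c[OF \<gamma>]])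
      then show "\<nu> (sc Z c (cotensor_transpose C D L M N \<gamma>) n) = n (lapply L M \<nu> \<circ> sc Y c \<gamma>)"
        using lin_on_scale[OF lin_imp_lin_on[OF n] Y_slice[OF \<gamma> \<nu>], of c]
          lin_on_scale[OF lin_imp_lin_on[OF \<nu>] hom_set_carr[OF L'(2) cotensor_transpose_hom[OF \<gamma>]], of c]
        by (simp add: sc_HomCC[of C "hfun C D M N" L] transposesD[OF cotensor_transpose_transposes[OF \<gamma>] \<nu> n])
    qed
  qed
qed

lemma lin_iso_cotensor_transpose: "lin_iso Y Z (cotensor_transpose C D L M N)"
  unfolding lin_iso_def
proof (intro conjI lin_cotensor_transpose)
  show "bij_betw (cotensor_transpose C D L M N) (carr Y) (carr Z)"
    unfolding bij_betw_def
  proof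
    show "inj_on (cotensor_transpose C D L M N) (carr Y)"
    proof (rule inj_onI)
      fix \<gamma> \<gamma>' assume \<gamma>: "\<gamma> \<in> carr Y" "\<gamma>' \<in> carr Y"
        and eq: "cotensor_transpose C D L M N \<gamma> = cotensor_transpose C D L M N \<gamma>'"
      show "\<gamma> = \<gamma>'"
      proof (rule transposes_unique_left)
        show "\<gamma> \<in> hom_set N (L \<otimes> M)" "\<gamma>' \<in> hom_set N (L \<otimes> M)" using \<gamma> by (simp_all add: Y_iff)
        show "transposes D L M N \<gamma> (cotensor_transpose C D L M N \<gamma>)" by (rule cotensor_transpose_transposes[OF \<gamma>(1)])
        show "transposes D L M N \<gamma>' (cotensor_transpose C D L M N \<gamma>)"
          unfolding eq by (rule cotensor_transpose_transposes[OF \<gamma>(2)])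
      qed (rule Y_slice, rule \<gamma>, assumption)+
    qed
    show "cotensor_transpose C D L M N ` carr Y = carr Z"
    proof
      show "cotensor_transpose C D L M N ` carr Y \<subseteq> carr Z" using cotensor_transpose_carr by blast
      show "carr Z \<subseteq> cotensor_transpose C D L M N ` carr Y"
      proof
        fix \<beta> assume \<beta>: "\<beta> \<in> carr Z"
        then have \<beta>h: "\<beta> \<in> hom_set (dual X) L" by (simp add: Z_iff)
        obtain \<gamma> where \<gamma>: "\<gamma> \<in> hom_set N (L \<otimes> M)" "\<And>\<nu>. lin L fld \<nu> \<Longrightarrow> lapply L M \<nu> \<circ> \<gamma> \<in> carr X"
          "transposes D L M N \<gamma> \<beta>"
          using transpose_exists_left[OF \<beta>h] by blast
        have "\<gamma> \<in> carr Y"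
          unfolding Y_iff using \<gamma> transposes_equivariant_iff[OF \<beta>h \<gamma>(3,2)] \<beta>[unfolded Z_iff] by blast
        then show "\<beta> \<in> cotensor_transpose C D L M N ` carr Y"
          using cotensor_transpose_eqI[OF _ \<beta>h \<gamma>(3)] by blast
      qed
    qed
  qed
qed

end

section \<open>Naturality\<close>

lemma ract_hom:
  assumes D: "vec D" and M: "right_comodule D M" and M': "right_comodule D M'"
    and g: "right_comodule_hom D M M' g" and \<xi>: "lin D fld \<xi>" and m: "m \<in> carr M"
  shows "ract D M' \<xi> (g m) = g (ract D M \<xi> m)"
proof -
  note R = right_comoduleD[OF M] and R' = right_comoduleD[OF M']
  have gl: "lin_on M M' g" using g by (simp add: right_comodule_hom_def lin_imp_lin_on)
  have "rcoact M' (g m) = tmap M D M' D g (\<lambda>x. x) (rcoact M m)"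
    using g m by (simp add: right_comodule_hom_def)
  then show ?thesis
    by (simp add: ract_def rapply_tmap[OF R(2) R'(2) gl lin_on_id lin_imp_lin_on[OF \<xi>] lin_on_carr[OF R(4) m]])
qed

lemma lact_hom:
  assumes C: "vec C" and M: "bicomodule C D M" and M': "bicomodule C D M'"
    and g: "bicomodule_hom C D M M' g" and f: "lin C fld f" and m: "m \<in> carr M"
  shows "lact C M' f (g m) = g (lact C M f m)"
proof -
  note B = bicomoduleD[OF M] and B' = bicomoduleD[OF M']
  have gl: "lin_on M M' g" using g by (simp add: bicomodule_hom_def right_comodule_hom_def lin_imp_lin_on)
  have "lcoact M' (g m) = tmap C M C M' (\<lambda>x. x) g (lcoact M m)"
    using g m by (simp add: bicomodule_hom_def)
  then show ?thesis
    by (simp add: lact_def lapply_tmap[OF C B'(3) lin_on_id gl lin_imp_lin_on[OF f] lin_on_carr[OF B(5) m] B(3)])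
qed

text \<open>All three maps commute with the action of \<open>\<xi> \<in> D\<^sup>*\<close>, which on \<open>N\<close> is \<open>n \<mapsto> \<theta>(e \<mapsto> \<xi>(e) n)\<close>.\<close>

lemma HomCC_map_carr:
  assumes D: "discrete_vec D" and N: "contra_space D N" and N': "contra_space D N'"
    and M: "right_comodule D M" and M': "right_comodule D M'"
    and g: "right_comodule_hom D M M' g" and u: "contramodule_hom D N' N u"
    and x: "x \<in> carr (HomCC D N M)"
  shows "g \<circ> x \<circ> u \<in> carr (HomCC D N' M')"
proof -
  note R = right_comoduleD[OF M] and R' = right_comoduleD[OF M']
  note iff = HomCC_iff[OF D N R(1,3)] and iff' = HomCC_iff[OF D N' R'(1,3)]
  have xh: "x \<in> hom_set N M" using x by (simp add: carr_HomCC)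
  have uh: "u \<in> hom_set N' N" using u by (simp add: contramodule_hom_def)
  have vN: "vec N" "vec N'" using N N' by (simp_all add: contra_space_def)
  have gl: "lin M M' g" using g by (simp add: right_comodule_hom_def)
  have "x \<circ> u \<in> hom_set N' M"
    using xh uh lin_comp[OF vN(1) hom_set_lin[OF uh] hom_set_lin[OF xh]]
    by (auto simp: hom_set_def intro: continuous_map_compose)
  then have "g \<circ> (x \<circ> u) \<in> hom_set N' M'" by (rule hom_set_comp_discrete[OF R(1) R'(2) _ gl])
  moreover have "rapply M' D \<xi> (rcoact M' (g (x (u n)))) = g (x (u (contra N' (\<lambda>e. sc N' (\<xi> e) n))))"
    if n: "n \<in> carr N'" and \<xi>: "lin D fld \<xi>" for n \<xi>
  proof -
    have un: "u n \<in> carr N" by (rule hom_set_carr[OF vN(1) uh])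
    have "(\<lambda>e. sc N' (\<xi> e) n) \<in> carr (Homk D N')"
      using lin_scalar_multiples[OF vN(2) \<xi> n] by (simp add: hom_set_discrete[OF D])
    then have "u (contra N' (\<lambda>e. sc N' (\<xi> e) n)) = contra N (u \<circ> (\<lambda>e. sc N' (\<xi> e) n))"
      using u by (simp add: contramodule_hom_def)
    also have "u \<circ> (\<lambda>e. sc N' (\<xi> e) n) = (\<lambda>e. sc N (\<xi> e) (u n))"
      by (rule ext) (simp add: lin_on_scale[OF lin_imp_lin_on[OF hom_set_lin[OF uh]] n])
    finally have "x (u (contra N' (\<lambda>e. sc N' (\<xi> e) n))) = ract D M \<xi> (x (u n))"
      using x un \<xi> unfolding iff by (simp add: ract_def)
    then show ?thesis
      using ract_hom[OF discrete_vec_imp_vec[OF D] M M' g \<xi> hom_set_carr[OF R(2) xh], of "u n"]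
      by (simp add: ract_def)
  qed
  ultimately show ?thesis unfolding iff' by (simp add: comp_assoc)
qed

text \<open>For \<open>\<gamma>' = (f \<otimes> g) \<gamma> u\<close> and \<open>\<beta>' = f \<beta> h(g, u)\<close>, with \<open>\<beta>\<close> the transpose of \<open>\<gamma>\<close>, both \<open>\<nu>(\<beta>'(n))\<close> and
  \<open>n(\<gamma>'\<^sub>\<nu>)\<close> are equal to \<open>n(g \<gamma>\<^bsub>\<nu> f\<^esub> u)\<close>.  Hence \<open>\<beta>'\<close> is the transpose of \<open>\<gamma>'\<close>.\<close>

lemma cotensor_transpose_natural:
  fixes C :: "('k::field, 'c::ab_group_add) coalg" and D :: "('k, 'd::ab_group_add) coalg"
    and L :: "('k, 'c, 'l::ab_group_add) rcomod" and L' :: "('k, 'c, 'l2::ab_group_add) rcomod"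
    and M :: "('k, 'c, 'd, 'm::ab_group_add) bicomod" and M' :: "('k, 'c, 'd, 'm2::ab_group_add) bicomod"
    and N :: "('k, 'd, 'n::ab_group_add) contramod" and N' :: "('k, 'd, 'n2::ab_group_add) contramod"
  assumes C: "discrete_vec C" and D: "discrete_vec D"
    and L: "right_comodule C L" and L': "right_comodule C L'" and f: "right_comodule_hom C L L' f"
    and M: "bicomodule C D M" and M': "bicomodule C D M'" and g: "bicomodule_hom C D M M' g"
    and N: "contramodule D N" and N': "contramodule D N'" and u: "contramodule_hom D N' N u"
    and \<gamma>: "\<gamma> \<in> carr (HomCC D N (cotensor C D L M))"
  shows "cotensor_transpose C D L' M' N'
      (HomCC_map D N (cotensor C D L M) u (cotensor_map C L M L' M' f g) \<gamma>)
    = HomCC_map C (hfun C D M N) L (hfun_map D M N M' N' g u) f (cotensor_transpose C D L M N \<gamma>)"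
proof -
  interpret A: cotensor_hom C D L M N by unfold_locales (rule C D L M N)+
  interpret B: cotensor_hom C D L' M' N' by unfold_locales (rule C D L' M' N')+
  let ?P = "cotensor_space C L M"
  let ?\<beta> = "cotensor_transpose C D L M N \<gamma>"
  define \<gamma>' where "\<gamma>' = tmap L M L' M' f g \<circ> \<gamma> \<circ> u"
  define \<beta>' where "\<beta>' = f \<circ> ?\<beta> \<circ> hfun_map D M N M' N' g u"
  have uh: "u \<in> hom_set N' N" using u by (simp add: contramodule_hom_def)
  have fl: "lin L L' f" using f by (simp add: right_comodule_hom_def)
  have gr: "right_comodule_hom D M M' g" using g by (simp add: bicomodule_hom_def)
  have gl: "lin M M' g" using gr by (simp add: right_comodule_hom_def)
  note fl' = lin_imp_lin_on[OF fl] and gl' = lin_imp_lin_on[OF gl]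
  note \<gamma>i = \<gamma>[unfolded A.Y_iff]
  have \<gamma>h: "\<gamma> \<in> hom_set N (L \<otimes> M)" using \<gamma>i by blast
  note \<gamma>c = hom_set_carr[OF vec_tensor \<gamma>h]
  have lL: "lin L fld (\<nu> \<circ> f)" if "lin L' fld \<nu>" for \<nu>
    by (rule lin_comp[OF B.L'(2) fl that])
  have slice: "lapply L' M' \<nu> \<circ> \<gamma>' = g \<circ> (lapply L M (\<nu> \<circ> f) \<circ> \<gamma>) \<circ> u" if "lin L' fld \<nu>" for \<nu>
    using lapply_tmap[OF A.L'(2) B.M'(2) fl' gl' lin_imp_lin_on[OF that] \<gamma>c A.M'(2)]
    by (simp add: fun_eq_iff \<gamma>'_def comp_def)
  have \<gamma>P: "\<gamma> n \<in> carr ?P" for n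
    unfolding carr_cotensor_space_iff[OF A.C' L M] using \<gamma>i \<gamma>c[of n] by (auto simp: fun_eq_iff)
  have \<gamma>'_eq: "HomCC_map D N (cotensor C D L M) u (cotensor_map C L M L' M' f g) \<gamma> = \<gamma>'"
    using \<gamma> \<gamma>P by (simp add: HomCC_map_def \<gamma>'_def cotensor_map_def fun_eq_iff)
  have "\<gamma> \<circ> u \<in> hom_set N' (L \<otimes> M)"
    using \<gamma>h uh lin_comp[OF A.N'(1) hom_set_lin[OF uh] hom_set_lin[OF \<gamma>h]]
    by (auto simp: hom_set_def intro: continuous_map_compose)
  then have \<gamma>'h: "\<gamma>' \<in> hom_set N' (L' \<otimes> M')"
    unfolding \<gamma>'_def comp_assoc
    by (rule hom_set_comp_discrete[OF discrete_vec_tensor vec_tensor _ lin_tmap[OF fl' gl']])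
  have mapX: "g \<circ> x \<circ> u \<in> carr B.X" if "x \<in> carr A.X" for x
    by (rule HomCC_map_carr[OF D A.cN B.cN bicomoduleD(1)[OF M] bicomoduleD(1)[OF M'] gr u that])
  have \<gamma>'Y: "\<gamma>' \<in> carr B.Y"
    unfolding B.Y_iff
  proof (intro conjI allI impI \<gamma>'h)
    fix \<nu> :: "'l2 \<Rightarrow> 'k" assume \<nu>: "lin L' fld \<nu>"
    show "lapply L' M' \<nu> \<circ> \<gamma>' \<in> carr B.X"
      unfolding slice[OF \<nu>] by (rule mapX[OF A.Y_slice[OF \<gamma> lL[OF \<nu>]]])
    fix \<phi> :: "'c \<Rightarrow> 'k" assume \<phi>: "lin C fld \<phi>"
    have "\<nu> \<circ> ract C L' \<phi> \<circ> f = \<nu> \<circ> f \<circ> ract C L \<phi>"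
    proof (rule lin_cancel_outside[OF lL[OF B.lin_conv[OF \<nu> \<phi>]] A.lin_conv[OF lL[OF \<nu>] \<phi>]])
      show "(\<nu> \<circ> ract C L' \<phi> \<circ> f) l = (\<nu> \<circ> f \<circ> ract C L \<phi>) l" if "l \<in> carr L" for l
        using ract_hom[OF A.C' L L' f \<phi> that] by simp
    qed
    then have "lapply L' M' (\<nu> \<circ> ract C L' \<phi>) \<circ> \<gamma>' = g \<circ> (lapply L M (\<nu> \<circ> f \<circ> ract C L \<phi>) \<circ> \<gamma>) \<circ> u"
      unfolding slice[OF B.lin_conv[OF \<nu> \<phi>]] by simp
    also have "\<dots> = g \<circ> (lact C M \<phi> \<circ> (lapply L M (\<nu> \<circ> f) \<circ> \<gamma>)) \<circ> u"
      using \<gamma>i lL[OF \<nu>] \<phi> by simp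
    also have "\<dots> = lact C M' \<phi> \<circ> (g \<circ> (lapply L M (\<nu> \<circ> f) \<circ> \<gamma>) \<circ> u)"
      using lact_hom[OF A.C' M M' g \<phi> hom_set_carr[OF A.M'(2) A.X_hom[OF A.Y_slice[OF \<gamma> lL[OF \<nu>]]]]]
      by (simp add: fun_eq_iff)
    finally show "lapply L' M' (\<nu> \<circ> ract C L' \<phi>) \<circ> \<gamma>' = lact C M' \<phi> \<circ> (lapply L' M' \<nu> \<circ> \<gamma>')"
      unfolding slice[OF \<nu>] .
  qed
  have hmap: "hfun_map D M N M' N' g u n
      = (\<lambda>x. if x \<in> carr A.X then n (g \<circ> x \<circ> u) else 0)" if n: "lin B.X fld n" for n
    using n lin_on_zero[OF B.X' lin_imp_lin_on[OF n]]
    by (auto simp: hfun_map_def dual_map_def HomCC_map_def hom_set_discrete[OF B.discrete_vec_X] fun_eq_iff)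
  have hmap_lin: "lin A.X fld (hfun_map D M N M' N' g u n)" if n: "lin B.X fld n" for n
  proof -
    have "lin_on A.X B.X (\<lambda>x. g \<circ> x \<circ> u)"
      unfolding lin_on_def using mapX hom_set_carr[OF A.M'(2) A.X_hom]
      by (auto simp: fun_eq_iff sc_HomCC lin_on_add[OF gl'] lin_on_scale[OF gl'])
    from lin_on_comp[OF this lin_imp_lin_on[OF n]] show ?thesis
      unfolding hmap[OF n] lin_iff lin_on_def using vec_add[OF A.X'] vec_scale[OF A.X'] by simp
  qed
  have cA: "carr (dual A.X) = {n. lin A.X fld n}" and cB: "carr (dual B.X) = {n. lin B.X fld n}"
    by (simp_all add: hom_set_discrete[OF A.discrete_vec_X] hom_set_discrete[OF B.discrete_vec_X])
  let ?h = "hfun_map D M N M' N' g u"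
  have hh: "?h \<in> hom_set (dual B.X) (dual A.X)"
    unfolding hom_set_def
  proof (intro CollectI conjI)
    have dB: "vec (dual B.X)" by (rule vec_Homk_discrete[OF B.discrete_vec_X vec_fld])
    show "lin (dual B.X) (dual A.X) ?h"
      unfolding lin_iff lin_on_def
    proof (intro conjI ballI allI impI)
      show "?h n \<in> carr (dual A.X)" if "n \<in> carr (dual B.X)" for n
        using hmap_lin that unfolding cA cB by blast
      show "?h (n + n') = ?h n + ?h n'" if "n \<in> carr (dual B.X)" "n' \<in> carr (dual B.X)" for n n'
        using that vec_add[OF dB that] unfolding cB by (simp add: hmap fun_eq_iff)
      show "?h (sc (dual B.X) c n) = sc (dual A.X) c (?h n)" if "n \<in> carr (dual B.X)" for c n
        using that vec_scale[OF dB that, of c] unfolding cB by (simp add: hmap fun_eq_iff sc_Homk)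
      show "?h n = 0" if "n \<notin> carr (dual B.X)" for n
        using that by (simp add: hfun_map_def dual_map_def)
    qed
    show "continuous_map (tp (dual B.X)) (tp (dual A.X)) ?h"
    proof (rule continuous_map_into_Homk[OF A.discrete_vec_X])
      show "?h \<in> carr (dual B.X) \<rightarrow> hom_set A.X fld"
        using hmap_lin cB by (auto simp: hom_set_discrete[OF A.discrete_vec_X])
      fix x assume x: "x \<in> carr A.X"
      show "continuous_map (tp (dual B.X)) (tp fld) (\<lambda>n. ?h n x)"
        by (rule continuous_map_eq[OF continuous_map_evaluation[OF mapX[OF x]]])
          (use cB x in \<open>simp add: hmap\<close>)
    qed
  qed
  note \<beta>h = A.cotensor_transpose_hom[OF \<gamma>]
  have dA: "vec (dual A.X)" by (rule vec_Homk_discrete[OF A.discrete_vec_X vec_fld])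
  have "?\<beta> \<circ> ?h \<in> hom_set (dual B.X) L"
    using hh \<beta>h lin_comp[OF dA hom_set_lin[OF hh] hom_set_lin[OF \<beta>h]]
    by (auto simp: hom_set_def intro: continuous_map_compose)
  then have \<beta>'h: "\<beta>' \<in> hom_set (dual B.X) L'"
    unfolding \<beta>'_def comp_assoc by (rule hom_set_comp_discrete[OF A.L'(1) B.L'(2) _ fl])
  have "transposes D L' M' N' \<gamma>' \<beta>'"
    unfolding transposes_def
  proof (intro allI impI)
    fix \<nu> n assume \<nu>: "lin L' fld \<nu>" and n: "lin B.X fld n"
    have "\<nu> (\<beta>' n) = (\<nu> \<circ> f) (?\<beta> (?h n))" by (simp add: \<beta>'_def)
    also have "\<dots> = ?h n (lapply L M (\<nu> \<circ> f) \<circ> \<gamma>)"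
      by (rule transposesD[OF A.cotensor_transpose_transposes[OF \<gamma>] lL[OF \<nu>] hmap_lin[OF n]])
    also have "\<dots> = n (lapply L' M' \<nu> \<circ> \<gamma>')"
      unfolding slice[OF \<nu>] hmap[OF n] using A.Y_slice[OF \<gamma> lL[OF \<nu>]] by simp
    finally show "\<nu> (\<beta>' n) = n (lapply L' M' \<nu> \<circ> \<gamma>')" .
  qed
  then have "cotensor_transpose C D L' M' N' \<gamma>' = \<beta>'"
    by (rule B.cotensor_transpose_eqI[OF \<gamma>'Y \<beta>'h])
  then show ?thesis
    using A.cotensor_transpose_carr[OF \<gamma>] unfolding \<gamma>'_eq by (simp add: HomCC_map_def \<beta>'_def)
qed

theorem corollary4p3:
  fixes C :: "('k::field, 'c::ab_group_add) coalg"
    and D :: "('k, 'd::ab_group_add) coalg"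
  assumes "coalgebra C" and "coalgebra D"
  shows "\<exists>\<Phi> :: ('k, 'c, 'l::ab_group_add) rcomod \<Rightarrow> ('k, 'c, 'd, 'm::ab_group_add) bicomod
      \<Rightarrow> ('k, 'd, 'n::ab_group_add) contramod
      \<Rightarrow> ('n \<Rightarrow> ('k, 'l, 'm) tensor) \<Rightarrow> ((('n \<Rightarrow> 'm) \<Rightarrow> 'k) \<Rightarrow> 'l).
    (\<forall>L M N. right_comodule C L \<longrightarrow> bicomodule C D M \<longrightarrow> contramodule D N \<longrightarrow>
       lin_iso (HomCC D N (cotensor C D L M)) (HomCC C (hfun C D M N) L) (\<Phi> L M N))
    \<and> (\<forall>L L' M M' N N' f g u.
         right_comodule C L \<longrightarrow> right_comodule C L' \<longrightarrow> right_comodule_hom C L L' f \<longrightarrow>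
         bicomodule C D M \<longrightarrow> bicomodule C D M' \<longrightarrow> bicomodule_hom C D M M' g \<longrightarrow>
         contramodule D N \<longrightarrow> contramodule D N' \<longrightarrow> contramodule_hom D N' N u \<longrightarrow>
         (\<forall>\<gamma>\<in>carr (HomCC D N (cotensor C D L M)).
            \<Phi> L' M' N' (HomCC_map D N (cotensor C D L M) u (cotensor_map C L M L' M' f g) \<gamma>)
            = HomCC_map C (hfun C D M N) L (hfun_map D M N M' N' g u) f (\<Phi> L M N \<gamma>)))"
proof -
  have C: "discrete_vec C" and D: "discrete_vec D"
    using assms unfolding coalgebra_def by blast+
  show ?thesis
  proof (intro exI[of _ "cotensor_transpose C D"] conjI allI impI ballI)
    fix L :: "('k, 'c, 'l) rcomod" and M :: "('k, 'c, 'd, 'm) bicomod" and N :: "('k, 'd, 'n) contramod"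
    assume "right_comodule C L" "bicomodule C D M" "contramodule D N"
    then interpret cotensor_hom C D L M N by unfold_locales (rule C D | assumption)+
    show "lin_iso (HomCC D N (cotensor C D L M)) (HomCC C (hfun C D M N) L) (cotensor_transpose C D L M N)"
      by (rule lin_iso_cotensor_transpose)
  qed (rule cotensor_transpose_natural[OF C D]; assumption)
qed

end
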